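(* Let $\Gamma$ be a tournament limit. The following are equivalent: (i) $\Gamma$ is uniquely determined by its degree distribution, i.e. every tournament limit $\Gamma_0$ with $\nu(\Gamma_0)=\nu(\Gamma)$ equals $\Gamma$; (ii) $\Gamma$ is uniquely determined by its outdegree distribution, i.e. every tournament limit $\Gamma_0$ with $\nu^+(\Gamma_0)=\nu^+(\Gamma)$ equals $\Gamma$; (iii) $\nu^+(\Gamma)$ is the uniform distribution $U[0,1]$; (iv) $\nu^+(\Gamma)$ is the law of $f(U)$, $U\sim U[0,1]$, for some measure-preserving transformation $f:[0,1]\to[0,1]$; (v) $t(\mathsf{S}_{1,1},\Gamma)=1/6$; (vi) $\Gamma$ is the transitive limit, i.e. $t(\mathsf{C}_3,\Gamma)=0$.
   Context: A digraph $F$ has a finite vertex set $V(F)$ and an edge set $E(F)\subseteq\{(u,v)\in V(F)^2: u\neq v\}$. A tournament is a digraph in which for every pair of distinct vertices exactly one of the two ordered pairs is an edge. For digraphs $F,G$ let $t(F,G)=\hom(F,G)/|V(G)|^{|V(F)|}$, where $\hom(F,G)$ is the number of maps $\phi:V(F)\to V(G)$ with $(\phi(i),\phi(j))\in E(G)$ whenever $(i,j)\in E(F)$. A sequence of tournaments $(G_n)$ with $|V(G_n)|\to\infty$ is convergent if $t(F,G_n)$ converges for every digraph $F$; a tournament limit $\Gamma$ is the family $t(F,\Gamma):=\lim_n t(F,G_n)$ of some convergent sequence; two limits are equal iff all these numbers agree. For $m,n\ge0$, $\mathsf{S}_{m,n}$ is the digraph on disjoint sets $A_1\cup A_2\cup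 A_3$ with $|A_1|=m,|A_2|=1,|A_3|=n$ and edges $(u,v)$ for $u\in A_i,v\in A_j,i<j$. The degree distribution $\nu(\Gamma)$ is the unique probability distribution on $[0,1]^2$ with $\int x^my^n\,d\nu(\Gamma)=t(\mathsf{S}_{m,n},\Gamma)$ for all $m,n$; its second marginal $\nu^+(\Gamma)$ is the outdegree distribution. $\mathsf{C}_3$ is the digraph with vertex set $\{1,2,3\}$ and edges $(1,2),(2,3),(3,1)$.
   Formalization: S_{m,n} has only the edges from A_1 to A_2 and from A_2 to A_3 (none from A_1 to A_3), both in ν(Γ) and in (v): with the extra edges no distribution ν(Γ) has the required moments for a limit of regular tournaments. *)

theory Defs
  imports "HOL-Probability.Probability" "Graph_Theory.Pair_Digraph"
begin

(* A digraph is a pair_digraph: finite vertex set, arcs are ordered pairs of vertices, no loops.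
   Vertices are natural numbers; every finite digraph is isomorphic to one of these, and
   densities are isomorphism invariant. *)

definition tournament :: "'a pair_pre_digraph \<Rightarrow> bool" where
  "tournament G \<longleftrightarrow> pair_digraph G \<and>
     (\<forall>u\<in>pverts G. \<forall>v\<in>pverts G. u \<noteq> v \<longrightarrow> ((u, v) \<in> parcs G \<longleftrightarrow> (v, u) \<notin> parcs G))"

definition hom_count :: "'a pair_pre_digraph \<Rightarrow> 'b pair_pre_digraph \<Rightarrow> nat" where
  "hom_count F G =
     card {\<phi> \<in> pverts F \<rightarrow>\<^sub>E pverts G. \<forall>(i, j)\<in>parcs F. (\<phi> i, \<phi> j) \<in> parcs G}"

definition hom_density :: "'a pair_pre_digraph \<Rightarrow> 'b pair_pre_digraph \<Rightarrow> real" where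
  "hom_density F G = real (hom_count F G) / real (card (pverts G)) ^ card (pverts F)"

(* A tournament limit is the family of its densities, indexed by all digraphs. The family is
   undefined outside that index set, so equality of limits is equality of functions. *)

type_synonym density_family = "nat pair_pre_digraph \<Rightarrow> real"

definition convergent_tournaments :: "(nat \<Rightarrow> nat pair_pre_digraph) \<Rightarrow> bool" where
  "convergent_tournaments G \<longleftrightarrow>
     (\<forall>n. tournament (G n)) \<and>
     filterlim (\<lambda>n. card (pverts (G n))) at_top sequentially \<and>
     (\<forall>F :: nat pair_pre_digraph. pair_digraph F \<longrightarrow> convergent (\<lambda>n. hom_density F (G n)))"

definition tournament_limit :: "density_family \<Rightarrow> bool" where
  "tournament_limit \<Gamma> \<longleftrightarrow>
     (\<exists>G. convergent_tournaments G \<and>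
          \<Gamma> = (\<lambda>F\<in>{F. pair_digraph F}. lim (\<lambda>n. hom_density F (G n))))"

(* The three parts are {..<m}, {m} and {m<..m + n}. Only consecutive parts are joined: the
   density of this digraph is the joint moment of the normalised indegree and outdegree of a
   random vertex, as the definition of the degree distribution requires. If the first part
   were also joined to the third, then that definition would be unsatisfiable in general:
   for a limit of regular tournaments the moments with m = 0 or n = 0 force the point mass at
   (1/2, 1/2), whose mixed moment of order (1, 1) is 1/4, whereas the density of the
   transitive triangle in a tournament limit is at most 1/6. *)

definition S_digraph :: "nat \<Rightarrow> nat \<Rightarrow> nat pair_pre_digraph" where
  "S_digraph m n =
     \<lparr> pverts = {..<m} \<union> {m} \<union> {m<..m + n},
       parcs = {..<m} \<times> {m} \<union> {m} \<times> {m<..m + n} \<rparr>"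

definition C3_digraph :: "nat pair_pre_digraph" where
  "C3_digraph = \<lparr> pverts = {1, 2, 3}, parcs = {(1, 2), (2, 3), (3, 1)} \<rparr>"

lemma pair_digraph_S_digraph: "pair_digraph (S_digraph m n)"
  by unfold_locales (auto simp: S_digraph_def)

lemma pair_digraph_C3_digraph: "pair_digraph C3_digraph"
  by unfold_locales (auto simp: C3_digraph_def)

definition degree_distribution :: "density_family \<Rightarrow> (real \<times> real) measure" where
  "degree_distribution \<Gamma> =
     (THE \<nu>. prob_space \<nu> \<and> sets \<nu> = sets borel \<and>
             measure \<nu> ({0..1} \<times> {0..1}) = 1 \<and>
             (\<forall>m n. (\<integral>(x, y). x ^ m * y ^ n \<partial>\<nu>) = \<Gamma> (S_digraph m n)))"

definition outdegree_distribution :: "density_family \<Rightarrow> real measure" where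
  "outdegree_distribution \<Gamma> = distr (degree_distribution \<Gamma>) borel snd"

definition measure_preserving :: "'a measure \<Rightarrow> ('a \<Rightarrow> 'a) \<Rightarrow> bool" where
  "measure_preserving M f \<longleftrightarrow>
     f \<in> measurable M M \<and> (\<forall>A\<in>sets M. emeasure M (f -` A \<inter> space M) = emeasure M A)"

(* The probability space [0,1] with Lebesgue measure. *)
abbreviation unit_interval :: "real measure" where
  "unit_interval \<equiv> restrict_space lborel {0..1}"

end

(* Every equivalence except one reduces to t(S_{1,1}) = 1/6 + (2/3) t(C_3) and to the fact that a
   limit without cyclic triangles is unique: almost all k-tuples of vertices then span transitive
   tournaments, so t(F) is the proportion of linear orders of V(F) that extend F.

   The remaining implication is that a limit with t(C_3) > 0 shares its degree distribution with
   another limit. In a finite tournament with adjacency matrix w, colour the vertices so that many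
   cyclic triangles have one fixed colour pattern, and let P be the (fractional) reversal of those
   triangles. The weighted tournaments w, w + P/2 and w + P have the same scores, while the density
   of K_{2,2} (oriented from one side to the other), being the fourth power of a Schatten norm, is
   uniformly convex along this segment. Hence the three densities cannot be almost equal. A weighted
   tournament is replaced by a genuine one by rounding its entries one at a time, which works because
   the score error and the density of K_{2,2} are, up to lower order terms, affine in each entry.
   Compactness turns these tournaments into limits. *)

theory Submission
  imports Defs
begin

text \<open>A score-preserving change \<open>P\<close> of a tournament \<open>w\<close> proves
  nothing by itself: \<open>w\<close> and \<open>w + P\<close> may even be isomorphic, as when
  \<open>P\<close> reverses a regular tournament that is isomorphic to its reverse. Strict convexity
  of one density excludes this, at the price of a third point. Quantitatively, the gap at the
  midpoint is twice the energy of P/2, hence an eighth of the energy of \<open>P\<close>. That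
  energy is bounded below by an entry sum over a rectangle, and this sum by the weight of the cyclic
  triangles of one colour pattern, which for some colouring with 3 colours is at least 1/27 of the
  total. This is the origin of the quantity (t(C_3)/27)^4 / 8.

  Rounding needs to control the energy on one side only: from above at the midpoint, from below at
  the end point. So a single objective, a large multiple of the squared score error plus or minus
  the energy, can be rounded deterministically. Limits are taken only at the very end, where a
  determined limit forces the three densities of K_{2,2} to a common value.\<close>

section \<open>Convexity of the codegree energy\<close>

text \<open>The trace of (W W^T)^2, that is, the fourth power of the Schatten 4-norm of the matrix
  \<open>W\<close>. For signed \<open>W\<close> it remains meaningful, which is needed for the
  perturbation \<open>P\<close>.\<close>

definition codegree_energy :: "'a set \<Rightarrow> ('a \<Rightarrow> 'a \<Rightarrow> real) \<Rightarrow> real" where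
  "codegree_energy V W = (\<Sum>x\<in>V. \<Sum>x'\<in>V. (\<Sum>y\<in>V. W x y * W x' y)\<^sup>2)"

text \<open>This is the trace of M M^T D D^T. Exchanging the order of summation exhibits it as the
  squared Frobenius norm of M^T D.\<close>

lemma codegree_energy_inner_nonneg:
  fixes M D :: "'a \<Rightarrow> 'a \<Rightarrow> real"
  shows "0 \<le> (\<Sum>x\<in>V. \<Sum>x'\<in>V. (\<Sum>y\<in>V. M x y * M x' y) * (\<Sum>y\<in>V. D x y * D x' y))"
proof -
  have "(\<Sum>x\<in>V. \<Sum>x'\<in>V. (\<Sum>y\<in>V. M x y * M x' y) * (\<Sum>y\<in>V. D x y * D x' y))
      = (\<Sum>x\<in>V. \<Sum>x'\<in>V. \<Sum>y\<in>V. \<Sum>y'\<in>V. (M x y * D x y') * (M x' y * D x' y'))"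
    by (simp only: sum_product) (simp only: mult_ac)
  also have "\<dots> = (\<Sum>x\<in>V. \<Sum>y\<in>V. \<Sum>x'\<in>V. \<Sum>y'\<in>V. (M x y * D x y') * (M x' y * D x' y'))"
    by (rule sum.cong[OF refl], rule sum.swap)
  also have "\<dots> = (\<Sum>y\<in>V. \<Sum>x\<in>V. \<Sum>x'\<in>V. \<Sum>y'\<in>V. (M x y * D x y') * (M x' y * D x' y'))"
    by (rule sum.swap)
  also have "\<dots> = (\<Sum>y\<in>V. \<Sum>x\<in>V. \<Sum>y'\<in>V. \<Sum>x'\<in>V. (M x y * D x y') * (M x' y * D x' y'))"
    by (rule sum.cong[OF refl], rule sum.cong[OF refl], rule sum.swap)
  also have "\<dots> = (\<Sum>y\<in>V. \<Sum>y'\<in>V. \<Sum>x\<in>V. \<Sum>x'\<in>V. (M x y * D x y') * (M x' y * D x' y'))"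
    by (rule sum.cong[OF refl], rule sum.swap)
  also have "\<dots> = (\<Sum>y\<in>V. \<Sum>y'\<in>V. (\<Sum>x\<in>V. M x y * D x y')\<^sup>2)"
    by (simp add: power2_eq_square sum_product)
  also have "\<dots> \<ge> 0" by (intro sum_nonneg) simp
  finally show ?thesis .
qed

text \<open>The Gram matrices of M + D and M - D are \<open>m + d + q\<close> and
  \<open>m + d - q\<close>. Adding the squares of their entries cancels everything linear in
  \<open>q\<close>; the square of \<open>q\<close> is dropped, and the cross term of
  \<open>m\<close> and \<open>d\<close> has a nonnegative sum by
  \<open>codegree_energy_inner_nonneg\<close>.\<close>

lemma codegree_energy_uniformly_convex:
  "2 * codegree_energy V M + 2 * codegree_energy V D
    \<le> codegree_energy V (\<lambda>x y. M x y + D x y) + codegree_energy V (\<lambda>x y. M x y - D x y)"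
proof -
  define m d q where "m x x' = (\<Sum>y\<in>V. M x y * M x' y)"
    and "d x x' = (\<Sum>y\<in>V. D x y * D x' y)"
    and "q x x' = (\<Sum>y\<in>V. M x y * D x' y + D x y * M x' y)" for x x'
  have plus: "(\<Sum>y\<in>V. (M x y + D x y) * (M x' y + D x' y)) = m x x' + d x x' + q x x'" for x x'
    unfolding m_def d_def q_def by (simp add: sum.distrib algebra_simps)
  have minus: "(\<Sum>y\<in>V. (M x y - D x y) * (M x' y - D x' y)) = m x x' + d x x' - q x x'" for x x'
    unfolding m_def d_def q_def by (simp add: sum.distrib sum_subtractf algebra_simps)
  have "0 \<le> (\<Sum>x\<in>V. \<Sum>x'\<in>V. m x x' * d x x')"
    unfolding m_def d_def by (rule codegree_energy_inner_nonneg)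
  hence "2 * codegree_energy V M + 2 * codegree_energy V D
      \<le> 2 * codegree_energy V M + 2 * codegree_energy V D + 4 * (\<Sum>x\<in>V. \<Sum>x'\<in>V. m x x' * d x x')"
    by simp
  also have "\<dots> = (\<Sum>x\<in>V. \<Sum>x'\<in>V. 2 * (m x x')\<^sup>2 + 2 * (d x x')\<^sup>2 + 4 * (m x x' * d x x'))"
    unfolding codegree_energy_def m_def d_def by (simp add: sum.distrib sum_distrib_left)
  also have "\<dots> \<le> (\<Sum>x\<in>V. \<Sum>x'\<in>V. (m x x' + d x x' + q x x')\<^sup>2 + (m x x' + d x x' - q x x')\<^sup>2)"
  proof (intro sum_mono)
    fix x x'
    have "(m x x' + d x x' + q x x')\<^sup>2 + (m x x' + d x x' - q x x')\<^sup>2 =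
       2 * (m x x')\<^sup>2 + 2 * (d x x')\<^sup>2 + 4 * (m x x' * d x x') + 2 * (q x x')\<^sup>2"
      by (simp add: power2_eq_square algebra_simps)
    then show "2 * (m x x')\<^sup>2 + 2 * (d x x')\<^sup>2 + 4 * (m x x' * d x x')
      \<le> (m x x' + d x x' + q x x')\<^sup>2 + (m x x' + d x x' - q x x')\<^sup>2" by simp
  qed
  also have "\<dots> = codegree_energy V (\<lambda>x y. M x y + D x y) + codegree_energy V (\<lambda>x y. M x y - D x y)"
    unfolding codegree_energy_def plus minus by (simp add: sum.distrib)
  finally show ?thesis .
qed

lemma sum_square_le_card:
  fixes f :: "'a \<Rightarrow> real"
  shows "(\<Sum>x\<in>A. f x)\<^sup>2 \<le> card A * (\<Sum>x\<in>A. (f x)\<^sup>2)"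
  using Cauchy_Schwarz_ineq_sum[of "\<lambda>_. 1" f A] by simp

text \<open>Cauchy-Schwarz over \<open>y\<close> turns the entry sum into a sum of codegrees
  \<open>c x x'\<close>, and Cauchy-Schwarz over the pairs \<open>x\<close>, \<open>x'\<close> turns
  this into the energy. It serves to show that a perturbation with a large rectangle sum has large
  energy.\<close>

lemma cut_le_codegree_energy:
  assumes "finite V" "X \<subseteq> V" "Y \<subseteq> V"
  shows "(\<Sum>x\<in>X. \<Sum>y\<in>Y. P x y) ^ 4 \<le> real (card V) ^ 4 * codegree_energy V P"
proof -
  define r where "r y = (\<Sum>x\<in>X. P x y)" for y
  define n where "n = real (card V)"
  have fin: "finite X" "finite Y" and le: "card X \<le> card V" "card Y \<le> card V"
    using assms by (auto intro: finite_subset card_mono)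
  define c where "c x x' = (\<Sum>y\<in>V. P x y * P x' y)" for x x'
  have "(\<Sum>x\<in>X. \<Sum>y\<in>Y. P x y)\<^sup>2 = (\<Sum>y\<in>Y. r y)\<^sup>2"
    unfolding r_def by (subst sum.swap) simp
  also have "\<dots> \<le> card Y * (\<Sum>y\<in>Y. (r y)\<^sup>2)" by (rule sum_square_le_card)
  also have "\<dots> \<le> n * (\<Sum>y\<in>V. (r y)\<^sup>2)"
    unfolding n_def using le assms by (intro mult_mono sum_mono2 sum_nonneg) auto
  also have "(\<Sum>y\<in>V. (r y)\<^sup>2) = (\<Sum>y\<in>V. \<Sum>x\<in>X. \<Sum>x'\<in>X. P x y * P x' y)"
    by (simp add: r_def power2_eq_square sum_product)
  also have "\<dots> = (\<Sum>x\<in>X. \<Sum>y\<in>V. \<Sum>x'\<in>X. P x y * P x' y)" by (rule sum.swap)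
  also have "\<dots> = (\<Sum>x\<in>X. \<Sum>x'\<in>X. c x x')"
    unfolding c_def by (rule sum.cong[OF refl], rule sum.swap)
  finally have 1: "(\<Sum>x\<in>X. \<Sum>y\<in>Y. P x y)\<^sup>2 \<le> n * (\<Sum>x\<in>X. \<Sum>x'\<in>X. c x x')" .
  have "(\<Sum>x\<in>X. \<Sum>x'\<in>X. c x x')\<^sup>2 \<le> card X * (\<Sum>x\<in>X. (\<Sum>x'\<in>X. c x x')\<^sup>2)"
    by (rule sum_square_le_card)
  also have "\<dots> \<le> card X * (\<Sum>x\<in>X. card X * (\<Sum>x'\<in>X. (c x x')\<^sup>2))"
    by (intro mult_left_mono sum_mono sum_square_le_card) auto
  also have "\<dots> \<le> n * (\<Sum>x\<in>V. n * (\<Sum>x'\<in>V. (c x x')\<^sup>2))"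
    unfolding n_def using le assms
    by (intro mult_mono order_trans[OF sum_mono2[of V X] sum_mono] sum_mono2 sum_nonneg mult_nonneg_nonneg) auto
  also have "\<dots> = n\<^sup>2 * codegree_energy V P"
    by (simp add: codegree_energy_def c_def sum_distrib_left power2_eq_square mult.assoc)
  finally have 2: "(\<Sum>x\<in>X. \<Sum>x'\<in>X. c x x')\<^sup>2 \<le> n\<^sup>2 * codegree_energy V P" .
  have "(\<Sum>x\<in>X. \<Sum>y\<in>Y. P x y) ^ 4 = ((\<Sum>x\<in>X. \<Sum>y\<in>Y. P x y)\<^sup>2)\<^sup>2" by simp
  also have "\<dots> \<le> (n * (\<Sum>x\<in>X. \<Sum>x'\<in>X. c x x'))\<^sup>2" using 1 by (intro power_mono) auto
  also have "\<dots> = n\<^sup>2 * (\<Sum>x\<in>X. \<Sum>x'\<in>X. c x x')\<^sup>2" by (simp add: power_mult_distrib)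
  also have "\<dots> \<le> n\<^sup>2 * (n\<^sup>2 * codegree_energy V P)" using 2 by (intro mult_left_mono) auto
  also have "\<dots> = n ^ 4 * codegree_energy V P" by (simp add: power2_eq_square eval_nat_numeral)
  finally show ?thesis unfolding n_def .
qed

section \<open>Rounding weighted tournaments\<close>

definition affine_real :: "(real \<Rightarrow> real) \<Rightarrow> bool" where
  "affine_real h \<longleftrightarrow> (\<exists>a b. \<forall>t. h t = a + b * t)"

definition const_real :: "(real \<Rightarrow> real) \<Rightarrow> bool" where
  "const_real h \<longleftrightarrow> (\<exists>c. \<forall>t. h t = c)"

lemma const_realI: "(\<And>t. h t = c) \<Longrightarrow> const_real h"
  by (auto simp: const_real_def)

lemma const_imp_affine: "const_real h \<Longrightarrow> affine_real h"
  unfolding affine_real_def const_real_def by (metis add.right_neutral mult_zero_left)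

lemma const_real_mult: "const_real p \<Longrightarrow> const_real q \<Longrightarrow> const_real (\<lambda>t. p t * q t)"
  by (auto simp: const_real_def)

lemma affine_real_cmult: assumes "affine_real p" shows "affine_real (\<lambda>t. c * p t)"
proof -
  from assms obtain a b where "\<And>t. p t = a + b * t" by (auto simp: affine_real_def)
  hence "\<forall>t. c * p t = c * a + (c * b) * t" by (simp add: algebra_simps)
  thus ?thesis unfolding affine_real_def by blast
qed

lemma affine_real_mult:
  assumes "affine_real p" "affine_real q" "const_real p \<or> const_real q"
  shows "affine_real (\<lambda>t. p t * q t)"
  using assms(3)
proof
  assume "const_real p"
  then obtain c where "\<And>t. p t = c" by (auto simp: const_real_def)
  thus ?thesis using affine_real_cmult[OF assms(2), of c] by simp
next
  assume "const_real q"
  then obtain c where "\<And>t. q t = c" by (auto simp: const_real_def)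
  thus ?thesis using affine_real_cmult[OF assms(1), of c] by (simp add: mult.commute)
qed

lemma affine_real_if: "(c \<Longrightarrow> affine_real p) \<Longrightarrow> affine_real (\<lambda>t. if c then p t else 0)"
  by (cases c) (auto intro: const_imp_affine const_realI)

lemma affine_real_add: assumes "affine_real p" "affine_real q" shows "affine_real (\<lambda>t. p t + q t)"
proof -
  from assms obtain a b a' b' where "\<And>t. p t = a + b * t" "\<And>t. q t = a' + b' * t"
    by (auto simp: affine_real_def)
  hence "\<forall>t. p t + q t = (a + a') + (b + b') * t" by (simp add: algebra_simps)
  thus ?thesis unfolding affine_real_def by blast
qed

lemma affine_real_sum: "(\<And>i. i \<in> I \<Longrightarrow> affine_real (f i)) \<Longrightarrow> affine_real (\<lambda>t. \<Sum>i\<in>I. f i t)"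
proof (induction I rule: infinite_finite_induct)
  case (insert i I)
  thus ?case by (simp add: affine_real_add)
qed (auto intro!: const_imp_affine const_realI)

text \<open>An affine function on [0,1] is at some end point no larger than at a given point, so the
  coordinates can be moved to 0 or 1 one after another. The induction freezes the coordinate
  \<open>e\<close> at the chosen end point \<open>s\<close>; hence affinity is required at every
  \<theta>, not just at the initial one.\<close>

lemma multiaffine_round:
  fixes \<Phi> :: "('e \<Rightarrow> real) \<Rightarrow> real"
  assumes "finite E" and "\<And>\<theta> e. e \<in> E \<Longrightarrow> affine_real (\<lambda>t. \<Phi> (\<theta>(e := t)))"
    and "\<And>e. e \<in> E \<Longrightarrow> 0 \<le> \<theta> e \<and> \<theta> e \<le> 1"
  shows "\<exists>\<theta>'. (\<forall>e\<in>E. \<theta>' e \<in> {0, 1}) \<and> \<Phi> \<theta>' \<le> \<Phi> \<theta>"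
  using assms
proof (induction E arbitrary: \<Phi> \<theta>)
  case empty
  thus ?case by auto
next
  case (insert e E)
  obtain a b where ab: "\<And>t. \<Phi> (\<theta>(e := t)) = a + b * t"
    using insert.prems(1)[of e \<theta>] unfolding affine_real_def by blast
  have "\<exists>s\<in>{0, 1}. \<Phi> (\<theta>(e := s)) \<le> \<Phi> \<theta>"
  proof (cases "b \<ge> 0")
    case True
    have "\<Phi> \<theta> = a + b * \<theta> e" using ab[of "\<theta> e"] by simp
    with True insert.prems(2)[of e] have "\<Phi> (\<theta>(e := 0)) \<le> \<Phi> \<theta>" by (simp add: ab)
    thus ?thesis by blast
  next
    case False
    have "\<Phi> \<theta> = a + b * \<theta> e" using ab[of "\<theta> e"] by simp
    moreover have "b * 1 \<le> b * \<theta> e" using False insert.prems(2)[of e]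
      by (intro mult_left_mono_neg) auto
    ultimately have "\<Phi> (\<theta>(e := 1)) \<le> \<Phi> \<theta>" by (simp add: ab)
    thus ?thesis by blast
  qed
  then obtain s where s: "s \<in> {0, 1}" "\<Phi> (\<theta>(e := s)) \<le> \<Phi> \<theta>" by blast
  have "\<exists>\<theta>'. (\<forall>e\<in>E. \<theta>' e \<in> {0, 1}) \<and> \<Phi> (\<theta>'(e := s)) \<le> \<Phi> (\<theta>(e := s))"
  proof (rule insert.IH[where \<Phi> = "\<lambda>\<theta>'. \<Phi> (\<theta>'(e := s))"])
    fix \<eta> e' assume "e' \<in> E"
    with insert.hyps have "e' \<noteq> e" by auto
    hence "(\<lambda>t. \<Phi> (\<eta>(e' := t, e := s))) = (\<lambda>t. \<Phi> (\<eta>(e := s, e' := t)))"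
      by (simp add: fun_upd_twist)
    thus "affine_real (\<lambda>t. \<Phi> (\<eta>(e' := t, e := s)))"
      using insert.prems(1)[of e' "\<eta>(e := s)"] \<open>e' \<in> E\<close> by (simp only: insertI2)
  qed (use insert.prems(2) in auto)
  then obtain \<theta>' where "\<forall>e\<in>E. \<theta>' e \<in> {0, 1}" "\<Phi> (\<theta>'(e := s)) \<le> \<Phi> \<theta>"
    using s(2) by (meson order_trans)
  moreover from this s(1) have "\<forall>e'\<in>insert e E. (\<theta>'(e := s)) e' \<in> {0, 1}" by simp
  ultimately show ?case by blast
qed

definition weighted_tournament :: "'a set \<Rightarrow> ('a \<Rightarrow> 'a \<Rightarrow> real) \<Rightarrow> bool" where
  "weighted_tournament V W \<longleftrightarrow>
     (\<forall>x\<in>V. \<forall>y\<in>V. 0 \<le> W x y \<and> (x \<noteq> y \<longrightarrow> W x y + W y x = 1)) \<and> (\<forall>x. W x x = 0)"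

text \<open>One free parameter for each unordered pair: changing it moves both opposite entries, so
  the constraint that they add up to 1 cannot be violated while rounding.\<close>

definition orientation :: "('a::linorder \<times> 'a \<Rightarrow> real) \<Rightarrow> 'a \<Rightarrow> 'a \<Rightarrow> real" where
  "orientation \<theta> x y = (if x < y then \<theta> (x, y) else if y < x then 1 - \<theta> (y, x) else 0)"

lemma const_orientation:
  assumes "\<not> (x = a \<and> y = b)" "\<not> (x = b \<and> y = a)"
  shows "const_real (\<lambda>t. orientation (\<theta>((a, b) := t)) x y - c)"
proof (rule const_realI)
  have "(x, y) \<noteq> (a, b)" "(y, x) \<noteq> (a, b)" using assms by auto
  thus "orientation (\<theta>((a, b) := t)) x y - c = orientation \<theta> x y - c" for t
    by (simp only: orientation_def fun_upd_apply if_False)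
qed

lemma affine_orientation:
  "affine_real (\<lambda>t. orientation (\<theta>((a, b) := t)) x y - c)"
proof -
  have 1: "affine_real (\<lambda>t. t - c)"
    unfolding affine_real_def by (rule exI[of _ "-c"], rule exI[of _ 1], simp)
  have 2: "affine_real (\<lambda>t. 1 - t - c)"
    unfolding affine_real_def by (rule exI[of _ "1 - c"], rule exI[of _ "-1"], simp)
  have 3: "affine_real (\<lambda>t. d)" for d by (rule const_imp_affine, rule const_realI) simp
  show ?thesis
  proof (cases x y rule: linorder_cases)
    case less
    thus ?thesis using 1 3 by (cases "x = a"; cases "y = b") (simp_all add: orientation_def)
  next
    case greater
    hence "\<not> x < y" by simp
    thus ?thesis using greater 2 3 by (cases "y = a"; cases "x = b") (simp_all add: orientation_def)
  qed (simp add: 3 orientation_def)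
qed

text \<open>For four distinct vertices the four factors belong to four different unordered pairs, so
  at most one of them varies with the parameter of the pair (\<open>a\<close>,
  \<open>b\<close>).\<close>

lemma affine_orientation_prod4:
  assumes "distinct [x, x', y, y']"
  shows "affine_real (\<lambda>t. orientation (\<theta>((a, b) := t)) x y * orientation (\<theta>((a, b) := t)) x' y
     * (orientation (\<theta>((a, b) := t)) x y' * orientation (\<theta>((a, b) := t)) x' y'))"
proof -
  let ?f = "\<lambda>u v t. orientation (\<theta>((a, b) := t)) u v"
  define hit where "hit u v \<longleftrightarrow> (u = a \<and> v = b) \<or> (u = b \<and> v = a)" for u v
  have c: "const_real (?f u v)" if "\<not> hit u v" for u v
    using const_orientation[where c = 0, of u a v b \<theta>] that unfolding hit_def diff_zero by blast
  have aff: "affine_real (?f u v)" for u v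
    using affine_orientation[where c = 0, of \<theta> a b u v] unfolding diff_zero .
  have h: "\<not> hit x y \<and> \<not> hit x' y \<or> \<not> hit x y' \<and> \<not> hit x' y'"
      "\<not> hit x y \<or> \<not> hit x' y" "\<not> hit x y' \<or> \<not> hit x' y'"
    using assms unfolding hit_def by auto
  have "const_real (\<lambda>t. ?f x y t * ?f x' y t) \<or> const_real (\<lambda>t. ?f x y' t * ?f x' y' t)"
    using h(1)
  proof
    assume "\<not> hit x y \<and> \<not> hit x' y"
    thus ?thesis by (intro disjI1 const_real_mult c) auto
  next
    assume "\<not> hit x y' \<and> \<not> hit x' y'"
    thus ?thesis by (intro disjI2 const_real_mult c) auto
  qed
  moreover have "const_real (?f x y) \<or> const_real (?f x' y)" "const_real (?f x y') \<or> const_real (?f x' y')"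
    using h(2,3) c by blast+
  ultimately show ?thesis by (intro affine_real_mult aff)
qed

lemma affine_orientation_prod2:
  assumes "y \<noteq> y'"
  shows "affine_real (\<lambda>t. (orientation (\<theta>((a, b) := t)) x y - c) * (orientation (\<theta>((a, b) := t)) x y' - c'))"
proof (intro affine_real_mult affine_orientation)
  show "const_real (\<lambda>t. orientation (\<theta>((a, b) := t)) x y - c) \<or>
    const_real (\<lambda>t. orientation (\<theta>((a, b) := t)) x y' - c')"
  proof (cases "x = a \<and> y = b \<or> x = b \<and> y = a")
    case True
    have "const_real (\<lambda>t. orientation (\<theta>((a, b) := t)) x y' - c')"
    proof (cases "x = y'")
      \<comment> \<open>Here the second factor is a diagonal entry, which is 0 whatever the
        parameters are.\<close>
      case True
      show ?thesis by (rule const_realI[where c = "0 - c'"]) (simp add: True orientation_def)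
    next
      case False
      thus ?thesis using assms \<open>x = a \<and> y = b \<or> x = b \<and> y = a\<close> by (intro const_orientation) auto
    qed
    thus ?thesis ..
  qed (use const_orientation in blast)
qed

lemma codegree_energy_expand:
  "codegree_energy V W = (\<Sum>x\<in>V. \<Sum>x'\<in>V. \<Sum>y\<in>V. \<Sum>y'\<in>V. W x y * W x' y * (W x y' * W x' y'))"
  by (simp add: codegree_energy_def power2_eq_square sum_product)

text \<open>The part of the energy that is affine in each parameter. Quadruples with a repeated
  vertex would contribute squares of entries.\<close>

definition proper_energy :: "'a set \<Rightarrow> ('a \<Rightarrow> 'a \<Rightarrow> real) \<Rightarrow> real" where
  "proper_energy V W = (\<Sum>x\<in>V. \<Sum>x'\<in>V. \<Sum>y\<in>V. \<Sum>y'\<in>V.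
     if distinct [x, x', y, y'] then W x y * W x' y * (W x y' * W x' y') else 0)"

lemma weighted_tournament_le_1:
  assumes "weighted_tournament V W" "x \<in> V" "y \<in> V"
  shows "0 \<le> W x y" "W x y \<le> 1"
  using assms unfolding weighted_tournament_def
proof -
  show "0 \<le> W x y" using assms by (auto simp: weighted_tournament_def)
  show "W x y \<le> 1"
  proof (cases "x = y")
    case False
    hence "W x y + W y x = 1" "0 \<le> W y x" using assms by (auto simp: weighted_tournament_def)
    thus ?thesis by simp
  qed (use assms in \<open>auto simp: weighted_tournament_def\<close>)
qed

text \<open>If some first index equals some second index, the product contains a diagonal entry and
  vanishes. So the only lost terms have \<open>x' = x\<close> or \<open>y' = y\<close>; there are at
  most n^3 of either kind, each at most 1.\<close>

lemma proper_energy_bounds: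
  assumes "weighted_tournament V W" "finite V"
  shows "proper_energy V W \<le> codegree_energy V W"
    and "codegree_energy V W \<le> proper_energy V W + 2 * real (card V) ^ 3"
proof -
  note [simp] = weighted_tournament_le_1[OF assms(1)]
  have diag[simp]: "W x x = 0" for x using assms by (auto simp: weighted_tournament_def)
  show "proper_energy V W \<le> codegree_energy V W"
    unfolding proper_energy_def codegree_energy_expand by (intro sum_mono) auto
  have "codegree_energy V W \<le> (\<Sum>x\<in>V. \<Sum>x'\<in>V. \<Sum>y\<in>V. \<Sum>y'\<in>V.
     (if distinct [x, x', y, y'] then W x y * W x' y * (W x y' * W x' y') else 0)
       + ((if x' = x then 1 else 0) + (if y' = y then 1 else 0)))"
    unfolding codegree_energy_expand
  proof (intro sum_mono)
    fix x x' y y' assume V: "x \<in> V" "x' \<in> V" "y \<in> V" "y' \<in> V"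
    have "W x y * W x' y * (W x y' * W x' y') \<le> 1" using V
      by (intro mult_le_one mult_nonneg_nonneg) auto
    thus "W x y * W x' y * (W x y' * W x' y') \<le>
       (if distinct [x, x', y, y'] then W x y * W x' y * (W x y' * W x' y') else 0)
       + ((if x' = x then 1 else 0) + (if y' = y then 1 else 0))"
      by auto
  qed
  also have "\<dots> = proper_energy V W + 2 * real (card V) ^ 3"
  proof -
    have "(\<Sum>x\<in>V. \<Sum>x'\<in>V. \<Sum>y\<in>V. \<Sum>y'\<in>V. if x' = x then 1 else 0)
        = (\<Sum>x\<in>V. \<Sum>x'\<in>V. if x' = x then real (card V) ^ 2 else 0)"
      by (intro sum.cong) (auto simp: power2_eq_square)
    also have "\<dots> = real (card V) ^ 3"
      using assms(2) by (simp add: eval_nat_numeral)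
    finally have x: "(\<Sum>x\<in>V. \<Sum>x'\<in>V. \<Sum>y\<in>V. \<Sum>y'\<in>V. if x' = x then 1 else 0) = real (card V) ^ 3" .
    have y: "(\<Sum>x\<in>V. \<Sum>x'\<in>V. \<Sum>y\<in>V. \<Sum>y'\<in>V. if y' = y then 1 else 0) = real (card V) ^ 3"
      using assms(2) by (simp add: eval_nat_numeral)
    show ?thesis unfolding proper_energy_def sum.distrib x y by simp
  qed
  finally show "codegree_energy V W \<le> proper_energy V W + 2 * real (card V) ^ 3" .
qed

lemma codegree_energy_le:
  assumes "weighted_tournament V W" "finite V"
  shows "codegree_energy V W \<le> real (card V) ^ 4"
proof -
  note [simp] = weighted_tournament_le_1[OF assms(1)]
  have "codegree_energy V W \<le> (\<Sum>x\<in>V. \<Sum>x'\<in>V. \<Sum>y\<in>V. \<Sum>y'\<in>V. 1)"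
    unfolding codegree_energy_expand
    by (intro sum_mono mult_le_one mult_nonneg_nonneg) auto
  thus ?thesis by (simp add: eval_nat_numeral mult.assoc)
qed

lemma codegree_energy_nonneg: "0 \<le> codegree_energy V W"
  unfolding codegree_energy_def by (intro sum_nonneg) simp

lemma codegree_energy_cong:
  "(\<And>x y. x \<in> V \<Longrightarrow> y \<in> V \<Longrightarrow> W x y = W' x y) \<Longrightarrow> codegree_energy V W = codegree_energy V W'"
  unfolding codegree_energy_def by (simp cong: sum.cong)

text \<open>Score error and energy enter a single objective, so one rounding controls both; \<sigma>
  selects whether the energy is kept from rising or from falling. Terms that are not affine in one
  parameter are removed before rounding and restored afterwards: the diagonal \<open>y = y'\<close>
  of the squared score error costs at most n for each vertex, hence K n^2 in total, and the
  degenerate quadruples cost 2 n^3. The off-diagonal score error \<open>D\<close> vanishes at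
  \<open>W\<close> itself.\<close>

lemma round_weighted_tournament:
  fixes W :: "'a::linorder \<Rightarrow> 'a \<Rightarrow> real" and \<sigma> K :: real
  assumes "finite V" "weighted_tournament V W" "\<sigma> \<in> {-1, 1}" "0 \<le> K"
  defines "n \<equiv> real (card V)"
  shows "\<exists>R. weighted_tournament V R \<and> (\<forall>x\<in>V. \<forall>y\<in>V. R x y \<in> {0, 1}) \<and>
    K * (\<Sum>x\<in>V. ((\<Sum>y\<in>V. R x y) - (\<Sum>y\<in>V. W x y))\<^sup>2) + \<sigma> * codegree_energy V R
      \<le> \<sigma> * codegree_energy V W + K * n\<^sup>2 + 2 * n ^ 3"
proof -
  define D where "D R = (\<Sum>x\<in>V. \<Sum>y\<in>V. \<Sum>y'\<in>V. if y \<noteq> y' then (R x y - W x y) * (R x y' - W x y') else 0)" for R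
  define \<Phi> where "\<Phi> \<theta> = K * D (orientation \<theta>) + \<sigma> * proper_energy V (orientation \<theta>)" for \<theta>
  define E where "E = {(x, y). x \<in> V \<and> y \<in> V \<and> x < y}"
  define \<theta> where "\<theta> e = W (fst e) (snd e)" for e
  have W: "orientation \<theta> x y = W x y" if "x \<in> V" "y \<in> V" for x y
  proof -
    have "W x y = 1 - W y x" if "x \<noteq> y"
      using assms(2) \<open>x \<in> V\<close> \<open>y \<in> V\<close> that unfolding weighted_tournament_def by (metis add_diff_cancel_right')
    moreover have "W x x = 0" using assms(2) unfolding weighted_tournament_def by blast
    ultimately show ?thesis by (cases x y rule: linorder_cases) (auto simp: orientation_def \<theta>_def)
  qed
  have "finite E" using assms(1) by (intro finite_subset[of E "V \<times> V"]) (auto simp: E_def)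
  moreover have "affine_real (\<lambda>t. \<Phi> (\<theta>(e := t)))" for \<theta> e
    unfolding \<Phi>_def D_def proper_energy_def
    by (cases e, simp only:, intro affine_real_add affine_real_cmult affine_real_sum affine_real_if
       affine_orientation_prod2 affine_orientation_prod4)
  moreover have "0 \<le> \<theta> e \<and> \<theta> e \<le> 1" if "e \<in> E" for e
    using that weighted_tournament_le_1[OF assms(2)] by (auto simp: \<theta>_def E_def)
  ultimately obtain \<theta>' where \<theta>': "\<forall>e\<in>E. \<theta>' e \<in> {0, 1}" "\<Phi> \<theta>' \<le> \<Phi> \<theta>"
    using multiaffine_round[of E \<Phi> \<theta>] by blast
  define R where "R = orientation \<theta>'"
  have R01: "R x y \<in> {0, 1}" if "x \<in> V" "y \<in> V" for x y
    using \<theta>'(1) that unfolding R_def orientation_def E_def by auto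
  have Rt: "weighted_tournament V R"
  proof -
    have "0 \<le> R x y" if "x \<in> V" "y \<in> V" for x y using R01[OF that] by auto
    moreover have "R x y + R y x = 1" if "x \<noteq> y" for x y
      using that by (cases x y rule: linorder_cases) (auto simp: R_def orientation_def)
    moreover have "R x x = 0" for x by (simp add: R_def orientation_def)
    ultimately show ?thesis unfolding weighted_tournament_def by blast
  qed
  have "\<Phi> \<theta> = K * D W + \<sigma> * proper_energy V W"
    unfolding \<Phi>_def D_def proper_energy_def by (simp add: W cong: sum.cong if_cong)
  also have "D W = 0" unfolding D_def by (simp cong: if_cong)
  finally have \<Phi>: "\<Phi> \<theta> = \<sigma> * proper_energy V W" by simp
  have "(\<Sum>x\<in>V. ((\<Sum>y\<in>V. R x y) - (\<Sum>y\<in>V. W x y))\<^sup>2)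
      = (\<Sum>x\<in>V. \<Sum>y\<in>V. \<Sum>y'\<in>V. (R x y - W x y) * (R x y' - W x y'))"
    by (simp add: sum_subtractf[symmetric] power2_eq_square sum_product)
  also have "\<dots> \<le> (\<Sum>x\<in>V. \<Sum>y\<in>V. \<Sum>y'\<in>V. (if y \<noteq> y' then (R x y - W x y) * (R x y' - W x y') else 0)
      + (if y' = y then 1 else 0))"
  proof (intro sum_mono)
    fix x y y' assume V: "x \<in> V" "y \<in> V" "y' \<in> V"
    have "\<bar>R x y - W x y\<bar> \<le> 1"
      using weighted_tournament_le_1[OF assms(2) V(1,2)] R01[OF V(1,2)] by auto
    hence "(R x y - W x y) * (R x y - W x y) \<le> 1"
      by (metis abs_square_le_1 power2_eq_square)
    thus "(R x y - W x y) * (R x y' - W x y') \<le> (if y \<noteq> y' then (R x y - W x y) * (R x y' - W x y') else 0)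
      + (if y' = y then 1 else 0)" by auto
  qed
  also have "\<dots> = D R + n\<^sup>2"
    using assms(1) by (simp add: sum.distrib D_def n_def power2_eq_square)
  finally have D: "(\<Sum>x\<in>V. ((\<Sum>y\<in>V. R x y) - (\<Sum>y\<in>V. W x y))\<^sup>2) \<le> D R + n\<^sup>2" .
  have "K * (\<Sum>x\<in>V. ((\<Sum>y\<in>V. R x y) - (\<Sum>y\<in>V. W x y))\<^sup>2) + \<sigma> * codegree_energy V R
     \<le> K * (D R + n\<^sup>2) + \<sigma> * codegree_energy V R"
    using D assms(4) by (intro add_right_mono mult_left_mono) auto
  also have "\<dots> = \<Phi> \<theta>' + \<sigma> * (codegree_energy V R - proper_energy V R) + K * n\<^sup>2"
    by (simp add: \<Phi>_def R_def algebra_simps)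
  also have "\<dots> \<le> \<sigma> * proper_energy V W + \<sigma> * (codegree_energy V R - proper_energy V R) + K * n\<^sup>2"
    using \<theta>'(2) \<Phi> by simp
  \<comment> \<open>The term 2 n^3 comes from the degenerate quadruples of \<open>R\<close> if
    \<sigma> is 1 and from those of \<open>W\<close> if \<sigma> is -1.\<close>
  also have "\<dots> \<le> \<sigma> * codegree_energy V W + K * n\<^sup>2 + 2 * n ^ 3"
    using proper_energy_bounds[OF Rt assms(1)] proper_energy_bounds[OF assms(2,1)] assms(3)
    unfolding n_def by auto
  finally show ?thesis using Rt R01 by blast
qed

section \<open>Score-preserving perturbations\<close>

definition rainbow :: "('a \<Rightarrow> nat) \<Rightarrow> ('a \<Rightarrow> 'a \<Rightarrow> real) \<Rightarrow> 'a \<Rightarrow> 'a \<Rightarrow> 'a \<Rightarrow> real" where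
  "rainbow c w x y z = (if c x = 0 \<and> c y = 1 \<and> c z = 2 then w x y * w y z * w z x else 0)"

lemma card_rainbow_colourings:
  assumes "finite V" "distinct [x, y, z]" "x \<in> V" "y \<in> V" "z \<in> V"
  shows "27 * card {c \<in> V \<rightarrow>\<^sub>E {0, 1, 2::nat}. c x = 0 \<and> c y = 1 \<and> c z = 2} = 3 ^ card V"
proof -
  define B where "B v = (if v = x then {0} else if v = y then {1} else if v = z then {2} else {0, 1, 2::nat})" for v
  have "{c \<in> V \<rightarrow>\<^sub>E {0, 1, 2}. c x = 0 \<and> c y = 1 \<and> c z = 2} = Pi\<^sub>E V B" (is "?L = ?R")
  proof
    show "?L \<subseteq> ?R" by (auto simp: PiE_def Pi_def B_def)
    show "?R \<subseteq> ?L"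
    proof
      fix c assume c: "c \<in> Pi\<^sub>E V B"
      have "c x \<in> B x" "c y \<in> B y" "c z \<in> B z" using c assms by (auto dest: PiE_mem)
      moreover have "c \<in> V \<rightarrow>\<^sub>E {0, 1, 2}"
        using c by (rule subsetD[OF PiE_mono, rotated]) (auto simp: B_def)
      ultimately show "c \<in> ?L" using assms(2) by (auto simp: B_def)
    qed
  qed
  hence "card ?L = (\<Prod>v\<in>V. card (B v))" using assms(1) by (simp add: card_PiE)
  moreover have "(27::nat) = (\<Prod>v\<in>V. if v \<in> {x, y, z} then 3 else 1)"
  proof -
    have "(\<Prod>v\<in>V. if v \<in> {x, y, z} then 3 else (1::nat)) = (\<Prod>v\<in>V \<inter> {x, y, z}. 3)"
      using assms(1) by (rule prod.inter_restrict[symmetric])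
    also have "V \<inter> {x, y, z} = {x, y, z}" using assms by auto
    finally show ?thesis using assms(2) by simp
  qed
  ultimately have "27 * card ?L = (\<Prod>v\<in>V. (if v \<in> {x, y, z} then 3 else 1) * card (B v))"
    by (simp only: prod.distrib)
  also have "\<dots> = (\<Prod>v\<in>V. 3)" by (intro prod.cong refl) (auto simp: B_def)
  finally show ?thesis by simp
qed

text \<open>Averaging over all colourings of \<open>V\<close> with 3 colours: three distinct
  vertices receive the colours 0, 1, 2 in this order in a fraction 1/27 of them, and triples with a
  repetition have weight 0 because the diagonal of \<open>w\<close> vanishes.\<close>

lemma ex_rainbow_colouring:
  assumes "finite V" and loop: "\<And>x. w x x = 0"
  shows "\<exists>c. (\<Sum>x\<in>V. \<Sum>y\<in>V. \<Sum>z\<in>V. w x y * w y z * w z x)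
    \<le> 27 * (\<Sum>x\<in>V. \<Sum>y\<in>V. \<Sum>z\<in>V. rainbow c w x y z)"
proof (rule ccontr)
  define T where "T = (\<Sum>x\<in>V. \<Sum>y\<in>V. \<Sum>z\<in>V. w x y * w y z * w z x)"
  define S where "S c = (\<Sum>x\<in>V. \<Sum>y\<in>V. \<Sum>z\<in>V. rainbow c w x y z)" for c
  define Cs where "Cs = V \<rightarrow>\<^sub>E {0, 1, 2::nat}"
  assume "\<not> ?thesis"
  hence less: "27 * S c < T" for c unfolding T_def S_def by (simp add: not_le)
  have fin: "finite Cs" unfolding Cs_def using assms(1) by (intro finite_PiE) auto
  have ne: "Cs \<noteq> {}" unfolding Cs_def by (auto simp: PiE_eq_empty_iff)
  have cCs: "card Cs = 3 ^ card V" unfolding Cs_def using assms(1) by (simp add: card_PiE numeral_3_eq_3)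
  have *: "27 * (\<Sum>c\<in>Cs. rainbow c w x y z) = 3 ^ card V * (w x y * w y z * w z x)"
    if "x \<in> V" "y \<in> V" "z \<in> V" for x y z
  proof (cases "distinct [x, y, z]")
    case True
    have "(\<Sum>c\<in>Cs. rainbow c w x y z)
        = (\<Sum>c\<in>{c \<in> Cs. c x = 0 \<and> c y = 1 \<and> c z = 2}. w x y * w y z * w z x)"
      unfolding rainbow_def using fin by (intro sum.inter_filter[symmetric]) 
    hence "27 * (\<Sum>c\<in>Cs. rainbow c w x y z)
        = real (27 * card {c \<in> Cs. c x = 0 \<and> c y = 1 \<and> c z = 2}) * (w x y * w y z * w z x)"
      by simp
    also have "\<dots> = 3 ^ card V * (w x y * w y z * w z x)"
      unfolding Cs_def card_rainbow_colourings[OF assms(1) True that] by simp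
    finally show ?thesis .
  next
    case False
    hence "w x y * w y z * w z x = 0" using loop by auto
    thus ?thesis by (simp only: rainbow_def if_cancel sum.neutral_const mult_zero_right)
  qed
  have "(\<Sum>c\<in>Cs. 27 * S c) = 27 * (\<Sum>c\<in>Cs. \<Sum>x\<in>V. \<Sum>y\<in>V. \<Sum>z\<in>V. rainbow c w x y z)"
    by (simp add: S_def sum_distrib_left)
  also have "(\<Sum>c\<in>Cs. \<Sum>x\<in>V. \<Sum>y\<in>V. \<Sum>z\<in>V. rainbow c w x y z)
      = (\<Sum>x\<in>V. \<Sum>y\<in>V. \<Sum>z\<in>V. \<Sum>c\<in>Cs. rainbow c w x y z)"
    by (subst sum.swap, rule sum.cong[OF refl], subst sum.swap, rule sum.cong[OF refl], rule sum.swap)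
  also have "27 * \<dots> = (\<Sum>x\<in>V. \<Sum>y\<in>V. \<Sum>z\<in>V. 27 * (\<Sum>c\<in>Cs. rainbow c w x y z))"
    by (simp only: sum_distrib_left)
  also have "\<dots> = (\<Sum>x\<in>V. \<Sum>y\<in>V. \<Sum>z\<in>V. 3 ^ card V * (w x y * w y z * w z x))"
    by (intro sum.cong refl *)
  also have "\<dots> = 3 ^ card V * T" by (simp add: T_def sum_distrib_left)
  also have "\<dots> = (\<Sum>c\<in>Cs. T)" by (simp add: cCs)
  finally have "(\<Sum>c\<in>Cs. 27 * S c) = (\<Sum>c\<in>Cs. T)" .
  moreover have "(\<Sum>c\<in>Cs. 27 * S c) < (\<Sum>c\<in>Cs. T)"
    using fin ne less by (intro sum_strict_mono) auto
  ultimately show False by simp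
qed

text \<open>Fractionally reversing the cyclic triangles of one colour pattern preserves all scores; a
  symmetric choice of triangles could cancel out, as it does for a constant weight $1/2$.\<close>

lemma ex_score_preserving_perturbation:
  assumes fin: "finite V" and w: "weighted_tournament V w"
  defines "n \<equiv> real (card V)"
  shows "\<exists>P. (\<forall>s\<in>{0..1}. weighted_tournament V (\<lambda>x y. w x y + s * P x y)) \<and>
      (\<forall>x\<in>V. (\<Sum>y\<in>V. P x y) = 0) \<and>
      ((\<Sum>x\<in>V. \<Sum>y\<in>V. \<Sum>z\<in>V. w x y * w y z * w z x) / 27) ^ 4 \<le> n ^ 8 * codegree_energy V P"
proof -
  have loop: "w x x = 0" for x using w by (auto simp: weighted_tournament_def)
  note w01 = weighted_tournament_le_1[OF w]
  define T where "T = (\<Sum>x\<in>V. \<Sum>y\<in>V. \<Sum>z\<in>V. w x y * w y z * w z x)"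
  obtain c where c: "T \<le> 27 * (\<Sum>x\<in>V. \<Sum>y\<in>V. \<Sum>z\<in>V. rainbow c w x y z)"
    unfolding T_def using ex_rainbow_colouring[where w = w, OF fin loop] by blast
  define R where "R = rainbow c w"
  \<comment> \<open>The amount of the arc from \<open>x\<close> to \<open>y\<close> that is
    reversed. The arc can be the first, second or third one of a coloured triangle, whence the three
    terms; dividing by \<open>n\<close> averages over the third vertex and keeps the amount below
    \<open>w x y\<close>.\<close>
  define Q where "Q x y = (\<Sum>z\<in>V. R x y z + R z x y + R y z x) / n" for x y
  define P where "P x y = Q y x - Q x y" for x y
  have R0: "0 \<le> R x y z" if "x \<in> V" "y \<in> V" "z \<in> V" for x y z
    using that unfolding R_def rainbow_def by (auto intro!: mult_nonneg_nonneg w01)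
  \<comment> \<open>The three terms require the colours 0, 1 and 2 of \<open>x\<close>,
    respectively, so at most one of them is nonzero.\<close>
  have Rsum: "R x y z + R z x y + R y z x \<le> w x y" if "x \<in> V" "y \<in> V" "z \<in> V" for x y z
  proof -
    have "w x y * w y z * w z x \<le> w x y * 1 * 1"
      using that by (intro mult_mono mult_nonneg_nonneg w01) auto
    moreover from this have "w z x * w x y * w y z \<le> w x y" "w y z * w z x * w x y \<le> w x y"
      by (simp_all add: mult_ac)
    ultimately show ?thesis
      using w01(1)[OF that(1,2)] unfolding R_def rainbow_def by auto
  qed
  have Q0: "0 \<le> Q x y" if "x \<in> V" "y \<in> V" for x y
    unfolding Q_def n_def using that by (intro divide_nonneg_nonneg sum_nonneg add_nonneg_nonneg R0) auto
  have Qw: "Q x y \<le> w x y" if "x \<in> V" "y \<in> V" for x y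
  proof -
    have "n > 0" using that fin by (auto simp: n_def card_gt_0_iff)
    have "(\<Sum>z\<in>V. R x y z + R z x y + R y z x) \<le> (\<Sum>z\<in>V. w x y)"
      using that by (intro sum_mono Rsum)
    thus ?thesis using \<open>n > 0\<close> by (simp add: Q_def n_def field_simps)
  qed
  have wt: "weighted_tournament V (\<lambda>x y. w x y + s * P x y)" if s: "s \<in> {0..1}" for s
    unfolding weighted_tournament_def
  proof (intro conjI ballI allI impI)
    fix x y assume V: "x \<in> V" "y \<in> V"
    have "s * Q x y \<le> 1 * w x y" using s V by (intro mult_mono Qw Q0) auto
    moreover have "0 \<le> s * Q y x" using s V by (intro mult_nonneg_nonneg Q0) auto
    ultimately show "0 \<le> w x y + s * P x y" by (simp add: P_def algebra_simps)
    assume "x \<noteq> y"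
    hence "w x y + w y x = 1" using w V by (auto simp: weighted_tournament_def)
    thus "w x y + s * P x y + (w y x + s * P y x) = 1" by (simp add: P_def algebra_simps)
  next
    fix x show "w x x + s * P x x = 0" by (simp add: P_def loop)
  qed
  \<comment> \<open>A cyclic triangle through \<open>x\<close> has one arc into \<open>x\<close> and
    one arc out of it, with equal weight. Exchanging \<open>y\<close> and \<open>z\<close> matches
    these two arcs, so reversal leaves the score of \<open>x\<close> unchanged.\<close>
  have rows: "(\<Sum>y\<in>V. P x y) = 0" for x
  proof -
    have "(\<Sum>y\<in>V. Q y x) = (\<Sum>y\<in>V. \<Sum>z\<in>V. R y x z + R z y x + R x z y) / n"
      by (simp add: Q_def sum_divide_distrib)
    also have "(\<Sum>y\<in>V. \<Sum>z\<in>V. R y x z + R z y x + R x z y)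
        = (\<Sum>y\<in>V. \<Sum>z\<in>V. R z x y + R y z x + R x y z)" by (rule sum.swap)
    also have "\<dots> / n = (\<Sum>y\<in>V. Q x y)"
      by (simp add: Q_def sum_divide_distrib algebra_simps)
    finally show ?thesis by (simp add: P_def sum_subtractf)
  qed
  \<comment> \<open>On this rectangle the colours leave only the first term of \<open>Q x y\<close>
    and annihilate \<open>Q y x\<close>. All entries of \<open>P\<close> there have the same sign,
    so nothing cancels and the rectangle sees every coloured triangle.\<close>
  define X Y where "X = {x \<in> V. c x = 0}" and "Y = {y \<in> V. c y = 1}"
  have PXY: "P x y = - (\<Sum>z\<in>V. R x y z) / n" if "x \<in> X" "y \<in> Y" for x y
    using that by (simp add: P_def Q_def R_def rainbow_def X_def Y_def)
  have "(\<Sum>x\<in>X. \<Sum>y\<in>Y. P x y) = (\<Sum>x\<in>X. \<Sum>y\<in>Y. - (\<Sum>z\<in>V. R x y z) / n)"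
    by (intro sum.cong refl PXY)
  also have "\<dots> = - (\<Sum>x\<in>X. \<Sum>y\<in>Y. \<Sum>z\<in>V. R x y z) / n"
    by (simp add: sum_divide_distrib sum_negf)
  also have "(\<Sum>x\<in>X. \<Sum>y\<in>Y. \<Sum>z\<in>V. R x y z) = (\<Sum>x\<in>V. \<Sum>y\<in>Y. \<Sum>z\<in>V. R x y z)"
    using fin by (intro sum.mono_neutral_left ballI sum.neutral) (auto simp: X_def R_def rainbow_def)
  also have "\<dots> = (\<Sum>x\<in>V. \<Sum>y\<in>V. \<Sum>z\<in>V. R x y z)"
    using fin by (intro sum.cong refl sum.mono_neutral_left ballI sum.neutral) (auto simp: Y_def R_def rainbow_def)
  finally have cut: "(\<Sum>x\<in>X. \<Sum>y\<in>Y. P x y) = - (\<Sum>x\<in>V. \<Sum>y\<in>V. \<Sum>z\<in>V. R x y z) / n" .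
  have T0: "0 \<le> T" unfolding T_def by (intro sum_nonneg mult_nonneg_nonneg w01)
  have "(T / 27) ^ 4 \<le> (\<Sum>x\<in>V. \<Sum>y\<in>V. \<Sum>z\<in>V. R x y z) ^ 4"
    using c T0 unfolding R_def by (intro power_mono) auto
  also have "\<dots> = (n * (\<Sum>x\<in>X. \<Sum>y\<in>Y. P x y)) ^ 4"
  proof (cases "n = 0")
    case True
    hence "V = {}" using fin by (simp add: n_def)
    thus ?thesis by (simp add: True)
  qed (simp add: cut)
  also have "\<dots> = n ^ 4 * (\<Sum>x\<in>X. \<Sum>y\<in>Y. P x y) ^ 4" by (rule power_mult_distrib)
  also have "\<dots> \<le> n ^ 4 * (n ^ 4 * codegree_energy V P)"
    unfolding n_def by (intro mult_left_mono cut_le_codegree_energy fin) (auto simp: X_def Y_def)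
  also have "\<dots> = n ^ 8 * codegree_energy V P" by (simp flip: power_add mult.assoc)
  finally have "(T / 27) ^ 4 \<le> n ^ 8 * codegree_energy V P" .
  with wt rows show ?thesis unfolding T_def by blast
qed

section \<open>Densities in finite tournaments\<close>

definition adj :: "'a pair_pre_digraph \<Rightarrow> 'a \<Rightarrow> 'a \<Rightarrow> real" where
  "adj G x y = (if (x, y) \<in> parcs G then 1 else 0)"

definition K22_digraph :: "nat pair_pre_digraph" where
  "K22_digraph = \<lparr> pverts = {0, 1, 2, 3}, parcs = {(0, 2), (0, 3), (1, 2), (1, 3)} \<rparr>"

lemma pair_digraph_K22_digraph: "pair_digraph K22_digraph"
  by unfold_locales (auto simp: K22_digraph_def)

lemma pair_digraph_finite:
  assumes "pair_digraph G"
  shows "finite (pverts G)" "finite (parcs G)" "parcs G \<subseteq> pverts G \<times> pverts G"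
    "(x, x) \<notin> parcs G"
proof -
  interpret pair_digraph G by fact
  show "finite (pverts G)" "finite (parcs G)" by (rule pair_finite_verts pair_finite_arcs)+
  show "parcs G \<subseteq> pverts G \<times> pverts G" by (auto dest: in_arcsD1 in_arcsD2)
  show "(x, x) \<notin> parcs G" using pair_no_loops[of "(x, x)"] by auto
qed

lemma tournament_finite: "tournament G \<Longrightarrow> finite (pverts G)"
  by (simp add: tournament_def pair_digraph_finite)

lemma weighted_tournament_adj:
  assumes "tournament G" shows "weighted_tournament (pverts G) (adj G)"
  unfolding weighted_tournament_def
proof (intro conjI ballI allI impI)
  fix x y assume V: "x \<in> pverts G" "y \<in> pverts G"
  show "0 \<le> adj G x y" by (simp add: adj_def)
  assume "x \<noteq> y"
  hence "(x, y) \<in> parcs G \<longleftrightarrow> (y, x) \<notin> parcs G" using assms V unfolding tournament_def by blast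
  thus "adj G x y + adj G y x = 1" by (cases "(x, y) \<in> parcs G") (simp_all add: adj_def)
next
  fix x show "adj G x x = 0"
    using assms pair_digraph_finite(4)[of G x] by (simp add: adj_def tournament_def)
qed

lemma ex_tournament_of_weights:
  assumes "finite V" "weighted_tournament V R" "\<And>x y. x \<in> V \<Longrightarrow> y \<in> V \<Longrightarrow> R x y \<in> {0, 1}"
  shows "\<exists>H. tournament H \<and> pverts H = V \<and> (\<forall>x\<in>V. \<forall>y\<in>V. adj H x y = R x y)"
proof (intro exI conjI ballI)
  define H where "H = \<lparr>pverts = V, parcs = {(x, y) \<in> V \<times> V. R x y = 1}\<rparr>"
  have verts: "pverts H = V" by (simp add: H_def)
  have arcs: "(x, y) \<in> parcs H \<longleftrightarrow> R x y = 1" if "x \<in> V" "y \<in> V" for x y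
    using that by (simp add: H_def)
  have "pair_digraph H"
  proof unfold_locales
    show "finite (parcs H)"
      using assms(1) by (intro finite_subset[of "parcs H" "V \<times> V"]) (auto simp: H_def)
  qed (use assms(1,2) in \<open>auto simp: H_def weighted_tournament_def\<close>)
  moreover have "R u v = 1 \<longleftrightarrow> R v u \<noteq> 1" if "u \<in> V" "v \<in> V" "u \<noteq> v" for u v
  proof -
    have "R u v + R v u = 1" using assms(2) that unfolding weighted_tournament_def by blast
    with assms(3)[OF that(1,2)] show ?thesis by auto
  qed
  hence "\<forall>u\<in>pverts H. \<forall>v\<in>pverts H. u \<noteq> v \<longrightarrow> ((u, v) \<in> parcs H \<longleftrightarrow> (v, u) \<notin> parcs H)"
    using arcs unfolding verts by blast
  ultimately show "tournament H" unfolding tournament_def by blast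
  show "pverts H = V" by fact
  fix x y assume "x \<in> V" "y \<in> V"
  thus "adj H x y = R x y" using assms(3)[of x y] arcs by (auto simp: adj_def)
qed

lemma hom_count_eq_sum:
  assumes "finite (pverts F)" "finite (parcs F)" "finite (pverts G)"
  shows "real (hom_count F G)
    = (\<Sum>\<phi>\<in>pverts F \<rightarrow>\<^sub>E pverts G. \<Prod>e\<in>parcs F. adj G (\<phi> (fst e)) (\<phi> (snd e)))"
proof -
  let ?A = "pverts F \<rightarrow>\<^sub>E pverts G"
  let ?P = "\<lambda>\<phi>. \<forall>(i, j)\<in>parcs F. (\<phi> i, \<phi> j) \<in> parcs G"
  have "finite ?A" using assms by (intro finite_PiE) auto
  have "real (hom_count F G) = (\<Sum>\<phi>\<in>{\<phi>\<in>?A. ?P \<phi>}. 1)" unfolding hom_count_def by simp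
  also have "\<dots> = (\<Sum>\<phi>\<in>?A. if ?P \<phi> then 1 else 0)"
    using \<open>finite ?A\<close> by (rule sum.inter_filter)
  also have "\<dots> = (\<Sum>\<phi>\<in>?A. \<Prod>e\<in>parcs F. adj G (\<phi> (fst e)) (\<phi> (snd e)))"
  proof (intro sum.cong refl)
    fix \<phi>
    show "(if ?P \<phi> then 1 else 0) = (\<Prod>e\<in>parcs F. adj G (\<phi> (fst e)) (\<phi> (snd e)))"
    proof (cases "?P \<phi>")
      case True
      have "(\<Prod>e\<in>parcs F. adj G (\<phi> (fst e)) (\<phi> (snd e))) = 1"
        by (rule prod.neutral) (use True in \<open>force simp: adj_def\<close>)
      with True show ?thesis by simp
    next
      case False
      then obtain i j where "(i, j) \<in> parcs F" "(\<phi> i, \<phi> j) \<notin> parcs G" by blast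
      hence "\<exists>e\<in>parcs F. adj G (\<phi> (fst e)) (\<phi> (snd e)) = 0"
        by (intro bexI[of _ "(i, j)"]) (simp_all add: adj_def)
      hence "(\<Prod>e\<in>parcs F. adj G (\<phi> (fst e)) (\<phi> (snd e))) = 0"
        using assms(2) by (intro prod_zero) auto
      with False show ?thesis by simp
    qed
  qed
  finally show ?thesis .
qed

lemma sum_PiE_insert:
  assumes "a \<notin> I"
  shows "(\<Sum>\<phi>\<in>insert a I \<rightarrow>\<^sub>E V. h \<phi>) = (\<Sum>x\<in>V. \<Sum>\<phi>\<in>I \<rightarrow>\<^sub>E V. h (\<phi>(a := x)))"
proof -
  have "(\<Sum>\<phi>\<in>insert a I \<rightarrow>\<^sub>E V. h \<phi>) = (\<Sum>(y, g)\<in>V \<times> (I \<rightarrow>\<^sub>E V). h (g(a := y)))"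
    unfolding PiE_insert_eq by (subst sum.reindex[OF inj_combinator[OF assms]]) (simp add: case_prod_beta)
  thus ?thesis by (simp add: sum.cartesian_product)
qed

lemma hom_count_C3:
  assumes "finite (pverts G)"
  shows "real (hom_count C3_digraph G)
    = (\<Sum>x\<in>pverts G. \<Sum>y\<in>pverts G. \<Sum>z\<in>pverts G. adj G x y * adj G y z * adj G z x)"
proof -
  have "real (hom_count C3_digraph G)
    = (\<Sum>\<phi>\<in>{1, 2, 3 :: nat} \<rightarrow>\<^sub>E pverts G. adj G (\<phi> 1) (\<phi> 2) * adj G (\<phi> 2) (\<phi> 3) * adj G (\<phi> 3) (\<phi> 1))"
    using assms by (subst hom_count_eq_sum) (simp_all add: C3_digraph_def mult.assoc)
  also have "\<dots> = (\<Sum>x\<in>pverts G. \<Sum>y\<in>pverts G. \<Sum>z\<in>pverts G. adj G x y * adj G y z * adj G z x)"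
    by (subst sum_PiE_insert, simp, subst sum_PiE_insert, simp, subst sum_PiE_insert, simp)
       (simp only: PiE_empty_domain, simp)
  finally show ?thesis .
qed

lemma hom_count_K22:
  assumes "finite (pverts G)"
  shows "real (hom_count K22_digraph G) = codegree_energy (pverts G) (adj G)"
proof -
  have "real (hom_count K22_digraph G)
    = (\<Sum>\<phi>\<in>{0, 1, 2, 3 :: nat} \<rightarrow>\<^sub>E pverts G. adj G (\<phi> 0) (\<phi> 2) * adj G (\<phi> 1) (\<phi> 2)
        * (adj G (\<phi> 0) (\<phi> 3) * adj G (\<phi> 1) (\<phi> 3)))"
    using assms by (subst hom_count_eq_sum) (simp_all add: K22_digraph_def mult_ac)
  also have "\<dots> = codegree_energy (pverts G) (adj G)"
    unfolding codegree_energy_expand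
    by (subst sum_PiE_insert, simp, subst sum_PiE_insert, simp, subst sum_PiE_insert, simp, subst sum_PiE_insert, simp)
       (simp only: PiE_empty_domain, simp)
  finally show ?thesis .
qed

definition outscore :: "'a pair_pre_digraph \<Rightarrow> 'a \<Rightarrow> real" where
  "outscore G x = (\<Sum>y\<in>pverts G. adj G x y)"

definition inscore :: "'a pair_pre_digraph \<Rightarrow> 'a \<Rightarrow> real" where
  "inscore G x = (\<Sum>y\<in>pverts G. adj G y x)"

text \<open>Once the image of the centre \<open>m\<close> is fixed, the leaves are mapped
  independently of each other, so the count factorises into powers of the two scores.\<close>

lemma hom_count_S:
  assumes "finite (pverts G)"
  shows "real (hom_count (S_digraph m n) G)
    = (\<Sum>x\<in>pverts G. inscore G x ^ m * outscore G x ^ n)"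
proof -
  define I where "I = {..<m} \<union> {m<..m + n}"
  define f where "f x i = (if i < m then (\<lambda>y. adj G y x) else (\<lambda>y. adj G x y))" for x i
  have "real (hom_count (S_digraph m n) G)
     = (\<Sum>\<phi>\<in>insert m I \<rightarrow>\<^sub>E pverts G. \<Prod>e\<in>{..<m} \<times> {m} \<union> {m} \<times> {m<..m + n}. adj G (\<phi> (fst e)) (\<phi> (snd e)))"
  proof -
    have "pverts (S_digraph m n) = insert m I" by (auto simp: S_digraph_def I_def)
    moreover have "parcs (S_digraph m n) = {..<m} \<times> {m} \<union> {m} \<times> {m<..m + n}" by (simp add: S_digraph_def)
    moreover have "finite (insert m I)" by (simp add: I_def)
    ultimately show ?thesis using assms by (subst hom_count_eq_sum) simp_all
  qed
  also have "\<dots> = (\<Sum>\<phi>\<in>insert m I \<rightarrow>\<^sub>E pverts G. \<Prod>i\<in>I. f (\<phi> m) i (\<phi> i))"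
  proof (intro sum.cong refl)
    fix \<phi>
    have in_arcs: "{..<m} \<times> {m} = (\<lambda>i. (i, m)) ` {..<m}" and out_arcs: "{m} \<times> {m<..m + n} = Pair m ` {m<..m + n}"
      by auto
    have "(\<Prod>e\<in>{..<m} \<times> {m} \<union> {m} \<times> {m<..m + n}. adj G (\<phi> (fst e)) (\<phi> (snd e)))
       = (\<Prod>e\<in>{..<m} \<times> {m}. adj G (\<phi> (fst e)) (\<phi> (snd e))) * (\<Prod>e\<in>{m} \<times> {m<..m + n}. adj G (\<phi> (fst e)) (\<phi> (snd e)))"
      by (rule prod.union_disjoint) auto
    also have "(\<Prod>e\<in>{..<m} \<times> {m}. adj G (\<phi> (fst e)) (\<phi> (snd e))) = (\<Prod>i\<in>{..<m}. f (\<phi> m) i (\<phi> i))"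
      unfolding in_arcs by (subst prod.reindex) (auto simp: inj_on_def f_def)
    also have "(\<Prod>e\<in>{m} \<times> {m<..m + n}. adj G (\<phi> (fst e)) (\<phi> (snd e))) = (\<Prod>i\<in>{m<..m+n}. f (\<phi> m) i (\<phi> i))"
      unfolding out_arcs by (subst prod.reindex) (auto simp: inj_on_def f_def)
    also have "(\<Prod>i\<in>{..<m}. f (\<phi> m) i (\<phi> i)) * (\<Prod>i\<in>{m<..m+n}. f (\<phi> m) i (\<phi> i)) = (\<Prod>i\<in>I. f (\<phi> m) i (\<phi> i))"
      unfolding I_def by (rule prod.union_disjoint[symmetric]) auto
    finally show "(\<Prod>e\<in>{..<m} \<times> {m} \<union> {m} \<times> {m<..m + n}. adj G (\<phi> (fst e)) (\<phi> (snd e)))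
       = (\<Prod>i\<in>I. f (\<phi> m) i (\<phi> i))" .
  qed
  also have "\<dots> = (\<Sum>x\<in>pverts G. \<Sum>\<phi>\<in>I \<rightarrow>\<^sub>E pverts G. \<Prod>i\<in>I. f x i (\<phi> i))"
    by (subst sum_PiE_insert) (auto simp: I_def intro!: sum.cong prod.cong)
  also have "\<dots> = (\<Sum>x\<in>pverts G. \<Prod>i\<in>I. \<Sum>y\<in>pverts G. f x i y)"
    using assms by (intro sum.cong refl prod_sum_PiE[symmetric]) (auto simp: I_def)
  also have "\<dots> = (\<Sum>x\<in>pverts G. inscore G x ^ m * outscore G x ^ n)"
  proof (intro sum.cong refl)
    fix x
    have "(\<Prod>i\<in>I. \<Sum>y\<in>pverts G. f x i y)
        = (\<Prod>i\<in>{..<m}. \<Sum>y\<in>pverts G. f x i y) * (\<Prod>i\<in>{m<..m+n}. \<Sum>y\<in>pverts G. f x i y)"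
      unfolding I_def by (rule prod.union_disjoint) auto
    thus "(\<Prod>i\<in>I. \<Sum>y\<in>pverts G. f x i y) = inscore G x ^ m * outscore G x ^ n"
      by (simp add: f_def inscore_def outscore_def)
  qed
  finally show ?thesis .
qed

lemma inscore_tournament:
  assumes "tournament G" "x \<in> pverts G"
  shows "inscore G x = real (card (pverts G)) - 1 - outscore G x"
proof -
  note fin = tournament_finite[OF assms(1)]
  have "inscore G x + outscore G x = (\<Sum>y\<in>pverts G. if y = x then 0 else 1)"
    unfolding inscore_def outscore_def sum.distrib[symmetric]
    using weighted_tournament_adj[OF assms(1)] assms(2)
    by (intro sum.cong refl) (auto simp: weighted_tournament_def)
  also have "\<dots> = real (card (pverts G - {x}))"
    using fin by (simp add: sum.If_cases Diff_eq Compl_eq)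
  also have "\<dots> = real (card (pverts G)) - 1"
  proof -
    have "1 \<le> card (pverts G)" using fin assms(2) by (auto simp: Suc_le_eq card_gt_0_iff)
    thus ?thesis using assms(2) by (simp add: card_Diff_singleton of_nat_diff)
  qed
  finally show ?thesis by simp
qed

lemma outscore_bounds:
  assumes "tournament G" "x \<in> pverts G"
  shows "0 \<le> outscore G x" "outscore G x \<le> real (card (pverts G)) - 1" "outscore G x \<le> real (card (pverts G))"
proof -
  show "0 \<le> outscore G x" unfolding outscore_def adj_def by (intro sum_nonneg) auto
  have "0 \<le> inscore G x" unfolding inscore_def adj_def by (intro sum_nonneg) auto
  thus "outscore G x \<le> real (card (pverts G)) - 1" using inscore_tournament[OF assms] by simp
  thus "outscore G x \<le> real (card (pverts G))" by simp
qed

lemma card_pverts_S [simp]: "card (pverts (S_digraph m n)) = Suc (m + n)"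
proof -
  have "pverts (S_digraph m n) = {..m + n}" by (auto simp: S_digraph_def)
  thus ?thesis by simp
qed

lemma hom_density_S:
  assumes "tournament G"
  shows "hom_density (S_digraph m n) G
    = (\<Sum>x\<in>pverts G. (inscore G x / card (pverts G)) ^ m * (outscore G x / card (pverts G)) ^ n)
      / card (pverts G)"
  unfolding hom_density_def hom_count_S[OF tournament_finite[OF assms]]
  by (simp add: sum_divide_distrib power_divide power_add mult_ac)

lemma abs_moment_diff_le:
  fixes a b c d :: real
  assumes "0 \<le> a" "a \<le> 1" "0 \<le> b" "b \<le> 1" "0 \<le> c" "c \<le> 1" "0 \<le> d" "d \<le> 1"
  shows "\<bar>a ^ m * b ^ n - c ^ m * d ^ n\<bar> \<le> m * \<bar>a - c\<bar> + n * \<bar>b - d\<bar>"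
proof -
  have "a ^ m * b ^ n - c ^ m * d ^ n = (a ^ m - c ^ m) * b ^ n + c ^ m * (b ^ n - d ^ n)"
    by (simp add: algebra_simps)
  also have "\<bar>\<dots>\<bar> \<le> \<bar>a ^ m - c ^ m\<bar> * b ^ n + c ^ m * \<bar>b ^ n - d ^ n\<bar>"
    using assms by (intro order_trans[OF abs_triangle_ineq]) (simp add: abs_mult)
  also have "\<dots> \<le> \<bar>a ^ m - c ^ m\<bar> * 1 + 1 * \<bar>b ^ n - d ^ n\<bar>"
    using assms by (intro add_mono mult_mono power_le_one) auto
  also have "\<dots> \<le> m * \<bar>a - c\<bar> + n * \<bar>b - d\<bar>"
    using norm_power_diff[of a c m] norm_power_diff[of b d n] assms by simp
  finally show ?thesis .
qed

text \<open>Monomials are Lipschitz on the unit square, and in a tournament the inscore changes by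
  the same amount as the outscore. Cauchy-Schwarz then passes from the mean absolute score error to
  the mean square error that rounding controls; N^3 accounts for scores of order N averaged over N
  vertices.\<close>

lemma hom_density_S_diff_le:
  assumes G: "tournament G" and H: "tournament H" and V: "pverts H = pverts G" and ne: "pverts G \<noteq> {}"
  defines "N \<equiv> real (card (pverts G))"
  shows "\<bar>hom_density (S_digraph m n) H - hom_density (S_digraph m n) G\<bar>
    \<le> (m + n) * sqrt ((\<Sum>x\<in>pverts G. (outscore H x - outscore G x)\<^sup>2) / N ^ 3)"
proof -
  note fin = tournament_finite[OF G]
  have N: "N > 0" using fin ne by (simp add: N_def card_gt_0_iff)
  define D where "D = (\<Sum>x\<in>pverts G. (outscore H x - outscore G x)\<^sup>2)"
  define d where "d x = \<bar>outscore H x - outscore G x\<bar>" for x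
  have "\<bar>hom_density (S_digraph m n) H - hom_density (S_digraph m n) G\<bar>
    = \<bar>\<Sum>x\<in>pverts G. (inscore H x / N) ^ m * (outscore H x / N) ^ n - (inscore G x / N) ^ m * (outscore G x / N) ^ n\<bar> / N"
    using N unfolding hom_density_S[OF G] hom_density_S[OF H] V
    by (simp add: N_def[symmetric] diff_divide_distrib[symmetric] sum_subtractf)
  also have "\<dots> \<le> (\<Sum>x\<in>pverts G. \<bar>(inscore H x / N) ^ m * (outscore H x / N) ^ n - (inscore G x / N) ^ m * (outscore G x / N) ^ n\<bar>) / N"
    using N by (intro divide_right_mono sum_abs) auto
  also have "\<dots> \<le> (\<Sum>x\<in>pverts G. (m + n) * (d x / N)) / N"
  proof (intro divide_right_mono sum_mono)
    fix x assume x: "x \<in> pverts G"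
    note b = outscore_bounds[OF G x] outscore_bounds[OF H, unfolded V, OF x]
    note i = inscore_tournament[OF G x] inscore_tournament[OF H, unfolded V, OF x]
    have "\<bar>(inscore H x / N) ^ m * (outscore H x / N) ^ n - (inscore G x / N) ^ m * (outscore G x / N) ^ n\<bar>
      \<le> m * \<bar>inscore H x / N - inscore G x / N\<bar> + n * \<bar>outscore H x / N - outscore G x / N\<bar>"
      using N b unfolding i N_def[symmetric]
      by (intro abs_moment_diff_le) auto
    also have "\<bar>inscore H x / N - inscore G x / N\<bar> = d x / N"
      using N by (simp add: i d_def diff_divide_distrib[symmetric] abs_divide abs_minus_commute)
    also have "\<bar>outscore H x / N - outscore G x / N\<bar> = d x / N"
      using N by (simp add: d_def diff_divide_distrib[symmetric] abs_divide)
    finally show "\<bar>(inscore H x / N) ^ m * (outscore H x / N) ^ n - (inscore G x / N) ^ m * (outscore G x / N) ^ n\<bar>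
      \<le> (m + n) * (d x / N)" by (simp add: algebra_simps)
  qed (use N in auto)
  also have "\<dots> = (m + n) * ((\<Sum>x\<in>pverts G. d x) / N\<^sup>2)"
    by (simp add: sum_distrib_left[symmetric] sum_divide_distrib[symmetric] power2_eq_square)
  also have "\<dots> \<le> (m + n) * sqrt (D / N ^ 3)"
  proof (intro mult_left_mono real_le_rsqrt)
    have "(\<Sum>x\<in>pverts G. d x)\<^sup>2 \<le> N * D"
      using sum_square_le_card[of d "pverts G"] by (simp add: d_def D_def N_def)
    hence "(\<Sum>x\<in>pverts G. d x)\<^sup>2 / N ^ 4 \<le> N * D / N ^ 4" using N by (intro divide_right_mono) auto
    also have "N * D / N ^ 4 = D / N ^ 3" using N by (simp add: eval_nat_numeral)
    finally show "((\<Sum>x\<in>pverts G. d x) / N\<^sup>2)\<^sup>2 \<le> D / N ^ 3" by (simp add: power_divide)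
  qed simp
  finally show ?thesis by (simp add: D_def)
qed

lemma sum3_swap12: "(\<Sum>x\<in>V. \<Sum>y\<in>V. \<Sum>z\<in>V. h x y z) = (\<Sum>x\<in>V. \<Sum>y\<in>V. \<Sum>z\<in>V. h y x z)"
  by (rule sum.swap)

lemma sum3_swap23: "(\<Sum>x\<in>V. \<Sum>y\<in>V. \<Sum>z\<in>V. h x y z) = (\<Sum>x\<in>V. \<Sum>y\<in>V. \<Sum>z\<in>V. h x z y)"
  by (rule sum.cong[OF refl], rule sum.swap)

text \<open>Every triple of distinct vertices spans a transitive triangle, with one path of length two,
  or a cyclic one, with three.\<close>

lemma path_density_C3_density:
  assumes G: "tournament G" and ne: "pverts G \<noteq> {}"
  defines "N \<equiv> real (card (pverts G))"
  shows "\<bar>hom_density (S_digraph 1 1) G - (1 / 6 + 2 / 3 * hom_density C3_digraph G)\<bar> \<le> 1 / N"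
proof -
  note fin = tournament_finite[OF G]
  define V w where "V = pverts G" and "w = adj G"
  have N: "N > 0" using fin ne by (simp add: N_def card_gt_0_iff)
  define \<Sigma> where "\<Sigma> h = (\<Sum>x\<in>V. \<Sum>y\<in>V. \<Sum>z\<in>V. h x y z)" for h :: "'a \<Rightarrow> 'a \<Rightarrow> 'a \<Rightarrow> real"
  have sw: "\<Sigma> h = \<Sigma> (\<lambda>x y z. h y x z)" "\<Sigma> h = \<Sigma> (\<lambda>x y z. h x z y)" for h
    unfolding \<Sigma>_def by (rule sum3_swap12, rule sum3_swap23)
  have add: "\<Sigma> (\<lambda>x y z. h x y z + k x y z) = \<Sigma> h + \<Sigma> k" for h k
    unfolding \<Sigma>_def by (simp add: sum.distrib)
  define C T where "C = \<Sigma> (\<lambda>x y z. w x y * w y z * w z x)" and "T = \<Sigma> (\<lambda>x y z. w x y * w y z * w x z)"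
  have anti: "w x y * w y x = 0" for x y
  proof (cases "(x, y) \<in> parcs G \<and> (y, x) \<in> parcs G")
    case True
    have "x \<in> pverts G" "y \<in> pverts G" "x \<noteq> y"
      using pair_digraph_finite(3,4)[of G] G True unfolding tournament_def by auto
    hence False using G True unfolding tournament_def by blast
    thus ?thesis ..
  qed (auto simp: w_def adj_def)
  have ww: "w x y + w y x = 1 - (if x = y then 1 else 0)" if "x \<in> V" "y \<in> V" for x y
    using weighted_tournament_adj[OF G] that unfolding weighted_tournament_def w_def V_def by auto
  \<comment> \<open>Expanding the product gives the eight orientations of a triangle, two cyclic and
    six transitive; permuting the summation variables brings each to the form \<open>C\<close> or
    \<open>T\<close>. On distinct triples the product is 1 and on all others 0, so 2 C + 6 T differs
    from N^3 by at most 3 N^2.\<close>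
  have "\<Sigma> (\<lambda>x y z. (w x y + w y x) * (w y z + w z y) * (w z x + w x z))
     = \<Sigma> (\<lambda>x y z. w x y * w y z * w z x) + \<Sigma> (\<lambda>x y z. w x y * w y z * w x z)
     + \<Sigma> (\<lambda>x y z. w z x * w x y * w z y) + \<Sigma> (\<lambda>x y z. w x z * w z y * w x y)
     + \<Sigma> (\<lambda>x y z. w y z * w z x * w y x) + \<Sigma> (\<lambda>x y z. w y x * w x z * w y z)
     + \<Sigma> (\<lambda>x y z. w z y * w y x * w z x) + \<Sigma> (\<lambda>x y z. w x z * w z y * w y x)"
    unfolding add[symmetric] by (simp add: algebra_simps)
  also have "\<Sigma> (\<lambda>x y z. w z x * w x y * w z y) = T"
    unfolding T_def by (subst sw(2), subst sw(1)) simp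
  also have "\<Sigma> (\<lambda>x y z. w x z * w z y * w x y) = T"
    unfolding T_def by (subst sw(2)) simp
  also have "\<Sigma> (\<lambda>x y z. w y z * w z x * w y x) = T"
    unfolding T_def by (subst sw(1), subst sw(2)) simp
  also have "\<Sigma> (\<lambda>x y z. w y x * w x z * w y z) = T"
    unfolding T_def by (subst sw(1)) simp
  also have "\<Sigma> (\<lambda>x y z. w z y * w y x * w z x) = T"
    unfolding T_def by (subst sw(1), subst sw(2), subst sw(1)) simp
  also have "\<Sigma> (\<lambda>x y z. w x z * w z y * w y x) = C"
    unfolding C_def by (subst sw(2)) simp
  finally have eq: "\<Sigma> (\<lambda>x y z. (w x y + w y x) * (w y z + w z y) * (w z x + w x z)) = 2 * C + 6 * T"
    unfolding C_def T_def by simp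
  have "\<Sigma> (\<lambda>x y z. (w x y + w y x) * (w y z + w z y) * (w z x + w x z)) \<le> \<Sigma> (\<lambda>x y z. 1)"
    unfolding \<Sigma>_def by (intro sum_mono) (auto simp: ww)
  also have "\<dots> = N ^ 3" unfolding \<Sigma>_def by (simp add: V_def N_def eval_nat_numeral)
  finally have up: "2 * C + 6 * T \<le> N ^ 3" unfolding eq .
  have "N ^ 3 - 3 * N\<^sup>2 = \<Sigma> (\<lambda>x y z. 1 - (if y = x then 1 else 0) - (if z = y then 1 else 0) - (if z = x then 1 else 0))"
  proof -
    have "(\<Sum>x\<in>V. \<Sum>y\<in>V. \<Sum>z\<in>V. if y = x then 1 else (0::real)) = (\<Sum>x\<in>V. \<Sum>y\<in>V. if y = x then N else 0)"
      by (intro sum.cong) (auto simp: N_def V_def)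
    also have "\<dots> = N\<^sup>2" using fin by (simp add: V_def N_def power2_eq_square)
    finally have 1: "(\<Sum>x\<in>V. \<Sum>y\<in>V. \<Sum>z\<in>V. if y = x then 1 else (0::real)) = N\<^sup>2" .
    have 2: "(\<Sum>x\<in>V. \<Sum>y\<in>V. \<Sum>z\<in>V. if z = y then 1 else (0::real)) = N\<^sup>2"
      "(\<Sum>x\<in>V. \<Sum>y\<in>V. \<Sum>z\<in>V. if z = x then 1 else (0::real)) = N\<^sup>2"
      using fin by (simp_all add: V_def N_def power2_eq_square)
    show ?thesis unfolding \<Sigma>_def sum_subtractf 1 2 by (simp add: V_def N_def eval_nat_numeral)
  qed
  also have "\<dots> \<le> \<Sigma> (\<lambda>x y z. (w x y + w y x) * (w y z + w z y) * (w z x + w x z))"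
    unfolding \<Sigma>_def by (intro sum_mono) (auto simp: ww)
  finally have low: "N ^ 3 - 3 * N\<^sup>2 \<le> 2 * C + 6 * T" unfolding eq .
  have "(\<Sum>x\<in>V. inscore G x * outscore G x) = \<Sigma> (\<lambda>x y z. w y x * w x z)"
    unfolding \<Sigma>_def by (simp add: inscore_def outscore_def sum_product V_def w_def)
  also have "\<dots> = \<Sigma> (\<lambda>x y z. w x y * w y z)" by (subst sw(1)) simp
  also have "\<dots> = \<Sigma> (\<lambda>x y z. w x y * w y z * w z x + w x y * w y z * w x z)"
    unfolding \<Sigma>_def
  proof (intro sum.cong refl)
    fix x y z assume "x \<in> V" "y \<in> V" "z \<in> V"
    hence "w x y * w y z * (w z x + w x z) = w x y * w y z - (if z = x then w x y * w y x else 0)"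
      by (auto simp: ww right_diff_distrib)
    thus "w x y * w y z = w x y * w y z * w z x + w x y * w y z * w x z"
      by (simp add: anti algebra_simps split: if_splits)
  qed
  also have "\<dots> = C + T" unfolding add C_def T_def ..
  finally have P: "(\<Sum>x\<in>V. inscore G x * outscore G x) = C + T" .
  have S11: "hom_density (S_digraph 1 1) G = (C + T) / N ^ 3"
    using hom_count_S[OF fin, of 1 1] P
    by (simp add: hom_density_def V_def N_def eval_nat_numeral)
  have C3: "hom_density C3_digraph G = C / N ^ 3"
    using hom_count_C3[OF fin]
    by (simp add: hom_density_def C_def \<Sigma>_def V_def w_def N_def C3_digraph_def eval_nat_numeral)
  \<comment> \<open>Eliminating \<open>T\<close> from 2 C + 6 T = N^3, up to the error above, is the
    origin of the constants 1/6 and 2/3.\<close>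
  have "(C + T) / N ^ 3 - (1 / 6 + 2 / 3 * (C / N ^ 3)) = (2 * C + 6 * T - N ^ 3) / (6 * N ^ 3)"
    using N by (simp add: field_simps)
  also have "\<bar>\<dots>\<bar> \<le> (3 * N\<^sup>2) / (6 * N ^ 3)"
  proof -
    have "\<bar>2 * C + 6 * T - N ^ 3\<bar> \<le> 3 * N\<^sup>2" using up low by linarith
    moreover have "\<bar>6 * N ^ 3\<bar> = 6 * N ^ 3" using N by simp
    ultimately show ?thesis using N by (simp only: abs_divide) (intro divide_right_mono, auto)
  qed
  also have "\<dots> = 1 / (2 * N)" using N by (simp add: field_simps eval_nat_numeral)
  also have "\<dots> \<le> 1 / N" using N by (simp add: field_simps)
  finally show ?thesis unfolding S11 C3 .
qed

section \<open>Compactness and transitive limits\<close>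

lemma countable_digraphs: "countable {F :: 'a::countable pair_pre_digraph. pair_digraph F}"
proof -
  have "inj_on (\<lambda>F::'a pair_pre_digraph. (pverts F, parcs F)) {F. pair_digraph F}"
    by (intro inj_onI pair_pre_digraph.equality) auto
  moreover have "(\<lambda>F. (pverts F, parcs F)) ` {F :: 'a pair_pre_digraph. pair_digraph F}
      \<subseteq> {A. finite A} \<times> {A. finite A}"
    using pair_digraph_finite by fastforce
  hence "countable ((\<lambda>F. (pverts F, parcs F)) ` {F :: 'a pair_pre_digraph. pair_digraph F})"
    by (rule countable_subset) (intro countable_SIGMA countable_Collect_finite)
  ultimately show ?thesis by (metis countable_image_inj_on)
qed

lemma hom_density_bounds:
  assumes "finite (pverts F)" "finite (pverts G)"
  shows "0 \<le> hom_density F G" "hom_density F G \<le> 1"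
proof -
  show "0 \<le> hom_density F G" by (simp add: hom_density_def)
  have "hom_count F G \<le> card (pverts F \<rightarrow>\<^sub>E pverts G)"
    unfolding hom_count_def using assms by (intro card_mono finite_PiE) auto
  also have "\<dots> = card (pverts G) ^ card (pverts F)" using assms(1) by (simp add: card_PiE)
  finally have "real (hom_count F G) \<le> real (card (pverts G)) ^ card (pverts F)"
    by (metis of_nat_le_iff of_nat_power)
  thus "hom_density F G \<le> 1" unfolding hom_density_def by (intro divide_le_eq_1[THEN iffD2]) auto
qed

text \<open>Diagonal argument: there are countably many digraphs on natural numbers, and the
  densities of each lie in the compact interval [0,1].\<close>

lemma ex_convergent_subsequence:
  assumes G: "\<And>n. tournament (G n)" and lim: "filterlim (\<lambda>n. card (pverts (G n))) at_top sequentially"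
  shows "\<exists>r. strict_mono r \<and> convergent_tournaments (G \<circ> r)"
proof -
  define Fs where "Fs = from_nat_into {F :: nat pair_pre_digraph. pair_digraph F}"
  let ?P = "\<lambda>n s. convergent (\<lambda>k. hom_density (Fs n) (G (s k)))"
  have ne: "{F :: nat pair_pre_digraph. pair_digraph F} \<noteq> {}" using pair_digraph_C3_digraph by blast
  have Fs: "pair_digraph (Fs n)" for n
    using from_nat_into[OF ne, of n] unfolding Fs_def by simp
  interpret subseqs ?P
  proof
    fix n and s :: "nat \<Rightarrow> nat" assume "strict_mono s"
    have "\<forall>k. hom_density (Fs n) (G (s k)) \<in> {0..1}"
      using hom_density_bounds[OF pair_digraph_finite(1)[OF Fs] tournament_finite[OF G]] by simp
    then obtain l r where "strict_mono r" "((\<lambda>k. hom_density (Fs n) (G (s k))) \<circ> r) \<longlonglongrightarrow> l"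
      using compact_Icc[THEN compact_imp_seq_compact] seq_compactE by metis
    thus "\<exists>r. strict_mono r \<and> ?P n (s \<circ> r)"
      by (intro exI[of _ r]) (auto simp: convergent_def comp_def)
  qed
  have "?P n diagseq" for n
  proof -
    have "?P n (diagseq \<circ> ((+) (Suc n)))"
    proof (rule diagseq_holds)
      fix r s :: "nat \<Rightarrow> nat" and n assume "strict_mono r" "?P n s"
      thus "?P n (s \<circ> r)"
        using convergent_subseq_convergent[of "\<lambda>k. hom_density (Fs n) (G (s k))" r] by (simp add: comp_def)
    qed
    thus ?thesis
      using convergent_ignore_initial_segment[of "\<lambda>k. hom_density (Fs n) (G (diagseq k))" "Suc n"]
      by (simp add: comp_def add.commute)
  qed
  hence "convergent (\<lambda>k. hom_density F (G (diagseq k)))" if "pair_digraph F" for F :: "nat pair_pre_digraph"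
    using from_nat_into_to_nat_on[OF countable_digraphs, of F] that unfolding Fs_def by (metis mem_Collect_eq)
  moreover have "filterlim (\<lambda>n. card (pverts (G (diagseq n)))) at_top sequentially"
    using filterlim_compose[OF lim filterlim_subseq[OF subseq_diagseq]] .
  ultimately have "convergent_tournaments (G \<circ> diagseq)"
    using G by (auto simp: convergent_tournaments_def)
  with subseq_diagseq show ?thesis by blast
qed

section \<open>Homomorphism counts in nearly transitive tournaments\<close>

text \<open>Counting predecessors ranks \<open>I\<close> bijectively by 0, ..., card I - 1, both for
  \<open>less\<close> (rank \<open>r\<close>) and for the natural order (rank \<open>q\<close>). The
  permutation is \<open>r\<close> followed by the inverse of \<open>q\<close>; it makes all strict
  linear orders on \<open>I\<close> look alike.\<close>

lemma ex_order_permutation: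
  fixes I :: "'a::linorder set" and less :: "'a \<Rightarrow> 'a \<Rightarrow> bool"
  assumes fin: "finite I"
    and irr: "\<And>i. \<not> less i i"
    and tr: "\<And>i j l. i \<in> I \<Longrightarrow> j \<in> I \<Longrightarrow> l \<in> I \<Longrightarrow> less i j \<Longrightarrow> less j l \<Longrightarrow> less i l"
    and tot: "\<And>i j. i \<in> I \<Longrightarrow> j \<in> I \<Longrightarrow> i \<noteq> j \<Longrightarrow> less i j \<or> less j i"
  shows "\<exists>\<tau>. \<tau> permutes I \<and> (\<forall>i\<in>I. \<forall>j\<in>I. less i j \<longleftrightarrow> \<tau> i < \<tau> j)"
proof -
  have rank: "\<exists>r. bij_betw r I {..<card I} \<and> (\<forall>i\<in>I. \<forall>j\<in>I. R i j \<longleftrightarrow> r i < r j)"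
    if irr: "\<And>i. \<not> R i i"
      and tr: "\<And>i j l. i \<in> I \<Longrightarrow> j \<in> I \<Longrightarrow> l \<in> I \<Longrightarrow> R i j \<Longrightarrow> R j l \<Longrightarrow> R i l"
      and tot: "\<And>i j. i \<in> I \<Longrightarrow> j \<in> I \<Longrightarrow> i \<noteq> j \<Longrightarrow> R i j \<or> R j i" for R
  proof -
    define r where "r i = card {j \<in> I. R j i}" for i
    have mono: "r i < r j" if "i \<in> I" "j \<in> I" "R i j" for i j
      unfolding r_def
    proof (intro psubset_card_mono psubsetI)
      show "{l \<in> I. R l i} \<subseteq> {l \<in> I. R l j}" using that tr by blast
      have "i \<in> {l \<in> I. R l j}" "i \<notin> {l \<in> I. R l i}" using that irr by auto
      thus "{l \<in> I. R l i} \<noteq> {l \<in> I. R l j}" by metis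
    qed (use fin in simp)
    have iff: "R i j \<longleftrightarrow> r i < r j" if "i \<in> I" "j \<in> I" for i j
      using mono[OF that] mono[OF that(2,1)] tot[OF that] by (metis less_asym less_irrefl)
    have "inj_on r I"
      using iff tot by (intro inj_onI) (metis less_irrefl)
    moreover have "r ` I \<subseteq> {..<card I}"
    proof
      fix y assume "y \<in> r ` I"
      then obtain i where "i \<in> I" "y = r i" by auto
      moreover have "{j \<in> I. R j i} \<subset> I" using irr \<open>i \<in> I\<close> by auto
      ultimately show "y \<in> {..<card I}" using fin by (auto simp: r_def intro: psubset_card_mono)
    qed
    ultimately have "bij_betw r I {..<card I}"
      by (simp add: bij_betw_def card_image card_subset_eq)
    with iff show ?thesis by blast
  qed
  obtain r where r: "bij_betw r I {..<card I}" "\<forall>i\<in>I. \<forall>j\<in>I. less i j \<longleftrightarrow> r i < r j"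
    using rank[of less] irr tr tot by blast
  have "\<exists>q. bij_betw q I {..<card I} \<and> (\<forall>i\<in>I. \<forall>j\<in>I. i < j \<longleftrightarrow> q i < q j)"
    by (rule rank) auto
  then obtain q where q: "bij_betw q I {..<card I}" "\<forall>i\<in>I. \<forall>j\<in>I. i < j \<longleftrightarrow> q i < q j" by blast
  define \<tau> where "\<tau> i = (if i \<in> I then inv_into I q (r i) else i)" for i
  have "bij_betw (inv_into I q \<circ> r) I I"
    using bij_betw_trans[OF r(1) bij_betw_inv_into[OF q(1)]] .
  hence "bij_betw \<tau> I I" by (rule bij_betw_cong[THEN iffD1, rotated]) (simp add: \<tau>_def)
  hence "\<tau> permutes I" by (rule bij_imp_permutes) (simp add: \<tau>_def)
  moreover have "less i j \<longleftrightarrow> \<tau> i < \<tau> j" if "i \<in> I" "j \<in> I" for i j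
  proof -
    have "q (\<tau> i) = r i" if "i \<in> I" for i
      using that r(1) q(1) by (auto simp: \<tau>_def bij_betw_def intro!: f_inv_into_f)
    moreover have "\<tau> i \<in> I" "\<tau> j \<in> I" using that \<open>bij_betw \<tau> I I\<close> by (auto simp: bij_betw_def)
    ultimately show ?thesis using q(2) r(2) that by simp
  qed
  ultimately show ?thesis by blast
qed

text \<open>A linear order of the vertices is encoded by the permutation \<pi> for which
  \<open>i\<close> precedes \<open>j\<close> iff \<open>\<pi> i < \<pi> j\<close>. Linear extensions
  can thus be matched with homomorphisms by composing permutations.\<close>

definition linear_extensions :: "nat pair_pre_digraph \<Rightarrow> nat" where
  "linear_extensions F = card {\<pi>. \<pi> permutes pverts F \<and> (\<forall>(i, j)\<in>parcs F. \<pi> i < \<pi> j)}"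

text \<open>A tournament is transitive iff it has no cyclic triangle. In this form the excluded maps
  can be bounded by the density of \<open>C3_digraph\<close>.\<close>

definition transitive_embeddings :: "nat set \<Rightarrow> 'a pair_pre_digraph \<Rightarrow> (nat \<Rightarrow> 'a) set" where
  "transitive_embeddings I G = {\<phi> \<in> I \<rightarrow>\<^sub>E pverts G. inj_on \<phi> I \<and>
     (\<forall>i\<in>I. \<forall>j\<in>I. \<forall>l\<in>I. \<not> ((\<phi> i, \<phi> j) \<in> parcs G \<and> (\<phi> j, \<phi> l) \<in> parcs G \<and> (\<phi> l, \<phi> i) \<in> parcs G))}"

lemma transitive_embeddings_permute:
  assumes "\<phi> \<in> transitive_embeddings I G" "\<pi> permutes I"
  shows "\<phi> \<circ> \<pi> \<in> transitive_embeddings I G"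
proof -
  have \<pi>: "\<pi> i \<in> I \<longleftrightarrow> i \<in> I" for i using assms(2) by (rule permutes_in_image)
  have \<phi>: "\<phi> \<in> I \<rightarrow>\<^sub>E pverts G" using assms(1) by (simp add: transitive_embeddings_def)
  have "\<phi> \<circ> \<pi> \<in> I \<rightarrow>\<^sub>E pverts G"
  proof (rule PiE_I)
    fix i assume "i \<in> I"
    hence "\<pi> i \<in> I" using \<pi> by blast
    thus "(\<phi> \<circ> \<pi>) i \<in> pverts G" using PiE_mem[OF \<phi>] by simp
  next
    fix i assume "i \<notin> I"
    thus "(\<phi> \<circ> \<pi>) i = undefined" using PiE_arb[OF \<phi>] permutes_not_in[OF assms(2)] by simp
  qed
  moreover have "inj_on (\<phi> \<circ> \<pi>) I"
    using assms by (intro comp_inj_on) (auto simp: transitive_embeddings_def permutes_image permutes_inj_on)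
  moreover have "\<not> (((\<phi> \<circ> \<pi>) i, (\<phi> \<circ> \<pi>) j) \<in> parcs G \<and> ((\<phi> \<circ> \<pi>) j, (\<phi> \<circ> \<pi>) l) \<in> parcs G
      \<and> ((\<phi> \<circ> \<pi>) l, (\<phi> \<circ> \<pi>) i) \<in> parcs G)" if "i \<in> I" "j \<in> I" "l \<in> I" for i j l
  proof -
    have "\<pi> i \<in> I" "\<pi> j \<in> I" "\<pi> l \<in> I" using that \<pi> by blast+
    thus ?thesis using assms(1) unfolding transitive_embeddings_def comp_apply by blast
  qed
  ultimately show ?thesis unfolding transitive_embeddings_def by blast
qed

text \<open>Pulling the arcs back along \<phi> gives a strict linear order on the vertices of
  \<open>F\<close>, represented by a permutation \<tau>. Composition with \<tau> maps the
  permutations counted here bijectively onto the linear extensions.\<close>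

lemma card_permutations_into_transitive:
  assumes G: "tournament G" and F: "pair_digraph F" and \<phi>: "\<phi> \<in> transitive_embeddings (pverts F) G"
  shows "card {\<pi>. \<pi> permutes pverts F \<and> (\<forall>(i, j)\<in>parcs F. ((\<phi> \<circ> \<pi>) i, (\<phi> \<circ> \<pi>) j) \<in> parcs G)}
    = linear_extensions F"
proof -
  define I where "I = pverts F"
  have fin: "finite I" and FI: "parcs F \<subseteq> I \<times> I" using pair_digraph_finite[OF F] by (auto simp: I_def)
  define less where "less i j \<longleftrightarrow> (\<phi> i, \<phi> j) \<in> parcs G" for i j
  have tot: "less i j \<longleftrightarrow> \<not> less j i" if "i \<in> I" "j \<in> I" "i \<noteq> j" for i j
  proof -
    have "\<phi> i \<in> pverts G" "\<phi> j \<in> pverts G" "\<phi> i \<noteq> \<phi> j"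
      using \<phi> that by (auto simp: transitive_embeddings_def I_def inj_on_def)
    thus ?thesis using G unfolding tournament_def less_def by blast
  qed
  have irr: "\<not> less i i" for i
    using G pair_digraph_finite(4)[of G] unfolding tournament_def less_def by blast
  have "\<exists>\<tau>. \<tau> permutes I \<and> (\<forall>i\<in>I. \<forall>j\<in>I. less i j \<longleftrightarrow> \<tau> i < \<tau> j)"
  proof (rule ex_order_permutation[OF fin irr])
    fix i j l assume I: "i \<in> I" "j \<in> I" "l \<in> I" and l: "less i j" "less j l"
    have "\<not> less l i" using \<phi> I l unfolding transitive_embeddings_def less_def I_def by blast
    moreover have "i \<noteq> l" using I l tot irr by metis
    ultimately show "less i l" using tot I by blast
  qed (use tot in blast)
  then obtain \<tau> where \<tau>: "\<tau> permutes I" "\<And>i j. i \<in> I \<Longrightarrow> j \<in> I \<Longrightarrow> less i j \<longleftrightarrow> \<tau> i < \<tau> j" by blast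
  have "bij_betw ((\<circ>) \<tau>) {\<pi>. \<pi> permutes I \<and> (\<forall>(i, j)\<in>parcs F. less (\<pi> i) (\<pi> j))}
     {\<pi>. \<pi> permutes I \<and> (\<forall>(i, j)\<in>parcs F. \<pi> i < \<pi> j)}"
  proof (rule bij_betwI[where g = "(\<circ>) (inv \<tau>)"])
    show "(\<circ>) \<tau> \<in> {\<pi>. \<pi> permutes I \<and> (\<forall>(i, j)\<in>parcs F. less (\<pi> i) (\<pi> j))}
       \<rightarrow> {\<pi>. \<pi> permutes I \<and> (\<forall>(i, j)\<in>parcs F. \<pi> i < \<pi> j)}"
      using \<tau> FI by (fastforce intro: permutes_compose simp: permutes_in_image)
    show "(\<circ>) (inv \<tau>) \<in> {\<pi>. \<pi> permutes I \<and> (\<forall>(i, j)\<in>parcs F. \<pi> i < \<pi> j)}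
       \<rightarrow> {\<pi>. \<pi> permutes I \<and> (\<forall>(i, j)\<in>parcs F. less (\<pi> i) (\<pi> j))}"
    proof (intro Pi_I CollectI conjI)
      fix \<pi> assume \<pi>: "\<pi> \<in> {\<pi>. \<pi> permutes I \<and> (\<forall>(i, j)\<in>parcs F. \<pi> i < \<pi> j)}"
      show p: "inv \<tau> \<circ> \<pi> permutes I" using \<pi> \<tau>(1) by (auto intro: permutes_compose permutes_inv)
      show "\<forall>(i, j)\<in>parcs F. less ((inv \<tau> \<circ> \<pi>) i) ((inv \<tau> \<circ> \<pi>) j)"
      proof (intro ballI, clarify)
        fix i j assume e: "(i, j) \<in> parcs F"
        hence "(inv \<tau> \<circ> \<pi>) i \<in> I" "(inv \<tau> \<circ> \<pi>) j \<in> I" using FI p by (auto simp: permutes_in_image simp del: comp_apply)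
        moreover have "\<tau> ((inv \<tau> \<circ> \<pi>) i) < \<tau> ((inv \<tau> \<circ> \<pi>) j)"
          using e \<pi> by (auto simp: permutes_inverses[OF \<tau>(1)])
        ultimately show "less ((inv \<tau> \<circ> \<pi>) i) ((inv \<tau> \<circ> \<pi>) j)" using \<tau>(2) by blast
      qed
    qed
  qed (simp_all add: fun_eq_iff permutes_inverses[OF \<tau>(1)])
  thus ?thesis unfolding linear_extensions_def less_def I_def by (simp add: bij_betw_same_card)
qed

text \<open>Averaging over relabellings: a uniformly random bijection onto a transitive set of vertices is
  a homomorphism with a probability that depends on the digraph only.\<close>

lemma card_transitive_homs:
  assumes G: "tournament G" and F: "pair_digraph F"
  shows "fact (card (pverts F)) *
      card {\<phi> \<in> transitive_embeddings (pverts F) G. \<forall>(i, j)\<in>parcs F. (\<phi> i, \<phi> j) \<in> parcs G}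
    = linear_extensions F * card (transitive_embeddings (pverts F) G)"
proof -
  define I E where "I = pverts F" and "E = transitive_embeddings I G"
  define hom where "hom \<phi> \<longleftrightarrow> (\<forall>(i, j)\<in>parcs F. (\<phi> i, \<phi> j) \<in> parcs G)" for \<phi>
  define Ps where "Ps = {\<pi>. \<pi> permutes I}"
  have fin: "finite I" using pair_digraph_finite[OF F] by (auto simp: I_def)
  have finE: "finite E" unfolding E_def transitive_embeddings_def
    using fin tournament_finite[OF G] by (intro finite_subset[OF _ finite_PiE]) auto
  have finP: "finite Ps" unfolding Ps_def using fin by (rule finite_permutations)
  have relabel: "card {\<phi> \<in> E. hom (\<phi> \<circ> \<pi>)} = card {\<phi> \<in> E. hom \<phi>}" if "\<pi> \<in> Ps" for \<pi>
  proof -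
    have \<pi>: "\<pi> permutes I" "inv \<pi> permutes I" using that by (auto simp: Ps_def permutes_inv)
    have [simp]: "\<phi> \<circ> inv \<pi> \<circ> \<pi> = \<phi>" "\<phi> \<circ> \<pi> \<circ> inv \<pi> = \<phi>" for \<phi> :: "nat \<Rightarrow> 'a"
      using permutes_inv_o[OF \<pi>(1)] by (simp_all add: comp_assoc)
    have "bij_betw (\<lambda>\<phi>. \<phi> \<circ> inv \<pi>) {\<phi> \<in> E. hom \<phi>} {\<phi> \<in> E. hom (\<phi> \<circ> \<pi>)}"
      by (rule bij_betwI[where g = "\<lambda>\<phi>. \<phi> \<circ> \<pi>"])
         (auto simp: E_def intro: transitive_embeddings_permute \<pi>)
    thus ?thesis by (rule bij_betw_same_card[symmetric])
  qed
  \<comment> \<open>Double counting of pairs of a permutation \<pi> and an embedding \<phi> such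
    that their composition is a homomorphism: for fixed \<pi> the number does not depend on \<pi> by
    \<open>relabel\<close>, for fixed \<phi> it is the number of linear extensions.\<close>
  have "card Ps * card {\<phi> \<in> E. hom \<phi>} = (\<Sum>\<pi>\<in>Ps. card {\<phi> \<in> E. hom (\<phi> \<circ> \<pi>)})"
    by (simp add: relabel)
  also have "\<dots> = (\<Sum>\<pi>\<in>Ps. \<Sum>\<phi>\<in>E. if hom (\<phi> \<circ> \<pi>) then 1 else 0)"
    using finE by (simp add: sum.inter_filter[symmetric])
  also have "\<dots> = (\<Sum>\<phi>\<in>E. \<Sum>\<pi>\<in>Ps. if hom (\<phi> \<circ> \<pi>) then 1 else 0)" by (rule sum.swap)
  also have "\<dots> = (\<Sum>\<phi>\<in>E. card {\<pi> \<in> Ps. hom (\<phi> \<circ> \<pi>)})"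
    using finP by (simp add: sum.inter_filter[symmetric])
  also have "\<dots> = (\<Sum>\<phi>\<in>E. linear_extensions F)"
    using card_permutations_into_transitive[OF G F]
    by (intro sum.cong refl) (simp add: E_def I_def Ps_def hom_def)
  finally show ?thesis using card_permutations[OF refl fin]
    by (simp add: Ps_def hom_def E_def I_def mult.commute)
qed

lemma card_collision_maps:
  assumes "finite I" "i \<in> I" "j \<in> I" "i \<noteq> j" "finite V"
  shows "real (card {\<phi> \<in> I \<rightarrow>\<^sub>E V. \<phi> i = \<phi> j}) * card V = real (card V) ^ card I"
proof -
  define J where "J = I - {i} - {j}"
  have I: "I = insert i (insert j J)" "i \<notin> insert j J" "j \<notin> J" "finite J" using assms by (auto simp: J_def)
  have "real (card {\<phi> \<in> I \<rightarrow>\<^sub>E V. \<phi> i = \<phi> j}) = (\<Sum>\<phi>\<in>{\<phi> \<in> I \<rightarrow>\<^sub>E V. \<phi> i = \<phi> j}. 1)" by simp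
  also have "\<dots> = (\<Sum>\<phi>\<in>I \<rightarrow>\<^sub>E V. if \<phi> i = \<phi> j then 1 else 0)"
    using assms by (intro sum.inter_filter finite_PiE) auto
  also have "\<dots> = (\<Sum>x\<in>V. \<Sum>y\<in>V. \<Sum>\<phi>\<in>J \<rightarrow>\<^sub>E V. if x = y then 1 else 0)"
    unfolding I(1) sum_PiE_insert[OF I(2)] sum_PiE_insert[OF I(3)] using assms(4)
    by (simp cong: if_cong)
  also have "\<dots> = (\<Sum>x\<in>V. \<Sum>y\<in>V. if x = y then real (card V) ^ card J else 0)"
    using I(4) by (intro sum.cong refl) (simp add: card_PiE)
  also have "\<dots> = real (card V) ^ Suc (card J)" using assms by simp
  finally show ?thesis using I by simp
qed

lemma card_cyclic_maps:
  assumes "finite I" "i \<in> I" "j \<in> I" "l \<in> I" "distinct [i, j, l]" "finite (pverts G)"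
  shows "real (card {\<phi> \<in> I \<rightarrow>\<^sub>E pverts G. (\<phi> i, \<phi> j) \<in> parcs G \<and> (\<phi> j, \<phi> l) \<in> parcs G \<and> (\<phi> l, \<phi> i) \<in> parcs G})
    = hom_density C3_digraph G * real (card (pverts G)) ^ card I"
proof -
  define J V where "J = I - {i} - {j} - {l}" and "V = pverts G"
  have I: "I = insert i (insert j (insert l J))" "i \<notin> insert j (insert l J)" "j \<notin> insert l J" "l \<notin> J" "finite J"
    using assms by (auto simp: J_def)
  let ?P = "\<lambda>\<phi>. (\<phi> i, \<phi> j) \<in> parcs G \<and> (\<phi> j, \<phi> l) \<in> parcs G \<and> (\<phi> l, \<phi> i) \<in> parcs G"
  have "real (card {\<phi> \<in> I \<rightarrow>\<^sub>E V. ?P \<phi>}) = (\<Sum>\<phi>\<in>{\<phi> \<in> I \<rightarrow>\<^sub>E V. ?P \<phi>}. 1)" by simp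
  also have "\<dots> = (\<Sum>\<phi>\<in>I \<rightarrow>\<^sub>E V. if ?P \<phi> then 1 else 0)"
    using assms by (intro sum.inter_filter finite_PiE) (auto simp: V_def)
  also have "\<dots> = (\<Sum>\<phi>\<in>I \<rightarrow>\<^sub>E V. adj G (\<phi> i) (\<phi> j) * adj G (\<phi> j) (\<phi> l) * adj G (\<phi> l) (\<phi> i))"
    by (intro sum.cong refl) (simp add: adj_def)
  also have "\<dots> = (\<Sum>x\<in>V. \<Sum>y\<in>V. \<Sum>z\<in>V. \<Sum>\<phi>\<in>J \<rightarrow>\<^sub>E V. adj G x y * adj G y z * adj G z x)"
  proof -
    have "i \<noteq> j" "j \<noteq> i" "i \<noteq> l" "l \<noteq> i" "j \<noteq> l" "l \<noteq> j" using assms(5) by auto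
    thus ?thesis
      unfolding I(1) sum_PiE_insert[OF I(2)] sum_PiE_insert[OF I(3)] sum_PiE_insert[OF I(4)]
      by (simp only: fun_upd_apply if_True if_False simp_thms)
  qed
  also have "\<dots> = real (hom_count C3_digraph G) * real (card V) ^ card J"
    using I(5) by (simp add: hom_count_C3[OF assms(6)] V_def card_PiE sum_distrib_left sum_distrib_right mult_ac)
  also have "real (hom_count C3_digraph G) = hom_density C3_digraph G * real (card V) ^ 3"
  proof -
    have "card (pverts C3_digraph) = 3" by (simp add: C3_digraph_def)
    moreover have "hom_count C3_digraph G = 0" if "V = {}"
      using hom_count_C3[OF assms(6)] that by (simp add: V_def)
    moreover have "card V \<noteq> 0" if "V \<noteq> {}" using that assms(6) by (simp add: V_def)
    ultimately show ?thesis by (cases "V = {}") (simp_all add: hom_density_def V_def)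
  qed
  also have "\<dots> * real (card V) ^ card J = hom_density C3_digraph G * real (card V) ^ card I"
    using I by (simp add: eval_nat_numeral mult.assoc)
  finally show ?thesis by (simp add: V_def)
qed

text \<open>Union bound: a uniformly random map identifies a given pair with probability 1/N and
  sends a given triple onto a cyclic triangle with probability at most the density of
  \<open>C3_digraph\<close>.\<close>

lemma card_nontransitive_maps_le:
  assumes I: "finite I" and G: "tournament G" and ne: "pverts G \<noteq> {}"
  defines "N \<equiv> real (card (pverts G))"
  shows "real (card ((I \<rightarrow>\<^sub>E pverts G) - transitive_embeddings I G))
    \<le> (real (card I) ^ 2 / N + real (card I) ^ 3 * hom_density C3_digraph G) * N ^ card I"
proof -
  define V A c where "V = pverts G" and "A = (I \<rightarrow>\<^sub>E pverts G)" and "c = hom_density C3_digraph G"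
  note fin = tournament_finite[OF G]
  have N: "N > 0" using fin ne by (simp add: N_def card_gt_0_iff)
  have finA: "finite A" unfolding A_def using I fin by (intro finite_PiE) auto
  have c0: "0 \<le> c" unfolding c_def hom_density_def by simp
  define X where "X p = {\<phi> \<in> A. fst p \<noteq> snd p \<and> \<phi> (fst p) = \<phi> (snd p)}" for p :: "nat \<times> nat"
  define Y where "Y t = (case t of (i, j, l) \<Rightarrow> {\<phi> \<in> A. (\<phi> i, \<phi> j) \<in> parcs G \<and> (\<phi> j, \<phi> l) \<in> parcs G \<and> (\<phi> l, \<phi> i) \<in> parcs G})"
    for t :: "nat \<times> nat \<times> nat"
  have X: "real (card (X p)) \<le> N ^ card I / N" if "p \<in> I \<times> I" for p
  proof (cases "fst p = snd p")
    case False
    have "real (card (X p)) * N = N ^ card I"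
      using card_collision_maps[OF I _ _ False fin] that False by (auto simp: X_def A_def N_def)
    thus ?thesis using N by (simp add: field_simps)
  qed (use N in \<open>simp add: X_def\<close>)
  have anti: "\<not> ((x, y) \<in> parcs G \<and> (y, x) \<in> parcs G)" "(x, x) \<notin> parcs G" for x y
  proof -
    show "(x, x) \<notin> parcs G" using G pair_digraph_finite(4)[of G x] unfolding tournament_def by blast
    show "\<not> ((x, y) \<in> parcs G \<and> (y, x) \<in> parcs G)"
    proof
      assume xy: "(x, y) \<in> parcs G \<and> (y, x) \<in> parcs G"
      hence "x \<in> pverts G" "y \<in> pverts G" "x \<noteq> y"
        using pair_digraph_finite(3,4)[of G] G unfolding tournament_def by auto
      thus False using G xy unfolding tournament_def by blast
    qed
  qed
  have Y: "real (card (Y t)) \<le> c * N ^ card I" if "t \<in> I \<times> I \<times> I" for t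
  proof -
    obtain i j l where t: "t = (i, j, l)" "i \<in> I" "j \<in> I" "l \<in> I" using \<open>t \<in> I \<times> I \<times> I\<close> by auto
    show ?thesis
    proof (cases "distinct [i, j, l]")
      case True
      show ?thesis using card_cyclic_maps[OF I t(2-4) True fin] by (simp add: Y_def t A_def N_def c_def)
    next
      case False
      hence "Y t = {}" using anti unfolding Y_def t by auto
      thus ?thesis using N c0 by simp
    qed
  qed
  have "A - transitive_embeddings I G \<subseteq> (\<Union>p\<in>I \<times> I. X p) \<union> (\<Union>t\<in>I \<times> I \<times> I. Y t)"
  proof
    fix \<phi> assume \<phi>: "\<phi> \<in> A - transitive_embeddings I G"
    then consider i j where "i \<in> I" "j \<in> I" "\<phi> i = \<phi> j" "i \<noteq> j"
      | i j l where "i \<in> I" "j \<in> I" "l \<in> I" "(\<phi> i, \<phi> j) \<in> parcs G" "(\<phi> j, \<phi> l) \<in> parcs G" "(\<phi> l, \<phi> i) \<in> parcs G"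
      unfolding transitive_embeddings_def A_def inj_on_def by blast
    thus "\<phi> \<in> (\<Union>p\<in>I \<times> I. X p) \<union> (\<Union>t\<in>I \<times> I \<times> I. Y t)"
    proof cases
      case 1
      hence "\<phi> \<in> X (i, j)" using \<phi> by (simp add: X_def)
      with 1 show ?thesis by blast
    next
      case 2
      hence "\<phi> \<in> Y (i, j, l)" using \<phi> by (simp add: Y_def)
      with 2 show ?thesis by blast
    qed
  qed
  hence "card (A - transitive_embeddings I G) \<le> card ((\<Union>p\<in>I \<times> I. X p) \<union> (\<Union>t\<in>I \<times> I \<times> I. Y t))"
    using I finA by (intro card_mono) (auto simp: X_def Y_def)
  also have "\<dots> \<le> card (\<Union>p\<in>I \<times> I. X p) + card (\<Union>t\<in>I \<times> I \<times> I. Y t)" by (rule card_Un_le)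
  also have "\<dots> \<le> (\<Sum>p\<in>I \<times> I. card (X p)) + (\<Sum>t\<in>I \<times> I \<times> I. card (Y t))"
    using I by (intro add_mono card_UN_le) auto
  finally have "real (card (A - transitive_embeddings I G))
     \<le> (\<Sum>p\<in>I \<times> I. real (card (X p))) + (\<Sum>t\<in>I \<times> I \<times> I. real (card (Y t)))"
    by (simp flip: of_nat_sum of_nat_add)
  also have "\<dots> \<le> (\<Sum>p\<in>I \<times> I. N ^ card I / N) + (\<Sum>t\<in>I \<times> I \<times> I. c * N ^ card I)"
    by (intro add_mono sum_mono X Y)
  also have "\<dots> = (real (card I) ^ 2 / N + real (card I) ^ 3 * c) * N ^ card I"
    by (simp add: card_cartesian_product algebra_simps power2_eq_square power3_eq_cube)
  finally show ?thesis unfolding A_def c_def .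
qed

text \<open>Among the transitive embeddings exactly the proportion \<open>q\<close> are
  homomorphisms. The other maps form a fraction \<beta> of all maps, and as \<open>q\<close> lies in
  [0,1] they shift the density by at most \<beta>.\<close>

lemma hom_density_near_transitive:
  assumes G: "tournament G" and F: "pair_digraph F" and ne: "pverts G \<noteq> {}"
  defines "k \<equiv> card (pverts F)"
  shows "\<bar>hom_density F G - linear_extensions F / fact k\<bar>
    \<le> real k ^ 2 / card (pverts G) + real k ^ 3 * hom_density C3_digraph G"
proof -
  define I A E where "I = pverts F" and "A = (I \<rightarrow>\<^sub>E pverts G)" and "E = transitive_embeddings I G"
  define N where "N = real (card (pverts G))"
  define hom where "hom \<phi> \<longleftrightarrow> (\<forall>(i, j)\<in>parcs F. (\<phi> i, \<phi> j) \<in> parcs G)" for \<phi>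
  define \<beta> where "\<beta> = real (card (A - E)) / N ^ k"
  note finV = tournament_finite[OF G]
  have N: "N > 0" using finV ne by (simp add: N_def card_gt_0_iff)
  have fin: "finite I" using pair_digraph_finite[OF F] by (simp add: I_def)
  have finA: "finite A" unfolding A_def using fin finV by (intro finite_PiE) auto
  have EA: "E \<subseteq> A" by (auto simp: E_def A_def transitive_embeddings_def)
  have cA: "real (card A) = N ^ k" using fin by (simp add: A_def card_PiE N_def k_def I_def)
  have cE: "real (card E) = N ^ k - real (card (A - E))"
    using card_Diff_subset[OF finite_subset[OF EA finA] EA] card_mono[OF finA EA]
    by (simp add: cA[symmetric] of_nat_diff)
  define b where "b = real (card {\<phi> \<in> A - E. hom \<phi>}) / N ^ k"
  define q where "q = real (linear_extensions F) / fact k"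
  have b: "0 \<le> b" "b \<le> \<beta>"
    unfolding b_def \<beta>_def using N finA by (auto intro!: divide_right_mono card_mono)
  have q: "0 \<le> q" "q \<le> 1"
  proof -
    have "linear_extensions F \<le> card {\<pi>. \<pi> permutes I}" unfolding linear_extensions_def I_def
      using fin by (intro card_mono finite_permutations) (auto simp: I_def)
    also have "\<dots> = fact k" using card_permutations[OF refl fin] by (simp add: k_def I_def)
    finally have "real (linear_extensions F) \<le> fact k" by (metis of_nat_fact of_nat_le_iff)
    thus "q \<le> 1" by (simp add: q_def)
  qed (simp add: q_def)
  have "{\<phi> \<in> A. hom \<phi>} = {\<phi> \<in> E. hom \<phi>} \<union> {\<phi> \<in> A - E. hom \<phi>}" using EA by auto
  moreover have "card ({\<phi> \<in> E. hom \<phi>} \<union> {\<phi> \<in> A - E. hom \<phi>}) = card {\<phi> \<in> E. hom \<phi>} + card {\<phi> \<in> A - E. hom \<phi>}"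
    using finA finite_subset[OF EA finA] by (intro card_Un_disjoint) auto
  moreover have "hom_count F G = card {\<phi> \<in> A. hom \<phi>}"
    by (simp only: hom_count_def hom_def A_def I_def)
  ultimately have count: "real (hom_count F G) = real (card {\<phi> \<in> E. hom \<phi>}) + real (card {\<phi> \<in> A - E. hom \<phi>})"
    by (simp only: of_nat_add)
  have "fact k * card {\<phi> \<in> E. hom \<phi>} = linear_extensions F * card E"
    unfolding E_def I_def hom_def k_def by (rule card_transitive_homs[OF G F])
  hence "real (fact k) * real (card {\<phi> \<in> E. hom \<phi>}) = real (linear_extensions F) * real (card E)"
    by (simp only: of_nat_mult[symmetric] of_nat_eq_iff)
  hence "real (card {\<phi> \<in> E. hom \<phi>}) = q * real (card E)"
    unfolding q_def by (simp only: of_nat_fact) (simp add: nonzero_eq_divide_eq mult.commute)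
  hence "real (hom_count F G) = q * (N ^ k - real (card (A - E))) + real (card {\<phi> \<in> A - E. hom \<phi>})"
    unfolding count cE by (rule arg_cong)
  hence "hom_density F G = (q * (N ^ k - real (card (A - E))) + real (card {\<phi> \<in> A - E. hom \<phi>})) / N ^ k"
    unfolding hom_density_def N_def k_def by (rule arg_cong)
  also have "\<dots> = q * (1 - \<beta>) + b"
  proof -
    have "N ^ k \<noteq> 0" using N by simp
    thus ?thesis unfolding \<beta>_def b_def by (simp add: add_divide_distrib diff_divide_distrib right_diff_distrib)
  qed
  finally have "hom_density F G - q = b - q * \<beta>" by (simp add: algebra_simps)
  moreover have "0 \<le> q * \<beta>" "q * \<beta> \<le> 1 * \<beta>"
    using q b by (intro mult_nonneg_nonneg mult_right_mono; simp)+
  ultimately have "\<bar>hom_density F G - q\<bar> \<le> \<beta>" using b by simp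
  also have "\<beta> \<le> real k ^ 2 / N + real k ^ 3 * hom_density C3_digraph G"
  proof -
    have "\<beta> \<le> (real k ^ 2 / N + real k ^ 3 * hom_density C3_digraph G) * N ^ k / N ^ k"
      unfolding \<beta>_def using N card_nontransitive_maps_le[OF fin G ne]
      by (intro divide_right_mono) (simp_all add: A_def E_def N_def k_def I_def)
    thus ?thesis using N by simp
  qed
  finally show ?thesis by (simp add: q_def N_def)
qed

section \<open>The degree distribution\<close>

lemma integrable_AE_bounded:
  fixes f :: "'a \<Rightarrow> real"
  assumes "prob_space M" "f \<in> borel_measurable M" "AE x in M. \<bar>f x\<bar> \<le> B"
  shows "integrable M f"
proof -
  interpret prob_space M by fact
  show ?thesis using assms(2,3) by (intro integrable_const_bound[of f B]) auto
qed

text \<open>The absolute moments are at most 1, so the Taylor polynomials \<open>S n\<close> of the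
  characteristic function, whose coefficients are moments, have remainder at most 2 |t|^n / n!.
  Since the moments agree, the same polynomials converge to both characteristic functions.\<close>

lemma moments_determine_distribution:
  assumes "real_distribution M1" "real_distribution M2"
    and "AE x in M1. x \<in> {0..1}" "AE x in M2. x \<in> {0..1}"
    and "\<And>k::nat. (\<integral>x. x ^ k \<partial>M1) = (\<integral>x. x ^ k \<partial>M2)"
  shows "M1 = M2"
proof (rule Levy_uniqueness[OF assms(1,2)], rule ext)
  fix t :: real
  define S where "S n = (\<Sum>k\<le>n. complex_of_real (\<integral>x. x ^ k \<partial>M1) * ((\<i> * t) ^ k / fact k))" for n
  have approx: "cmod (char M t - S n) \<le> 2 * (\<bar>t\<bar> ^ n / fact n)"
    if M: "real_distribution M" "AE x in M. x \<in> {0..1}" "\<And>k::nat. (\<integral>x. x ^ k \<partial>M) = (\<integral>x. x ^ k \<partial>M1)" for M n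
  proof -
    interpret M: real_distribution M by fact
    have int: "integrable M (\<lambda>x. x ^ k)" for k :: nat
    proof (rule integrable_AE_bounded[of _ _ 1])
      show "AE x in M. \<bar>x ^ k\<bar> \<le> 1"
        using that(2) by (rule AE_mp) (auto simp: power_abs power_le_one)
    qed (auto intro: M.prob_space_axioms)
    have "(\<integral>x. \<bar>x\<bar> ^ n \<partial>M) \<le> (\<integral>x. 1 \<partial>M)"
    proof (rule integral_mono_AE)
      show "integrable M (\<lambda>x. \<bar>x\<bar> ^ n)" using integrable_abs[OF int[of n]] by (simp add: power_abs)
      show "AE x in M. \<bar>x\<bar> ^ n \<le> 1" using that(2) by (rule AE_mp) (auto simp: power_le_one)
    qed simp
    hence "2 * \<bar>t\<bar> ^ n / fact n * (\<integral>x. \<bar>x\<bar> ^ n \<partial>M) \<le> 2 * \<bar>t\<bar> ^ n / fact n * 1"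
      by (intro mult_left_mono) (auto simp: M.prob_space[unfolded M.space_eq_univ])
    moreover have "cmod (char M t - S n) \<le> 2 * \<bar>t\<bar> ^ n / fact n * (\<integral>x. \<bar>x\<bar> ^ n \<partial>M)"
      using M.char_approx1[of n t, OF int] by (simp add: S_def M(3) mult.commute)
    ultimately show ?thesis by simp
  qed
  have "(\<lambda>n. 2 * (\<bar>t\<bar> ^ n / fact n)) \<longlonglongrightarrow> 2 * 0"
    using summable_LIMSEQ_zero[OF summable_exp[of "\<bar>t\<bar>"]]
    by (intro tendsto_mult_left) (simp add: divide_inverse mult.commute)
  hence zero: "(\<lambda>n. 2 * (\<bar>t\<bar> ^ n / fact n)) \<longlonglongrightarrow> 0" by simp
  have S: "S \<longlonglongrightarrow> char M t"
    if M: "real_distribution M" "AE x in M. x \<in> {0..1}" "\<And>k::nat. (\<integral>x. x ^ k \<partial>M) = (\<integral>x. x ^ k \<partial>M1)" for M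
  proof (rule LIM_zero_cancel, rule Lim_null_comparison[OF _ zero], rule always_eventually, rule allI)
    show "norm (S n - char M t) \<le> 2 * (\<bar>t\<bar> ^ n / fact n)" for n
      using approx[OF M, of n] by (simp only: norm_minus_commute)
  qed
  show "char M1 t = char M2 t"
    by (rule LIMSEQ_unique[OF S[OF assms(1,3) refl] S[OF assms(2,4) assms(5)[symmetric]]])
qed

text \<open>Tightness gives a weakly convergent subsequence, which handles bounded continuous
  integrands. The retraction \<open>c\<close> of the line onto [0,1] extends this to all continuous
  \<open>g\<close>, since g and \<open>g (c x)\<close> agree almost everywhere for all measures
  involved.\<close>

lemma unit_distributions_subsequence:
  fixes \<mu> :: "nat \<Rightarrow> real measure"
  assumes \<mu>: "\<And>n. real_distribution (\<mu> n)" "\<And>n. AE x in \<mu> n. x \<in> {0..1::real}"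
  shows "\<exists>r M. strict_mono r \<and> real_distribution M \<and> (AE x in M. x \<in> {0..1}) \<and>
    (\<forall>g :: real \<Rightarrow> real. continuous_on UNIV g \<longrightarrow> (\<lambda>n. \<integral>x. g x \<partial>\<mu> (r n)) \<longlonglongrightarrow> (\<integral>x. g x \<partial>M))"
proof -
  \<comment> \<open>Tightness is formulated with half-open intervals, so the left end has to lie
    strictly below 0.\<close>
  have \<mu>1: "measure (\<mu> n) {-1<..1} = 1" for n
  proof -
    interpret real_distribution "\<mu> n" by fact
    have "AE x in \<mu> n. x \<in> {-1<..1}" using \<mu>(2)[of n] by (rule AE_mp) auto
    thus ?thesis by (subst AE_in_set_eq_1[symmetric]) auto
  qed
  have "tight \<mu>" unfolding tight_def
    using \<mu>1 by (intro conjI allI impI \<mu>(1) exI[of _ "-1"] exI[of _ 1]) auto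
  then obtain r M where r: "strict_mono r" and M: "real_distribution M" and w: "weak_conv_m (\<mu> \<circ> r) M"
    using tight_imp_convergent_subsubsequence[of \<mu> id] by (auto simp: strict_mono_def)
  interpret M: real_distribution M by fact
  define c where "c x = max 0 (min 1 x)" for x :: real
  have c_id: "c x = x" if "x \<in> {0..1}" for x using that by (auto simp: c_def)
  have c_cont: "continuous_on UNIV c" unfolding c_def by (intro continuous_intros)
  have conv: "(\<lambda>n. \<integral>x. f x \<partial>\<mu> (r n)) \<longlonglongrightarrow> (\<integral>x. f x \<partial>M)"
    if "continuous_on UNIV f" "\<And>x. \<bar>f x\<bar> \<le> B" for f :: "real \<Rightarrow> real" and B
    using weak_conv_imp_integral_bdd_continuous_conv[OF _ M w, of f B] \<mu>(1) that
    by (auto simp: continuous_on_eq_continuous_at)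
  have "AE x in M. x \<in> {0..1}"
  proof -
    \<comment> \<open>The truncated distance to [0,1] is bounded and continuous, and has integral 0
      along the sequence, hence also in the limit.\<close>
    define d where "d x = min 1 \<bar>x - c x\<bar>" for x
    have d: "continuous_on UNIV d" "\<And>x. \<bar>d x\<bar> \<le> 1"
      unfolding d_def using c_cont by (auto intro!: continuous_intros)
    have [measurable]: "d \<in> borel_measurable borel" using d(1) by (rule borel_measurable_continuous_onI)
    have "(\<integral>x. d x \<partial>\<mu> (r n)) = 0" for n
    proof -
      interpret real_distribution "\<mu> (r n)" by fact
      have "AE x in \<mu> (r n). d x = 0" using \<mu>(2)[of "r n"] by (rule AE_mp) (auto simp: d_def c_def)
      thus ?thesis by (subst integral_cong_AE[of _ _ "\<lambda>_. 0"]) auto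
    qed
    hence "(\<integral>x. d x \<partial>M) = 0" using conv[OF d] by (simp add: LIMSEQ_const_iff)
    moreover have "integrable M d"
      using d(2) by (intro integrable_AE_bounded[of _ _ 1] M.prob_space_axioms) auto
    moreover have "AE x in M. 0 \<le> d x" by (simp add: d_def)
    ultimately have "AE x in M. d x = 0" using integral_nonneg_eq_0_iff_AE by blast
    thus ?thesis by (rule AE_mp) (auto simp: d_def c_def min_def max_def split: if_splits)
  qed
  moreover have "(\<lambda>n. \<integral>x. g x \<partial>\<mu> (r n)) \<longlonglongrightarrow> (\<integral>x. g x \<partial>M)"
    if g: "continuous_on UNIV g" for g :: "real \<Rightarrow> real"
  proof -
    have gc: "continuous_on UNIV (\<lambda>x. g (c x))"
      using continuous_on_compose2[OF g c_cont] by simp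
    have [measurable]: "g \<in> borel_measurable borel" "(\<lambda>x. g (c x)) \<in> borel_measurable borel"
      using g gc by (auto intro: borel_measurable_continuous_onI)
    have "bounded (g ` {0..1})"
      using g by (intro compact_imp_bounded compact_continuous_image) (auto intro: continuous_on_subset)
    then obtain B where "\<forall>x\<in>{0..1}. \<bar>g x\<bar> \<le> B" by (auto simp: bounded_iff simp del: atLeastAtMost_iff)
    hence B: "\<bar>g x\<bar> \<le> B" if "x \<in> {0..1}" for x using that by blast
    have "\<bar>g (c x)\<bar> \<le> B" for x by (rule B) (auto simp: c_def)
    hence lim: "(\<lambda>n. \<integral>x. g (c x) \<partial>\<mu> (r n)) \<longlonglongrightarrow> (\<integral>x. g (c x) \<partial>M)" by (intro conv gc)
    have eq: "(\<integral>x. g (c x) \<partial>N) = (\<integral>x. g x \<partial>N)" if "real_distribution N" "AE x in N. x \<in> {0..1}" for N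
    proof -
      interpret N: real_distribution N by fact
      have "AE x in N. g (c x) = g x" using that(2) by (rule AE_mp) (auto simp: c_id)
      thus ?thesis by (intro integral_cong_AE) auto
    qed
    show ?thesis using lim eq[OF M \<open>AE x in M. x \<in> {0..1}\<close>] eq[OF \<mu>] by simp
  qed
  ultimately show ?thesis using r M by blast
qed

definition score_distribution :: "'a pair_pre_digraph \<Rightarrow> real measure" where
  "score_distribution G =
     distr (measure_pmf (pmf_of_set (pverts G))) borel (\<lambda>x. outscore G x / card (pverts G))"

lemma score_distribution:
  assumes G: "tournament G" "pverts G \<noteq> {}"
  shows "real_distribution (score_distribution G)" "AE x in score_distribution G. x \<in> {0..1}"
    and "f \<in> borel_measurable borel \<Longrightarrow> (\<integral>x. f x \<partial>score_distribution G)
      = (\<Sum>x\<in>pverts G. f (outscore G x / card (pverts G))) / card (pverts G)"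
proof -
  note fin = tournament_finite[OF G(1)]
  have N: "real (card (pverts G)) > 0" using fin G(2) by (simp add: card_gt_0_iff)
  show "real_distribution (score_distribution G)"
    unfolding score_distribution_def by (rule prob_space.real_distribution_distr[OF measure_pmf.prob_space_axioms]) simp
  have "outscore G x / card (pverts G) \<in> {0..1}" if "x \<in> pverts G" for x
    using outscore_bounds[OF G(1) that] N by simp
  thus "AE x in score_distribution G. x \<in> {0..1}"
    unfolding score_distribution_def
    using fin G(2) by (subst AE_distr_iff) (auto simp: AE_measure_pmf_iff set_pmf_of_set)
  assume "f \<in> borel_measurable borel"
  thus "(\<integral>x. f x \<partial>score_distribution G)
      = (\<Sum>x\<in>pverts G. f (outscore G x / card (pverts G))) / card (pverts G)"
    unfolding score_distribution_def using fin G(2)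
    by (simp add: integral_distr integral_pmf_of_set)
qed

text \<open>Inscore and outscore add up to N - 1, so the normalised inscore is 1 - y up to 1/N, and
  the error is paid once for each of the \<open>m\<close> factors. Hence one real variable carries
  the whole degree distribution.\<close>

lemma hom_density_S_score_moment:
  assumes G: "tournament G" "pverts G \<noteq> {}"
  shows "\<bar>hom_density (S_digraph m n) G - (\<integral>y. (1 - y) ^ m * y ^ n \<partial>score_distribution G)\<bar> \<le> m / card (pverts G)"
proof -
  define N where "N = real (card (pverts G))"
  have N: "N > 0" using tournament_finite[OF G(1)] G(2) by (simp add: N_def card_gt_0_iff)
  have "\<bar>hom_density (S_digraph m n) G - (\<integral>y. (1 - y) ^ m * y ^ n \<partial>score_distribution G)\<bar>
    = \<bar>\<Sum>x\<in>pverts G. (inscore G x / N) ^ m * (outscore G x / N) ^ n - (1 - outscore G x / N) ^ m * (outscore G x / N) ^ n\<bar> / N"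
    using N unfolding hom_density_S[OF G(1)]
    by (subst score_distribution(3)[OF G]) (simp_all add: N_def[symmetric] diff_divide_distrib[symmetric] sum_subtractf)
  also have "\<dots> \<le> (\<Sum>x\<in>pverts G. \<bar>(inscore G x / N) ^ m * (outscore G x / N) ^ n - (1 - outscore G x / N) ^ m * (outscore G x / N) ^ n\<bar>) / N"
    using N by (intro divide_right_mono sum_abs) auto
  also have "\<dots> \<le> (\<Sum>x\<in>pverts G. m * (1 / N)) / N"
  proof (intro divide_right_mono sum_mono)
    fix x assume x: "x \<in> pverts G"
    note b = outscore_bounds[OF G(1) x, folded N_def]
    note i = inscore_tournament[OF G(1) x, folded N_def]
    have "\<bar>(inscore G x / N) ^ m * (outscore G x / N) ^ n - (1 - outscore G x / N) ^ m * (outscore G x / N) ^ n\<bar>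
      \<le> m * \<bar>inscore G x / N - (1 - outscore G x / N)\<bar> + n * \<bar>outscore G x / N - outscore G x / N\<bar>"
      using N b unfolding i by (intro abs_moment_diff_le) auto
    also have "inscore G x / N - (1 - outscore G x / N) = - (1 / N)"
      using N unfolding i by (simp add: field_simps)
    finally show "\<bar>(inscore G x / N) ^ m * (outscore G x / N) ^ n - (1 - outscore G x / N) ^ m * (outscore G x / N) ^ n\<bar>
      \<le> m * (1 / N)" using N by simp
  qed (use N in auto)
  also have "\<dots> = m / N" using N by (simp add: N_def)
  finally show ?thesis by (simp add: N_def)
qed

lemma tournament_limit_sequence:
  assumes "tournament_limit \<Gamma>"
  shows "\<exists>G :: nat \<Rightarrow> nat pair_pre_digraph. (\<forall>n. tournament (G n)) \<and> (\<forall>n. pverts (G n) \<noteq> {}) \<and>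
    filterlim (\<lambda>n. card (pverts (G n))) at_top sequentially \<and>
    (\<forall>F. pair_digraph F \<longrightarrow> (\<lambda>n. hom_density F (G n)) \<longlonglongrightarrow> \<Gamma> F) \<and>
    (\<forall>F. \<not> pair_digraph F \<longrightarrow> \<Gamma> F = undefined)"
proof -
  obtain H where H: "convergent_tournaments H" "\<Gamma> = (\<lambda>F\<in>{F. pair_digraph F}. lim (\<lambda>n. hom_density F (H n)))"
    using assms unfolding tournament_limit_def by blast
  have lim: "filterlim (\<lambda>n. card (pverts (H n))) at_top sequentially"
    using H(1) by (simp add: convergent_tournaments_def)
  \<comment> \<open>Finitely many tournaments are dropped in order that all vertex sets are
    nonempty.\<close>
  obtain k where k: "\<And>n. n \<ge> k \<Longrightarrow> card (pverts (H n)) \<ge> 1"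
    using filterlim_at_top[THEN iffD1, OF lim] by (auto simp: eventually_sequentially)
  define G where "G n = H (n + k)" for n
  show ?thesis
  proof (intro exI[of _ G] conjI allI impI)
    show "tournament (G n)" for n using H(1) by (simp add: convergent_tournaments_def G_def)
    show "filterlim (\<lambda>n. card (pverts (G n))) at_top sequentially"
      unfolding G_def using filterlim_compose[OF lim filterlim_add_const_nat_at_top] .
    show "pverts (G n) \<noteq> {}" for n using k[of "n + k"] by (auto simp: G_def)
    show "\<Gamma> F = undefined" if "\<not> pair_digraph F" for F using that by (simp add: H(2))
    fix F :: "nat pair_pre_digraph" assume F: "pair_digraph F"
    hence "(\<lambda>n. hom_density F (H n)) \<longlonglongrightarrow> \<Gamma> F"
      using H by (simp add: convergent_tournaments_def convergent_LIMSEQ_iff)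
    thus "(\<lambda>n. hom_density F (G n)) \<longlonglongrightarrow> \<Gamma> F" unfolding G_def by (rule LIMSEQ_ignore_initial_segment)
  qed
qed

lemma inverse_card_tendsto_0:
  assumes "filterlim (\<lambda>n. card (A n)) at_top sequentially"
  shows "(\<lambda>n. c / real (card (A n))) \<longlonglongrightarrow> 0"
  by (rule tendsto_divide_0[OF tendsto_const])
     (rule filterlim_at_top_imp_at_infinity[OF filterlim_compose[OF filterlim_real_sequentially assms]])

lemma limit_score_distribution:
  assumes "tournament_limit \<Gamma>"
  shows "\<exists>M. real_distribution M \<and> (AE y in M. y \<in> {0..1}) \<and>
    (\<forall>m n. \<Gamma> (S_digraph m n) = (\<integral>y. (1 - y) ^ m * y ^ n \<partial>M))"
proof -
  obtain G :: "nat \<Rightarrow> nat pair_pre_digraph" where G: "\<And>n. tournament (G n)" "filterlim (\<lambda>n. card (pverts (G n))) at_top sequentially"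
    "\<And>n. pverts (G n) \<noteq> {}" and \<Gamma>: "\<And>F. pair_digraph F \<Longrightarrow> (\<lambda>n. hom_density F (G n)) \<longlonglongrightarrow> \<Gamma> F"
    using tournament_limit_sequence[OF assms] by blast
  obtain r M where r: "strict_mono r" and M: "real_distribution M" "AE y in M. y \<in> {0..1}" and
    lim: "\<And>g :: real \<Rightarrow> real. continuous_on UNIV g \<Longrightarrow>
      (\<lambda>n. \<integral>x. g x \<partial>score_distribution (G (r n))) \<longlonglongrightarrow> (\<integral>x. g x \<partial>M)"
    using unit_distributions_subsequence[of "\<lambda>n. score_distribution (G n)",
      OF score_distribution(1)[OF G(1,3)] score_distribution(2)[OF G(1,3)]] by blast
  have "\<Gamma> (S_digraph m n) = (\<integral>y. (1 - y) ^ m * y ^ n \<partial>M)" for m n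
  proof -
    have 1: "(\<lambda>i. hom_density (S_digraph m n) (G (r i))) \<longlonglongrightarrow> \<Gamma> (S_digraph m n)"
      using LIMSEQ_subseq_LIMSEQ[OF \<Gamma>[OF pair_digraph_S_digraph] r] by (simp add: comp_def)
    have 2: "(\<lambda>i. \<integral>y. (1 - y) ^ m * y ^ n \<partial>score_distribution (G (r i))) \<longlonglongrightarrow> (\<integral>y. (1 - y) ^ m * y ^ n \<partial>M)"
      by (intro lim continuous_intros)
    have "(\<lambda>i. real m / real (card (pverts (G (r i))))) \<longlonglongrightarrow> 0"
      using LIMSEQ_subseq_LIMSEQ[OF inverse_card_tendsto_0[OF G(2)] r] by (simp add: comp_def)
    hence "(\<lambda>i. hom_density (S_digraph m n) (G (r i)) - (\<integral>y. (1 - y) ^ m * y ^ n \<partial>score_distribution (G (r i)))) \<longlonglongrightarrow> 0"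
      by (rule Lim_null_comparison[rotated]) (simp add: hom_density_S_score_moment G)
    from LIMSEQ_unique[OF this tendsto_diff[OF 1 2]] show ?thesis by simp
  qed
  with M show ?thesis by blast
qed

text \<open>The mixed moments give x + y - 1 second moment 0, so \<nu> is concentrated on the line x
  + y = 1 and is determined by its second marginal. The moments with m = 0 identify that marginal as
  \<open>M\<close>.\<close>

lemma degree_distribution_unique:
  fixes M :: "real measure" and \<nu> :: "(real \<times> real) measure"
  assumes M: "real_distribution M" "AE y in M. y \<in> {0..1}"
    and \<nu>: "prob_space \<nu>" "sets \<nu> = sets borel" "measure \<nu> ({0..1} \<times> {0..1}) = 1"
    and mom: "\<And>m n. (\<integral>(x, y). x ^ m * y ^ n \<partial>\<nu>) = (\<integral>y. (1 - y) ^ m * y ^ n \<partial>M)"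
  shows "\<nu> = distr M borel (\<lambda>y. (1 - y, y))"
proof -
  interpret M: real_distribution M by fact
  interpret \<nu>: prob_space \<nu> by fact
  note [measurable_cong] = \<nu>(2)
  have [measurable]: "fst \<in> borel_measurable (borel :: (real \<times> real) measure)"
    "snd \<in> borel_measurable (borel :: (real \<times> real) measure)"
    by (auto intro!: borel_measurable_continuous_onI continuous_intros)
  have sq: "AE p in \<nu>. p \<in> {0..1} \<times> {0..1}"
    using \<nu>(3) by (subst \<nu>.AE_in_set_eq_1) (auto simp: \<nu>(2) intro!: borel_closed closed_Times)
  have int: "integrable \<nu> (\<lambda>p. fst p ^ m * snd p ^ n)" for m n :: nat
  proof (rule integrable_AE_bounded[OF \<nu>(1), of _ 1])
    show "AE p in \<nu>. \<bar>fst p ^ m * snd p ^ n\<bar> \<le> 1"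
      using sq by (rule AE_mp) (auto simp: abs_mult power_abs[symmetric] intro!: mult_le_one power_le_one)
  qed simp
  have intM: "integrable M (\<lambda>y. (1 - y) ^ m * y ^ n)" for m n :: nat
  proof (rule integrable_AE_bounded[OF M.prob_space_axioms, of _ 1])
    show "AE y in M. \<bar>(1 - y) ^ m * y ^ n\<bar> \<le> 1"
      using M(2) by (rule AE_mp) (auto simp: abs_mult power_abs[symmetric] intro!: mult_le_one power_le_one)
  qed simp
  have mom': "(\<integral>p. fst p ^ m * snd p ^ n \<partial>\<nu>) = (\<integral>y. (1 - y) ^ m * y ^ n \<partial>M)" for m n
    using mom[of m n] by (simp add: case_prod_beta')
  \<comment> \<open>Zeroth and first powers are kept so that every term is literally a moment to
    which \<open>int\<close> and \<open>mom'\<close> apply.\<close>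
  have expand: "(x + y - 1)\<^sup>2 = x ^ 2 * y ^ 0 + 2 * (x ^ 1 * y ^ 1) + x ^ 0 * y ^ 2 - 2 * (x ^ 1 * y ^ 0)
      - 2 * (x ^ 0 * y ^ 1) + x ^ 0 * y ^ 0" for x y :: real
    by (simp add: power2_eq_square algebra_simps)
  have "(\<integral>p. (fst p + snd p - 1)\<^sup>2 \<partial>\<nu>) = (\<integral>y. ((1 - y) + y - 1)\<^sup>2 \<partial>M)"
    unfolding expand
    by (simp only: int intM mom' Bochner_Integration.integral_add Bochner_Integration.integral_diff
        Bochner_Integration.integrable_add Bochner_Integration.integrable_diff
        Bochner_Integration.integral_mult_right_zero Bochner_Integration.integrable_mult_right)
  hence zero: "(\<integral>p. (fst p + snd p - 1)\<^sup>2 \<partial>\<nu>) = 0" by simp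
  have "integrable \<nu> (\<lambda>p. (fst p + snd p - 1)\<^sup>2)"
    unfolding expand
    by (intro Bochner_Integration.integrable_add Bochner_Integration.integrable_diff
        Bochner_Integration.integrable_mult_right int)
  with zero have "AE p in \<nu>. (fst p + snd p - 1)\<^sup>2 = 0"
    by (subst integral_nonneg_eq_0_iff_AE[symmetric]) auto
  hence diag: "AE p in \<nu>. p = (1 - snd p, snd p)"
    by (rule AE_mp) (auto simp: prod_eq_iff)
  have "distr \<nu> borel snd = M"
  proof (rule moments_determine_distribution[OF _ M(1) _ M(2)])
    show "real_distribution (distr \<nu> borel snd)" by (rule \<nu>.real_distribution_distr) simp
    show "AE x in distr \<nu> borel snd. x \<in> {0..1}"
    proof (subst AE_distr_iff)
      show "AE p in \<nu>. snd p \<in> {0..1}" using sq by (rule AE_mp) auto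
    qed auto
    show "(\<integral>x. x ^ k \<partial>distr \<nu> borel snd) = (\<integral>x. x ^ k \<partial>M)" for k :: nat
      using mom'[of 0 k] by (simp add: integral_distr)
  qed
  moreover have pair: "(\<lambda>y. (1 - y, y)) \<in> borel \<rightarrow>\<^sub>M (borel :: (real \<times> real) measure)"
    by (intro borel_measurable_continuous_onI continuous_intros)
  moreover have "\<nu> = distr \<nu> borel (\<lambda>p. (1 - snd p, snd p))"
  proof -
    have "distr \<nu> borel (\<lambda>p. p) = distr \<nu> borel (\<lambda>p. (1 - snd p, snd p))"
      using diag by (intro distr_cong_AE) (auto intro!: borel_measurable_Pair)
    thus ?thesis using distr_id2[OF \<nu>(2)[symmetric]] by simp
  qed
  moreover have "distr \<nu> borel (\<lambda>p. (1 - snd p, snd p)) = distr (distr \<nu> borel snd) borel (\<lambda>y. (1 - y, y))"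
    using pair by (subst distr_distr) (auto simp: comp_def)
  ultimately show ?thesis by simp
qed

text \<open>Discharges the definite description in \<open>degree_distribution\<close>: the image of
  the limiting score distribution under y -> (1 - y, y) has the required properties and is the only
  such measure. Later arguments need nothing else about degree distributions of limits.\<close>

lemma outdegree_distribution_limit:
  assumes "tournament_limit \<Gamma>"
  shows "real_distribution (outdegree_distribution \<Gamma>)"
    and "AE y in outdegree_distribution \<Gamma>. y \<in> {0..1}"
    and "\<Gamma> (S_digraph m n) = (\<integral>y. (1 - y) ^ m * y ^ n \<partial>outdegree_distribution \<Gamma>)"
proof -
  obtain M where M: "real_distribution M" "AE y in M. y \<in> {0..1}"
    and mom: "\<And>m n. \<Gamma> (S_digraph m n) = (\<integral>y. (1 - y) ^ m * y ^ n \<partial>M)"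
    using limit_score_distribution[OF assms] by blast
  interpret M: real_distribution M by fact
  define \<nu> where "\<nu> = distr M borel (\<lambda>y. (1 - y, y))"
  have pair [measurable]: "(\<lambda>y. (1 - y, y)) \<in> borel \<rightarrow>\<^sub>M (borel :: (real \<times> real) measure)"
    by (intro borel_measurable_continuous_onI continuous_intros)
  have [measurable]: "fst \<in> borel_measurable (borel :: (real \<times> real) measure)"
    "snd \<in> borel_measurable (borel :: (real \<times> real) measure)"
    by (auto intro!: borel_measurable_continuous_onI continuous_intros)
  have p: "prob_space \<nu>" unfolding \<nu>_def by (rule M.prob_space_distr) simp
  interpret \<nu>: prob_space \<nu> by fact
  have "degree_distribution \<Gamma> = \<nu>"
    unfolding degree_distribution_def
  proof (rule the_equality)
    have square: "{0..1} \<times> {0..1} \<in> sets (borel :: (real \<times> real) measure)"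
      by (intro borel_closed closed_Times closed_atLeastAtMost)
    have "AE p in \<nu>. p \<in> {0..1} \<times> {0..1}"
      unfolding \<nu>_def
    proof (subst AE_distr_iff)
      show "AE y in M. (1 - y, y) \<in> {0..1} \<times> {0..1}" using M(2) by (rule AE_mp) auto
      show "{p \<in> space borel. p \<in> {0..1} \<times> {0..1}} \<in> sets (borel :: (real \<times> real) measure)"
        using square by simp
    qed simp
    hence "measure \<nu> ({0..1} \<times> {0..1}) = 1"
      by (subst \<nu>.AE_in_set_eq_1[symmetric]) (use square in \<open>simp_all add: \<nu>_def\<close>)
    moreover have "(\<integral>(x, y). x ^ m * y ^ n \<partial>\<nu>) = \<Gamma> (S_digraph m n)" for m n
      unfolding \<nu>_def mom by (subst integral_distr) (auto simp: case_prod_beta')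
    ultimately show "prob_space \<nu> \<and> sets \<nu> = sets borel \<and> measure \<nu> ({0..1} \<times> {0..1}) = 1 \<and>
      (\<forall>m n. (\<integral>(x, y). x ^ m * y ^ n \<partial>\<nu>) = \<Gamma> (S_digraph m n))"
      using p by (simp add: \<nu>_def)
  next
    fix \<nu>' :: "(real \<times> real) measure"
    assume "prob_space \<nu>' \<and> sets \<nu>' = sets borel \<and> measure \<nu>' ({0..1} \<times> {0..1}) = 1 \<and>
      (\<forall>m n. (\<integral>(x, y). x ^ m * y ^ n \<partial>\<nu>') = \<Gamma> (S_digraph m n))"
    thus "\<nu>' = \<nu>" unfolding \<nu>_def using mom by (intro degree_distribution_unique[OF M]) auto
  qed
  hence "outdegree_distribution \<Gamma> = distr M borel (\<lambda>y. y)"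
    unfolding outdegree_distribution_def \<nu>_def by (simp add: distr_distr comp_def)
  also have "\<dots> = M" by (rule distr_id2) simp
  finally have "outdegree_distribution \<Gamma> = M" .
  thus "real_distribution (outdegree_distribution \<Gamma>)"
    "AE y in outdegree_distribution \<Gamma>. y \<in> {0..1}"
    "\<Gamma> (S_digraph m n) = (\<integral>y. (1 - y) ^ m * y ^ n \<partial>outdegree_distribution \<Gamma>)"
    using M mom by (simp_all only:)
qed

lemma uniform_unit_distribution:
  defines "U \<equiv> uniform_measure lborel {0..1::real}"
  shows "real_distribution U" "AE y in U. y \<in> {0..1}" "(\<integral>y. y ^ k \<partial>U) = 1 / (real k + 1)"
proof -
  have "prob_space U" unfolding U_def by (rule prob_space_uniform_measure) auto
  thus "real_distribution U"
    by (simp add: real_distribution_def real_distribution_axioms_def U_def)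
  show "AE y in U. y \<in> {0..1}" unfolding U_def by (rule AE_uniform_measureI) auto
  have "U = density lborel (\<lambda>x. ennreal (indicator {0..1} x))"
    unfolding U_def uniform_measure_def by (intro density_cong) (auto simp: indicator_def)
  hence "(\<integral>y. y ^ k \<partial>U) = (\<integral>y. indicator {0..1} y *\<^sub>R y ^ k \<partial>lborel)"
    by (simp add: integral_density)
  also have "\<dots> = (1 ^ Suc k - 0 ^ Suc k) / Suc k"
    using integral_power[of 0 1 k] by (simp add: mult.commute)
  finally show "(\<integral>y. y ^ k \<partial>U) = 1 / (real k + 1)" by simp
qed

section \<open>Characterisations of the transitive limit\<close>

lemma path_C3_limit:
  assumes "tournament_limit \<Gamma>"
  shows "\<Gamma> (S_digraph 1 1) = 1 / 6 + 2 / 3 * \<Gamma> C3_digraph"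
proof -
  obtain G :: "nat \<Rightarrow> nat pair_pre_digraph" where G: "\<And>n. tournament (G n)" "filterlim (\<lambda>n. card (pverts (G n))) at_top sequentially"
    "\<And>n. pverts (G n) \<noteq> {}" and \<Gamma>: "\<And>F. pair_digraph F \<Longrightarrow> (\<lambda>n. hom_density F (G n)) \<longlonglongrightarrow> \<Gamma> F"
    using tournament_limit_sequence[OF assms] by blast
  have "(\<lambda>n. hom_density (S_digraph 1 1) (G n) - (1 / 6 + 2 / 3 * hom_density C3_digraph (G n))) \<longlonglongrightarrow> 0"
  proof (rule Lim_null_comparison[OF _ inverse_card_tendsto_0[OF G(2), of 1]], rule always_eventually, rule allI)
    show "norm (hom_density (S_digraph 1 1) (G n) - (1 / 6 + 2 / 3 * hom_density C3_digraph (G n))) \<le> 1 / real (card (pverts (G n)))" for n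
      using path_density_C3_density[OF G(1,3), of n] by simp
  qed
  moreover have "(\<lambda>n. hom_density (S_digraph 1 1) (G n) - (1 / 6 + 2 / 3 * hom_density C3_digraph (G n)))
      \<longlonglongrightarrow> \<Gamma> (S_digraph 1 1) - (1 / 6 + 2 / 3 * \<Gamma> C3_digraph)"
    by (intro tendsto_intros \<Gamma> pair_digraph_S_digraph pair_digraph_C3_digraph)
  ultimately show ?thesis using LIMSEQ_unique by fastforce
qed

lemma transitive_limit_density:
  assumes "tournament_limit \<Gamma>" "\<Gamma> C3_digraph = 0" "pair_digraph F"
  shows "\<Gamma> F = linear_extensions F / fact (card (pverts F))"
proof -
  obtain G :: "nat \<Rightarrow> nat pair_pre_digraph" where G: "\<And>n. tournament (G n)" "filterlim (\<lambda>n. card (pverts (G n))) at_top sequentially"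
    "\<And>n. pverts (G n) \<noteq> {}" and \<Gamma>: "\<And>F. pair_digraph F \<Longrightarrow> (\<lambda>n. hom_density F (G n)) \<longlonglongrightarrow> \<Gamma> F"
    using tournament_limit_sequence[OF assms(1)] by blast
  define k where "k = card (pverts F)"
  have "(\<lambda>n. real k ^ 2 / card (pverts (G n)) + real k ^ 3 * hom_density C3_digraph (G n)) \<longlonglongrightarrow> 0 + real k ^ 3 * 0"
    using \<Gamma>[OF pair_digraph_C3_digraph] unfolding assms(2)
    by (intro tendsto_add tendsto_mult_left inverse_card_tendsto_0 G)
  hence bound: "(\<lambda>n. real k ^ 2 / card (pverts (G n)) + real k ^ 3 * hom_density C3_digraph (G n)) \<longlonglongrightarrow> 0"
    by simp
  have "(\<lambda>n. hom_density F (G n) - linear_extensions F / fact k) \<longlonglongrightarrow> 0"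
  proof (rule Lim_null_comparison[OF _ bound], rule always_eventually, rule allI)
    show "norm (hom_density F (G n) - linear_extensions F / fact k)
        \<le> real k ^ 2 / card (pverts (G n)) + real k ^ 3 * hom_density C3_digraph (G n)" for n
      using hom_density_near_transitive[OF G(1) assms(3) G(3), of n] unfolding k_def by simp
  qed
  hence "(\<lambda>n. hom_density F (G n)) \<longlonglongrightarrow> linear_extensions F / fact k" by (rule LIM_zero_cancel)
  from LIMSEQ_unique[OF \<Gamma>[OF assms(3)] this] show ?thesis by (simp add: k_def)
qed

lemma transitive_limit_unique:
  assumes "tournament_limit \<Gamma>" "\<Gamma> C3_digraph = 0" "tournament_limit \<Gamma>\<^sub>0" "\<Gamma>\<^sub>0 C3_digraph = 0"
  shows "\<Gamma>\<^sub>0 = \<Gamma>"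
proof (rule ext)
  fix F show "\<Gamma>\<^sub>0 F = \<Gamma> F"
  proof (cases "pair_digraph F")
    case True
    thus ?thesis using assms by (simp add: transitive_limit_density)
  next
    case False
    have "\<Gamma> F = undefined" "\<Gamma>\<^sub>0 F = undefined"
      using tournament_limit_sequence[OF assms(1)] tournament_limit_sequence[OF assms(3)] False by blast+
    thus ?thesis by simp
  qed
qed

text \<open>The centre must come first and the leaves follow in any order. Among (n + 1)! orders
  this is a proportion 1 / (n + 1), the n-th moment of the uniform distribution.\<close>

lemma linear_extensions_out_star: "linear_extensions (S_digraph 0 n) = fact n"
proof -
  have verts: "pverts (S_digraph 0 n) = {0..n}" and arcs: "parcs (S_digraph 0 n) = {0} \<times> {0<..n}"
    by (auto simp: S_digraph_def)
  have "{\<pi>. \<pi> permutes {0..n} \<and> (\<forall>(i, j)\<in>{0} \<times> {0<..n}. \<pi> i < \<pi> j)} = {\<pi>. \<pi> permutes {0<..n}}"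
  proof (intro equalityI subsetI CollectI; elim CollectE)
    fix \<pi> assume \<pi>: "\<pi> permutes {0..n} \<and> (\<forall>(i, j)\<in>{0} \<times> {0<..n}. \<pi> i < \<pi> j)"
    have less: "\<forall>j\<in>{0<..n}. \<pi> 0 < \<pi> j" using \<pi> by simp
    have "0 \<in> \<pi> ` {0..n}" using \<pi> by (simp add: permutes_image)
    then obtain j where j: "j \<le> n" "\<pi> j = 0" by auto
    have "j = 0"
    proof (rule ccontr)
      assume "j \<noteq> 0"
      hence "\<pi> 0 < \<pi> j" using less j(1) by (intro less[rule_format]) simp
      thus False using j by simp
    qed
    with j have "\<pi> 0 = 0" by simp
    show "\<pi> permutes {0<..n}"
    proof (rule permutes_superset)
      show "\<pi> permutes {0..n}" using \<pi> by blast
      fix x assume "x \<in> {0..n} - {0<..n}"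
      hence "x = 0" by simp
      thus "\<pi> x = x" using \<open>\<pi> 0 = 0\<close> by simp
    qed
  next
    fix \<pi> assume \<pi>: "\<pi> permutes {0<..n}"
    have "\<pi> 0 = 0" using permutes_not_in[OF \<pi>, of 0] by simp
    moreover have "0 < \<pi> j" if "j \<in> {0<..n}" for j using that permutes_in_image[OF \<pi>, of j] by simp
    ultimately have "\<forall>(i, j)\<in>{0} \<times> {0<..n}. \<pi> i < \<pi> j" by simp
    moreover have "\<pi> permutes {0..n}" using \<pi> by (rule permutes_subset) auto
    ultimately show "\<pi> permutes {0..n} \<and> (\<forall>(i, j)\<in>{0} \<times> {0<..n}. \<pi> i < \<pi> j)" by blast
  qed
  thus ?thesis unfolding linear_extensions_def verts arcs
    using card_permutations[of "{0<..n}" n] by simp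
qed

lemma transitive_imp_uniform:
  assumes "tournament_limit \<Gamma>" "\<Gamma> C3_digraph = 0"
  shows "outdegree_distribution \<Gamma> = uniform_measure lborel {0..1}"
proof (rule moments_determine_distribution)
  show "(\<integral>y. y ^ k \<partial>outdegree_distribution \<Gamma>) = (\<integral>y. y ^ k \<partial>uniform_measure lborel {0..1})" for k
  proof -
    have "(\<integral>y. y ^ k \<partial>outdegree_distribution \<Gamma>) = \<Gamma> (S_digraph 0 k)"
      using outdegree_distribution_limit(3)[OF assms(1), of 0 k] by simp
    also have "\<dots> = fact k / fact (Suc k)"
      using transitive_limit_density[OF assms pair_digraph_S_digraph, of 0 k]
      by (simp only: linear_extensions_out_star card_pverts_S add_0 of_nat_fact)
    also have "\<dots> = 1 / (real k + 1)" by (simp add: add.commute)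
    finally show ?thesis by (simp add: uniform_unit_distribution(3))
  qed
qed (use outdegree_distribution_limit[OF assms(1)] uniform_unit_distribution in blast)+

lemma path_density_outdegree:
  assumes "tournament_limit \<Gamma>"
  shows "\<Gamma> (S_digraph 1 1) = (\<integral>y. (1 - y) * y \<partial>outdegree_distribution \<Gamma>)"
  using outdegree_distribution_limit(3)[OF assms, of 1 1] by simp

lemma uniform_path_moment: "(\<integral>y. (1 - y) * y \<partial>uniform_measure lborel {0..1::real}) = 1 / 6"
proof -
  let ?U = "uniform_measure lborel {0..1::real}"
  interpret real_distribution ?U by (rule uniform_unit_distribution)
  have int: "integrable ?U (\<lambda>y. y ^ k)" for k
  proof (rule integrable_AE_bounded[OF prob_space_axioms, of _ 1])
    show "AE y in ?U. \<bar>y ^ k\<bar> \<le> 1"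
      using uniform_unit_distribution(2) by (rule AE_mp) (auto simp: power_abs power_le_one)
  qed simp
  have "(\<integral>y. (1 - y) * y \<partial>?U) = (\<integral>y. y ^ 1 - y ^ 2 \<partial>?U)"
    by (simp add: algebra_simps power2_eq_square)
  also have "\<dots> = (\<integral>y. y ^ 1 \<partial>?U) - (\<integral>y. y ^ 2 \<partial>?U)" by (rule Bochner_Integration.integral_diff[OF int int])
  also have "\<dots> = 1 / 6" unfolding uniform_unit_distribution(3) by simp
  finally show ?thesis .
qed

section \<open>A limit with cyclic triangles is not determined by its degrees\<close>

lemma codegree_energy_scale: "codegree_energy V (\<lambda>x y. a * P x y) = a ^ 4 * codegree_energy V P"
proof -
  have "(\<Sum>y\<in>V. a * P x y * (a * P x' y)) = a\<^sup>2 * (\<Sum>y\<in>V. P x y * P x' y)" for x x'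
    by (simp add: sum_distrib_left power2_eq_square mult_ac)
  hence "(\<Sum>y\<in>V. a * P x y * (a * P x' y))\<^sup>2 = a ^ 4 * (\<Sum>y\<in>V. P x y * P x' y)\<^sup>2" for x x'
    by (simp only: power_mult_distrib power_mult[symmetric]) simp
  thus ?thesis unfolding codegree_energy_def by (simp only: sum_distrib_left)
qed

lemma hom_density_K22:
  assumes "finite (pverts G)"
  shows "hom_density K22_digraph G = codegree_energy (pverts G) (adj G) / real (card (pverts G)) ^ 4"
proof -
  have "card (pverts K22_digraph) = 4" by (simp add: K22_digraph_def)
  thus ?thesis by (simp only: hom_density_def hom_count_K22[OF assms])
qed

text \<open>The weight K = N * sqrt N of the score error balances two losses. Energies lie between 0
  and N^4, so the normalised score error is of order N / K, which requires K to exceed the order N;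
  the diagonal correction K N^2 changes the normalised energy by K / N^2, which requires K to stay
  below the order N^2. With K = N^(3/2) both are of order 1 / sqrt N.\<close>

lemma round_to_tournament:
  fixes G :: "'a::linorder pair_pre_digraph"
  assumes G: "tournament G" "pverts G \<noteq> {}" and W: "weighted_tournament (pverts G) W"
    and rows: "\<And>x. x \<in> pverts G \<Longrightarrow> (\<Sum>y\<in>pverts G. W x y) = outscore G x" and \<sigma>: "\<sigma> \<in> {-1, 1}"
  defines "N \<equiv> real (card (pverts G))"
  shows "\<exists>H. tournament H \<and> pverts H = pverts G \<and>
     (\<Sum>x\<in>pverts G. (outscore H x - outscore G x)\<^sup>2) / N ^ 3 \<le> 4 / sqrt N \<and>
     \<sigma> * (hom_density K22_digraph H - codegree_energy (pverts G) W / N ^ 4) \<le> 3 / sqrt N"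
proof -
  define V where "V = pverts G"
  define s where "s = sqrt N"
  note fin = tournament_finite[OF G(1), folded V_def]
  have N: "N \<ge> 1" using fin G(2) by (simp add: N_def V_def[symmetric] Suc_le_eq card_gt_0_iff)
  have s: "s \<ge> 1" "N = s\<^sup>2" using N by (auto simp: s_def)
  have NV: "real (card V) = N" by (simp add: N_def V_def)
  obtain R where R: "weighted_tournament V R" "\<And>x y. x \<in> V \<Longrightarrow> y \<in> V \<Longrightarrow> R x y \<in> {0, 1}" and
    le: "N * s * (\<Sum>x\<in>V. ((\<Sum>y\<in>V. R x y) - (\<Sum>y\<in>V. W x y))\<^sup>2) + \<sigma> * codegree_energy V R
      \<le> \<sigma> * codegree_energy V W + N * s * N\<^sup>2 + 2 * N ^ 3"
    using round_weighted_tournament[OF fin W[folded V_def] \<sigma>, of "N * s"] N s(1) NV by auto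
  obtain H where H: "tournament H" "pverts H = V" "\<And>x y. x \<in> V \<Longrightarrow> y \<in> V \<Longrightarrow> adj H x y = R x y"
    using ex_tournament_of_weights[OF fin R] by blast
  define D where "D = (\<Sum>x\<in>V. (outscore H x - outscore G x)\<^sup>2)"
  define e f where "e = codegree_energy V R" and "f = codegree_energy V W"
  have "D = (\<Sum>x\<in>V. ((\<Sum>y\<in>V. R x y) - (\<Sum>y\<in>V. W x y))\<^sup>2)"
    unfolding D_def by (intro sum.cong refl) (simp add: outscore_def[of H] H rows V_def[symmetric] rows[folded V_def])
  with le have le: "N * s * D + \<sigma> * e \<le> \<sigma> * f + N * s * N\<^sup>2 + 2 * N ^ 3" by (simp add: e_def f_def)
  have D0: "0 \<le> D" unfolding D_def by (intro sum_nonneg) simp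
  have ef: "0 \<le> e" "e \<le> N ^ 4" "0 \<le> f" "f \<le> N ^ 4"
    using codegree_energy_le[OF R(1) fin] codegree_energy_le[OF W[folded V_def] fin] codegree_energy_nonneg
    by (simp_all add: e_def f_def N_def V_def)
  \<comment> \<open>To bound the score error, the energies need only their trivial bounds. The
    constant 4 = 1 + 1 + 2 below collects this term and the two rounding losses.\<close>
  have "\<sigma> * f - \<sigma> * e \<le> N ^ 4" using \<sigma> ef by auto
  hence 1: "s ^ 3 * D \<le> s ^ 8 + s ^ 7 + 2 * s ^ 6"
    using le unfolding s(2) by (simp add: power_mult[symmetric] eval_nat_numeral mult_ac)
  have "s ^ 7 \<le> s ^ 8" "s ^ 6 \<le> s ^ 8" using s(1) by (intro power_increasing; simp)+
  hence 1: "s ^ 3 * D \<le> 4 * s ^ 8" using 1 by linarith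
  have "D / N ^ 3 = (s ^ 3 * D) / s ^ 9"
    using s(1) unfolding s(2) by (simp add: power_mult[symmetric] field_simps eval_nat_numeral)
  also have "\<dots> \<le> 4 * s ^ 8 / s ^ 9" using 1 s(1) by (intro divide_right_mono) auto
  also have "\<dots> = 4 / s" using s(1) by (simp add: field_simps eval_nat_numeral)
  finally have first: "D / N ^ 3 \<le> 4 / s" .
  \<comment> \<open>To bound the energy, the nonnegative score term is dropped instead.\<close>
  have "0 \<le> N * s * D" using N s D0 by (intro mult_nonneg_nonneg) auto
  hence 2: "\<sigma> * (e - f) \<le> s ^ 7 + 2 * s ^ 6"
    using le unfolding s(2) by (simp add: power_mult[symmetric] eval_nat_numeral algebra_simps)
  have "s ^ 6 \<le> s ^ 7" using s(1) by (intro power_increasing) auto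
  with 2 have 2: "\<sigma> * (e - f) \<le> 3 * s ^ 7" by linarith
  have "codegree_energy V (adj H) = e"
    unfolding e_def by (rule codegree_energy_cong) (rule H(3))
  hence "hom_density K22_digraph H = e / N ^ 4"
    using hom_density_K22[of H] fin H(2) by (simp add: N_def V_def)
  hence "\<sigma> * (hom_density K22_digraph H - f / N ^ 4) = \<sigma> * (e - f) / s ^ 8"
    unfolding s(2) by (simp add: power_mult[symmetric] diff_divide_distrib right_diff_distrib)
  also have "\<dots> \<le> 3 * s ^ 7 / s ^ 8" using 2 s(1) by (intro divide_right_mono) auto
  also have "\<dots> = 3 / s" using s(1) by (simp add: field_simps eval_nat_numeral)
  finally have "\<sigma> * (hom_density K22_digraph H - f / N ^ 4) \<le> 3 / s" .
  with first H(1,2) show ?thesis unfolding D_def V_def f_def s_def by blast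
qed

text \<open>The term with $C_3$ is the convexity gap between the midpoint $H$ and the end points $G$, $H'$ of
  a segment of weighted tournaments with equal scores.\<close>

lemma ex_tournaments_same_scores:
  fixes G :: "'a::linorder pair_pre_digraph"
  assumes G: "tournament G" "pverts G \<noteq> {}"
  defines "N \<equiv> real (card (pverts G))"
  shows "\<exists>H H'. tournament H \<and> pverts H = pverts G \<and> tournament H' \<and> pverts H' = pverts G \<and>
     (\<Sum>x\<in>pverts G. (outscore H x - outscore G x)\<^sup>2) / N ^ 3 \<le> 4 / sqrt N \<and>
     (\<Sum>x\<in>pverts G. (outscore H' x - outscore G x)\<^sup>2) / N ^ 3 \<le> 4 / sqrt N \<and>
     2 * hom_density K22_digraph H + (hom_density C3_digraph G / 27) ^ 4 / 8
       \<le> hom_density K22_digraph H' + hom_density K22_digraph G + 9 / sqrt N"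
proof -
  define V w where "V = pverts G" and "w = adj G"
  note fin = tournament_finite[OF G(1), folded V_def]
  have N: "N > 0" using fin G(2) by (simp add: N_def V_def[symmetric] card_gt_0_iff)
  define T where "T = (\<Sum>x\<in>V. \<Sum>y\<in>V. \<Sum>z\<in>V. w x y * w y z * w z x)"
  have wt: "weighted_tournament V w" unfolding V_def w_def by (rule weighted_tournament_adj[OF G(1)])
  obtain P where P: "\<And>s. s \<in> {0..1} \<Longrightarrow> weighted_tournament V (\<lambda>x y. w x y + s * P x y)"
    and rows: "\<And>x. x \<in> V \<Longrightarrow> (\<Sum>y\<in>V. P x y) = 0"
    and low: "(T / 27) ^ 4 \<le> N ^ 8 * codegree_energy V P"
    using ex_score_preserving_perturbation[OF fin wt] unfolding T_def N_def V_def[symmetric] by blast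
  define E where "E s = codegree_energy V (\<lambda>x y. w x y + s * P x y) / N ^ 4" for s
  have round: "\<exists>H. tournament H \<and> pverts H = V \<and>
     (\<Sum>x\<in>V. (outscore H x - outscore G x)\<^sup>2) / N ^ 3 \<le> 4 / sqrt N \<and>
     \<sigma> * (hom_density K22_digraph H - E s) \<le> 3 / sqrt N" if "s \<in> {0..1}" "\<sigma> \<in> {-1, 1}" for s \<sigma>
  proof -
    have "(\<Sum>y\<in>V. w x y + s * P x y) = outscore G x" if "x \<in> V" for x
      using rows[OF that] by (simp add: sum.distrib sum_distrib_left[symmetric] outscore_def w_def V_def)
    thus ?thesis
      using round_to_tournament[OF G, folded V_def, OF P[OF that(1)] _ that(2)]
      unfolding E_def N_def V_def by blast
  qed
  \<comment> \<open>The midpoint must not gain energy and the end point must not lose any, hence the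
    opposite signs of the two roundings. The end point \<open>G\<close> is a genuine tournament
    already.\<close>
  obtain H where H: "tournament H" "pverts H = V" "(\<Sum>x\<in>V. (outscore H x - outscore G x)\<^sup>2) / N ^ 3 \<le> 4 / sqrt N"
    "1 * (hom_density K22_digraph H - E (1/2)) \<le> 3 / sqrt N"
    using round[of "1/2" 1] by auto
  obtain H' where H': "tournament H'" "pverts H' = V" "(\<Sum>x\<in>V. (outscore H' x - outscore G x)\<^sup>2) / N ^ 3 \<le> 4 / sqrt N"
    "(-1) * (hom_density K22_digraph H' - E 1) \<le> 3 / sqrt N"
    using round[of 1 "-1"] by auto
  have E0: "hom_density K22_digraph G = E 0"
    using hom_density_K22[OF tournament_finite[OF G(1)]] by (simp add: E_def N_def V_def w_def)
  have "hom_density C3_digraph G = T / N ^ 3"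
    using hom_count_C3[OF tournament_finite[OF G(1)]]
    by (simp add: hom_density_def T_def V_def w_def N_def C3_digraph_def eval_nat_numeral)
  hence "(hom_density C3_digraph G / 27) ^ 4 = (T / 27) ^ 4 / N ^ 12"
    by (simp add: power_divide power_mult[symmetric])
  also have "\<dots> \<le> N ^ 8 * codegree_energy V P / N ^ 12"
    using low N by (intro divide_right_mono) auto
  also have "\<dots> = codegree_energy V P / N ^ 4" using N by (simp add: field_simps eval_nat_numeral)
  finally have C3: "(hom_density C3_digraph G / 27) ^ 4 \<le> codegree_energy V P / N ^ 4" .
  \<comment> \<open>Convexity with centre w + P/2 and displacement P/2. The energy of P/2 is 1/16 of
    that of \<open>P\<close>, which leaves the gap 1/8.\<close>
  have "2 * codegree_energy V (\<lambda>x y. w x y + 1/2 * P x y) + 2 * codegree_energy V (\<lambda>x y. 1/2 * P x y)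
    \<le> codegree_energy V (\<lambda>x y. (w x y + 1/2 * P x y) + 1/2 * P x y)
      + codegree_energy V (\<lambda>x y. (w x y + 1/2 * P x y) - 1/2 * P x y)"
    by (rule codegree_energy_uniformly_convex)
  also have "(\<lambda>x y. (w x y + 1/2 * P x y) + 1/2 * P x y) = (\<lambda>x y. w x y + 1 * P x y)" by (simp add: fun_eq_iff)
  also have "(\<lambda>x y. (w x y + 1/2 * P x y) - 1/2 * P x y) = (\<lambda>x y. w x y + 0 * P x y)" by simp
  finally have "2 * codegree_energy V (\<lambda>x y. w x y + 1/2 * P x y) + codegree_energy V P / 8
    \<le> codegree_energy V (\<lambda>x y. w x y + 1 * P x y) + codegree_energy V (\<lambda>x y. w x y + 0 * P x y)"
    unfolding codegree_energy_scale by (simp add: power4_eq_xxxx)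
  from divide_right_mono[OF this, of "N ^ 4"] have gap: "2 * E (1/2) + codegree_energy V P / N ^ 4 / 8 \<le> E 1 + E 0"
    by (simp add: E_def add_divide_distrib mult_ac)
  \<comment> \<open>The rounding error 3 / sqrt N enters twice for \<open>H\<close> and once for
    \<open>H'\<close>, which gives 9 / sqrt N.\<close>
  have "2 * hom_density K22_digraph H + (hom_density C3_digraph G / 27) ^ 4 / 8
       \<le> hom_density K22_digraph H' + hom_density K22_digraph G + (3 / sqrt N + 3 / sqrt N + 3 / sqrt N)"
  proof -
    have arith: "2 * h + z / 8 \<le> h' + g + (u + u + u)"
      if "2 * a + b / 8 \<le> c + d" "1 * (h - a) \<le> u" "(-1) * (h' - c) \<le> u" "z \<le> b" "g = d"
      for a b c d g h h' u z :: real
    proof -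
      have "h \<le> a + u" "c \<le> h' + u" using that(2,3) by simp_all
      thus ?thesis using that(1,4,5) by linarith
    qed
    show ?thesis by (rule arith[OF gap H(4) H'(4) C3 E0])
  qed
  hence "2 * hom_density K22_digraph H + (hom_density C3_digraph G / 27) ^ 4 / 8
       \<le> hom_density K22_digraph H' + hom_density K22_digraph G + 9 / sqrt N" by simp
  with H(1-3) H'(1-3) show ?thesis unfolding V_def by blast
qed

text \<open>The score error tends to 0 in mean square, so all degree moments of \<open>H\<close> and
  \<open>G\<close> have the same limits. Compactness yields a limit of a subsequence of
  \<open>H\<close>, which therefore has the degree moments of \<Gamma>.\<close>

lemma same_scores_subsequence_limit:
  fixes G H :: "nat \<Rightarrow> nat pair_pre_digraph"
  assumes \<Gamma>: "\<And>m n. (\<lambda>i. hom_density (S_digraph m n) (G i)) \<longlonglongrightarrow> \<Gamma> (S_digraph m n)"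
    and G: "\<And>i. tournament (G i)" "\<And>i. pverts (G i) \<noteq> {}"
      "filterlim (\<lambda>i. card (pverts (G i))) at_top sequentially"
    and H: "\<And>i. tournament (H i)" "\<And>i. pverts (H i) = pverts (G i)"
    and close: "\<And>i. (\<Sum>x\<in>pverts (G i). (outscore (H i) x - outscore (G i) x)\<^sup>2) / real (card (pverts (G i))) ^ 3
       \<le> 4 / sqrt (real (card (pverts (G i))))"
  shows "\<exists>r \<Gamma>\<^sub>0. strict_mono r \<and> tournament_limit \<Gamma>\<^sub>0 \<and> (\<forall>m n. \<Gamma>\<^sub>0 (S_digraph m n) = \<Gamma> (S_digraph m n)) \<and>
    (\<forall>F. pair_digraph F \<longrightarrow> (\<lambda>i. hom_density F (H (r i))) \<longlonglongrightarrow> \<Gamma>\<^sub>0 F)"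
proof -
  let ?N = "\<lambda>i. real (card (pverts (G i)))"
  obtain r where r: "strict_mono r" and conv: "convergent_tournaments (H \<circ> r)"
    using ex_convergent_subsequence[of H] H G(3) by auto
  define \<Gamma>\<^sub>0 :: density_family where "\<Gamma>\<^sub>0 = (\<lambda>F\<in>{F. pair_digraph F}. lim (\<lambda>i. hom_density F ((H \<circ> r) i)))"
  have lim: "(\<lambda>i. hom_density F (H (r i))) \<longlonglongrightarrow> \<Gamma>\<^sub>0 F" if "pair_digraph F" for F
    using conv that by (simp add: convergent_tournaments_def \<Gamma>\<^sub>0_def convergent_LIMSEQ_iff)
  have "tournament_limit \<Gamma>\<^sub>0" unfolding tournament_limit_def \<Gamma>\<^sub>0_def using conv by blast
  moreover have "\<Gamma>\<^sub>0 (S_digraph m n) = \<Gamma> (S_digraph m n)" for m n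
  proof -
    have "(\<lambda>i. 4 / sqrt (?N i)) \<longlonglongrightarrow> 0"
      by (rule tendsto_divide_0[OF tendsto_const], rule filterlim_at_top_imp_at_infinity,
          rule filterlim_compose[OF sqrt_at_top filterlim_compose[OF filterlim_real_sequentially G(3)]])
    hence "(\<lambda>i. real (m + n) * sqrt (4 / sqrt (?N i))) \<longlonglongrightarrow> real (m + n) * sqrt 0"
      by (intro tendsto_mult_left tendsto_real_sqrt)
    hence bound: "(\<lambda>i. real (m + n) * sqrt (4 / sqrt (?N i))) \<longlonglongrightarrow> 0" by simp
    have "(\<lambda>i. hom_density (S_digraph m n) (H i) - hom_density (S_digraph m n) (G i)) \<longlonglongrightarrow> 0"
    proof (rule Lim_null_comparison[OF _ bound], rule always_eventually, rule allI)
      fix i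
      have "norm (hom_density (S_digraph m n) (H i) - hom_density (S_digraph m n) (G i))
        \<le> real (m + n) * sqrt ((\<Sum>x\<in>pverts (G i). (outscore (H i) x - outscore (G i) x)\<^sup>2) / ?N i ^ 3)"
        using hom_density_S_diff_le[OF G(1) H(1) H(2) G(2)] by simp
      also have "\<dots> \<le> real (m + n) * sqrt (4 / sqrt (?N i))"
        using close by (intro mult_left_mono real_sqrt_le_mono) auto
      finally show "norm (hom_density (S_digraph m n) (H i) - hom_density (S_digraph m n) (G i))
        \<le> real (m + n) * sqrt (4 / sqrt (?N i))" .
    qed
    from tendsto_add[OF this \<Gamma>[of m n]] have "(\<lambda>i. hom_density (S_digraph m n) (H i)) \<longlonglongrightarrow> \<Gamma> (S_digraph m n)"
      by simp
    from LIMSEQ_subseq_LIMSEQ[OF this r] have "(\<lambda>i. hom_density (S_digraph m n) (H (r i))) \<longlonglongrightarrow> \<Gamma> (S_digraph m n)"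
      by (simp add: comp_def)
    with lim[OF pair_digraph_S_digraph] show ?thesis by (rule LIMSEQ_unique)
  qed
  ultimately show ?thesis using r lim by blast
qed

lemma degree_distribution_cong:
  assumes "\<And>m n. \<Gamma>\<^sub>0 (S_digraph m n) = \<Gamma> (S_digraph m n)"
  shows "degree_distribution \<Gamma>\<^sub>0 = degree_distribution \<Gamma>"
  by (simp add: degree_distribution_def assms)

text \<open>By determinacy, every limit of a subsequence of \<open>H\<close> or \<open>H'\<close> is
  \<Gamma> itself. So all three densities in the convexity inequality tend to the same value and
  cancel, leaving (t(C_3)/27)^4 / 8 at most 0.\<close>

lemma determined_imp_transitive:
  assumes lim: "tournament_limit \<Gamma>"
    and det: "\<And>\<Gamma>\<^sub>0. tournament_limit \<Gamma>\<^sub>0 \<Longrightarrow> degree_distribution \<Gamma>\<^sub>0 = degree_distribution \<Gamma> \<Longrightarrow> \<Gamma>\<^sub>0 = \<Gamma>"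
  shows "\<Gamma> C3_digraph = 0"
proof -
  obtain G :: "nat \<Rightarrow> nat pair_pre_digraph" where G: "\<And>n. tournament (G n)" "\<And>n. pverts (G n) \<noteq> {}"
    "filterlim (\<lambda>n. card (pverts (G n))) at_top sequentially"
    and \<Gamma>: "\<And>F. pair_digraph F \<Longrightarrow> (\<lambda>n. hom_density F (G n)) \<longlonglongrightarrow> \<Gamma> F"
    using tournament_limit_sequence[OF lim] by blast
  let ?N = "\<lambda>i. real (card (pverts (G i)))"
  define Q where "Q i H H' \<longleftrightarrow> tournament H \<and> pverts H = pverts (G i) \<and> tournament H' \<and> pverts H' = pverts (G i) \<and>
     (\<Sum>x\<in>pverts (G i). (outscore H x - outscore (G i) x)\<^sup>2) / ?N i ^ 3 \<le> 4 / sqrt (?N i) \<and>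
     (\<Sum>x\<in>pverts (G i). (outscore H' x - outscore (G i) x)\<^sup>2) / ?N i ^ 3 \<le> 4 / sqrt (?N i) \<and>
     2 * hom_density K22_digraph H + (hom_density C3_digraph (G i) / 27) ^ 4 / 8
       \<le> hom_density K22_digraph H' + hom_density K22_digraph (G i) + 9 / sqrt (?N i)" for i H H'
  have "\<forall>i. \<exists>H H'. Q i H H'"
    unfolding Q_def using ex_tournaments_same_scores[OF G(1,2)] by blast
  then obtain H H' where "\<And>i. Q i (H i) (H' i)" by metis
  hence H: "\<And>i. tournament (H i)" "\<And>i. pverts (H i) = pverts (G i)"
      "\<And>i. (\<Sum>x\<in>pverts (G i). (outscore (H i) x - outscore (G i) x)\<^sup>2) / ?N i ^ 3 \<le> 4 / sqrt (?N i)"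
    and H': "\<And>i. tournament (H' i)" "\<And>i. pverts (H' i) = pverts (G i)"
      "\<And>i. (\<Sum>x\<in>pverts (G i). (outscore (H' i) x - outscore (G i) x)\<^sup>2) / ?N i ^ 3 \<le> 4 / sqrt (?N i)"
    and gap: "\<And>i. 2 * hom_density K22_digraph (H i) + (hom_density C3_digraph (G i) / 27) ^ 4 / 8
       \<le> hom_density K22_digraph (H' i) + hom_density K22_digraph (G i) + 9 / sqrt (?N i)"
    unfolding Q_def by blast+
  have sub: "\<exists>r. strict_mono r \<and> (\<lambda>i. hom_density K22_digraph (J (s (r i)))) \<longlonglongrightarrow> \<Gamma> K22_digraph"
    if s: "strict_mono s" and J: "\<And>i. tournament (J i)" "\<And>i. pverts (J i) = pverts (G i)"
      "\<And>i. (\<Sum>x\<in>pverts (G i). (outscore (J i) x - outscore (G i) x)\<^sup>2) / ?N i ^ 3 \<le> 4 / sqrt (?N i)"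
    for s :: "nat \<Rightarrow> nat" and J :: "nat \<Rightarrow> nat pair_pre_digraph"
  proof -
    have S: "(\<lambda>i. hom_density (S_digraph m n) (G (s i))) \<longlonglongrightarrow> \<Gamma> (S_digraph m n)" for m n
      using LIMSEQ_subseq_LIMSEQ[OF \<Gamma>[OF pair_digraph_S_digraph] s] by (simp add: comp_def)
    have sizes: "filterlim (\<lambda>i. card (pverts (G (s i)))) at_top sequentially"
      using filterlim_compose[OF G(3) filterlim_subseq[OF s]] .
    obtain r \<Gamma>\<^sub>0 where r: "strict_mono r" "tournament_limit \<Gamma>\<^sub>0"
      "\<And>m n. \<Gamma>\<^sub>0 (S_digraph m n) = \<Gamma> (S_digraph m n)"
      "\<And>F. pair_digraph F \<Longrightarrow> (\<lambda>i. hom_density F (J (s (r i)))) \<longlonglongrightarrow> \<Gamma>\<^sub>0 F"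
      using same_scores_subsequence_limit[where G = "\<lambda>i. G (s i)" and H = "\<lambda>i. J (s i)",
        OF S G(1,2) sizes J] by blast
    have "\<Gamma>\<^sub>0 = \<Gamma>" using r(2,3) by (intro det degree_distribution_cong)
    with r(1) r(4)[OF pair_digraph_K22_digraph] show ?thesis by blast
  qed
  obtain r where r: "strict_mono r" "(\<lambda>i. hom_density K22_digraph (H (r i))) \<longlonglongrightarrow> \<Gamma> K22_digraph"
    using sub[of id H] H by (auto simp: strict_mono_def)
  \<comment> \<open>The second subsequence is chosen inside the first, so that the inequality
    \<open>gap\<close> can be used along the common subsequence \<open>p\<close>.\<close>
  obtain q where q: "strict_mono q" "(\<lambda>i. hom_density K22_digraph (H' (r (q i)))) \<longlonglongrightarrow> \<Gamma> K22_digraph"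
    using sub[OF r(1), of H'] H' by blast
  define p where "p i = r (q i)" for i
  have p: "strict_mono p" using strict_mono_o[OF r(1) q(1)] by (simp add: p_def[abs_def] comp_def)
  have "(\<lambda>i. 9 / sqrt (?N i)) \<longlonglongrightarrow> 0"
    by (rule tendsto_divide_0[OF tendsto_const], rule filterlim_at_top_imp_at_infinity,
        rule filterlim_compose[OF sqrt_at_top filterlim_compose[OF filterlim_real_sequentially G(3)]])
  from LIMSEQ_subseq_LIMSEQ[OF this p] have small: "(\<lambda>i. 9 / sqrt (?N (p i))) \<longlonglongrightarrow> 0" by (simp add: comp_def)
  have Gp: "(\<lambda>i. hom_density F (G (p i))) \<longlonglongrightarrow> \<Gamma> F" if "pair_digraph F" for F
    using LIMSEQ_subseq_LIMSEQ[OF \<Gamma>[OF that] p] by (simp add: comp_def)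
  have Hp: "(\<lambda>i. hom_density K22_digraph (H (p i))) \<longlonglongrightarrow> \<Gamma> K22_digraph"
    using LIMSEQ_subseq_LIMSEQ[OF r(2) q(1)] by (simp add: comp_def p_def)
  have "2 * \<Gamma> K22_digraph + (\<Gamma> C3_digraph / 27) ^ 4 / 8 \<le> \<Gamma> K22_digraph + \<Gamma> K22_digraph + 0"
  proof (rule LIMSEQ_le)
    show "(\<lambda>i. 2 * hom_density K22_digraph (H (p i)) + (hom_density C3_digraph (G (p i)) / 27) ^ 4 / 8)
      \<longlonglongrightarrow> 2 * \<Gamma> K22_digraph + (\<Gamma> C3_digraph / 27) ^ 4 / 8"
      by (intro tendsto_intros Hp Gp pair_digraph_C3_digraph) simp_all
    show "(\<lambda>i. hom_density K22_digraph (H' (p i)) + hom_density K22_digraph (G (p i)) + 9 / sqrt (?N (p i)))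
      \<longlonglongrightarrow> \<Gamma> K22_digraph + \<Gamma> K22_digraph + 0"
      using q(2) unfolding p_def[symmetric] by (intro tendsto_add small Gp pair_digraph_K22_digraph)
  qed (use gap in blast)
  hence "(\<Gamma> C3_digraph / 27) ^ 4 \<le> 0" by simp
  thus ?thesis by (simp add: power_le_zero_eq)
qed

section \<open>Measure-preserving maps and the equivalence\<close>

lemma measure_preserving_distr_uniform:
  assumes "measure_preserving unit_interval f"
  shows "distr unit_interval borel f = uniform_measure lborel {0..1}"
proof (rule measure_eqI)
  have f: "f \<in> unit_interval \<rightarrow>\<^sub>M unit_interval"
    and mp: "\<And>A. A \<in> sets unit_interval \<Longrightarrow> emeasure unit_interval (f -` A \<inter> space unit_interval) = emeasure unit_interval A"
    using assms by (auto simp: measure_preserving_def)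
  have fb: "f \<in> borel_measurable unit_interval"
    using measurable_restrict_space2_iff[of f unit_interval lborel "{0..1}"] f by simp
  show "sets (distr unit_interval borel f) = sets (uniform_measure lborel {0..1})" by simp
  fix A assume "A \<in> sets (distr unit_interval borel f)"
  hence A: "A \<in> sets borel" by simp
  have B: "A \<inter> {0..1} \<in> sets unit_interval" using A by (auto simp: sets_restrict_space)
  have "f -` A \<inter> space unit_interval = f -` (A \<inter> {0..1}) \<inter> space unit_interval"
    using measurable_space[OF f] by (auto simp: space_restrict_space)
  \<comment> \<open>As \<open>f\<close> takes values in [0,1] only, its law ignores the rest of
    \<open>A\<close>, and measure preservation applies to the remaining part.\<close>
  hence "emeasure (distr unit_interval borel f) A = emeasure unit_interval (A \<inter> {0..1})"
    using fb A mp[OF B] by (simp add: emeasure_distr)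
  also have "\<dots> = emeasure lborel (A \<inter> {0..1})" using A by (intro emeasure_restrict_space) auto
  also have "\<dots> = emeasure (uniform_measure lborel {0..1}) A"
    using A by (simp add: Int_commute divide_ennreal_def)
  finally show "emeasure (distr unit_interval borel f) A = emeasure (uniform_measure lborel {0..1}) A" .
qed

lemma measure_preserving_id: "measure_preserving M id"
proof -
  have "id -` A \<inter> space M = A" if "A \<in> sets M" for A using sets.sets_into_space[OF that] by auto
  thus ?thesis unfolding measure_preserving_def by auto
qed

theorem mainTheorem3:
  fixes \<Gamma> :: density_family
  assumes "tournament_limit \<Gamma>"
  defines "cond_i \<equiv>
      \<forall>\<Gamma>\<^sub>0. tournament_limit \<Gamma>\<^sub>0 \<and> degree_distribution \<Gamma>\<^sub>0 = degree_distribution \<Gamma> \<longrightarrow> \<Gamma>\<^sub>0 = \<Gamma>"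
    and "cond_ii \<equiv>
      \<forall>\<Gamma>\<^sub>0. tournament_limit \<Gamma>\<^sub>0 \<and> outdegree_distribution \<Gamma>\<^sub>0 = outdegree_distribution \<Gamma> \<longrightarrow> \<Gamma>\<^sub>0 = \<Gamma>"
    and "cond_iii \<equiv> outdegree_distribution \<Gamma> = uniform_measure lborel {0..1}"
    and "cond_iv \<equiv>
      \<exists>f. measure_preserving unit_interval f \<and> outdegree_distribution \<Gamma> = distr unit_interval borel f"
    and "cond_v \<equiv> \<Gamma> (S_digraph 1 1) = 1 / 6"
    and "cond_vi \<equiv> \<Gamma> C3_digraph = 0"
  shows "(cond_i \<longleftrightarrow> cond_ii) \<and> (cond_ii \<longleftrightarrow> cond_iii) \<and> (cond_iii \<longleftrightarrow> cond_iv) \<and>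
         (cond_iv \<longleftrightarrow> cond_v) \<and> (cond_v \<longleftrightarrow> cond_vi)"
proof -
  note \<Gamma> = assms(1)
  have i_vi: "cond_i \<Longrightarrow> cond_vi"
    unfolding cond_i_def cond_vi_def using determined_imp_transitive[OF \<Gamma>] by blast
  have vi_iii: "cond_vi \<Longrightarrow> cond_iii"
    unfolding cond_vi_def cond_iii_def by (rule transitive_imp_uniform[OF \<Gamma>])
  have iii_v: "cond_iii \<Longrightarrow> cond_v"
    unfolding cond_iii_def cond_v_def path_density_outdegree[OF \<Gamma>] by (simp only: uniform_path_moment)
  have v_vi: "cond_v \<Longrightarrow> cond_vi"
    unfolding cond_v_def cond_vi_def path_C3_limit[OF \<Gamma>] by simp
  \<comment> \<open>The outdegree distribution fixes the density of \<open>S_digraph 1 1\<close>,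
    hence that of \<open>C3_digraph\<close>, and a limit where the latter is 0 is unique.\<close>
  have vi_ii: "cond_vi \<Longrightarrow> cond_ii"
    unfolding cond_vi_def cond_ii_def
  proof (intro allI impI, elim conjE)
    fix \<Gamma>\<^sub>0 assume C3: "\<Gamma> C3_digraph = 0" and \<Gamma>\<^sub>0: "tournament_limit \<Gamma>\<^sub>0"
      and eq: "outdegree_distribution \<Gamma>\<^sub>0 = outdegree_distribution \<Gamma>"
    have "\<Gamma>\<^sub>0 (S_digraph 1 1) = \<Gamma> (S_digraph 1 1)"
      unfolding path_density_outdegree[OF \<Gamma>] path_density_outdegree[OF \<Gamma>\<^sub>0] eq ..
    hence "\<Gamma>\<^sub>0 C3_digraph = 0" unfolding path_C3_limit[OF \<Gamma>] path_C3_limit[OF \<Gamma>\<^sub>0] C3 by simp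
    thus "\<Gamma>\<^sub>0 = \<Gamma>" using transitive_limit_unique[OF \<Gamma> C3 \<Gamma>\<^sub>0] by blast
  qed
  have ii_i: "cond_ii \<Longrightarrow> cond_i"
    unfolding cond_ii_def cond_i_def outdegree_distribution_def by metis
  \<comment> \<open>The identity is a witness; conversely every measure-preserving map has the
    uniform law.\<close>
  have iii_iv: "cond_iii \<Longrightarrow> cond_iv"
    unfolding cond_iii_def cond_iv_def
    using measure_preserving_id measure_preserving_distr_uniform by metis
  have iv_iii: "cond_iv \<Longrightarrow> cond_iii"
    unfolding cond_iii_def cond_iv_def using measure_preserving_distr_uniform by metis
  show ?thesis using i_vi vi_iii iii_v v_vi vi_ii ii_i iii_iv iv_iii by blast
qed

end
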